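(* Let $(k_n)_{n=1}^\infty$ be a sequence of positive integers, let $\{(G_{n,i},Q_{n,i},U_{n,i}): 1\le i\le k_n,\ n\ge1\}$ be a triangular array of random walks on finite groups and $\{p_{n,i}: 1\le i\le k_n,\ n\ge1\}$ a triangular array of positive reals; put $q_n=p_{n,1}+\cdots+p_{n,k_n}$. Let $\mathcal{F}^{\mathcal{P}}$ be the family whose $n$th random walk is the product of $(G_{n,i},Q_{n,i},U_{n,i})_{i=1}^{k_n}$ with respect to the probability vector $(p_{n,i}/q_n)_{i=1}^{k_n}$, and let $\mathcal{F}^{\mathcal{P}}_c$ be the family of associated continuous time random walks. Let $d_{n,\mathrm{TV}}^{(c)}$, $T_{n,\mathrm{TV}}^{(c)}$ (resp. $d_{n,\mathrm{TV}}$, $T_{n,\mathrm{TV}}$) be the total variation and its mixing time of the $n$th chain in $\mathcal{F}^{\mathcal{P}}_c$ (resp. $\mathcal{F}^{\mathcal{P}}$). Let $E_{n,i}$ be the support of $Q_{n,i}$ and $\rho_{n,i}$ the diameter of $(G_{n,i},E_{n,i})$. Assume that every $Q_{n,i}$ is symmetric, that $\inf\{Q_{n,i}(x): x\in E_{n,i},\,1\le i\le k_n,\,n\ge 1\}>0$, and that, for some constants $A,d$ not depending on $n,i$, $G_{n,i}$ has $(A,d)$-moderate growth with respect to $E_{n,i}$ for all $n,i$. Assume further that $\rho_{n,1}\ge4$ for $n$ large enough and that there are $C>1$ and $\ell_{n,i}>0$ satisfying $\ell_{n,i}\le\ell_{n,i+1}$ such that $\ell_{n,i}/C\le p_{n,i}/(q_n\rho_{n,i}^2)\le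 C\ell_{n,i}$ for all $n,i$. Set $t_n=\max\{\log(i+1)/\ell_{n,i}: 1\le i\le k_n\}$. Then: (1) If $k_n=O(1)$, then there are $A'>0$ and $\sigma_2>\sigma_1>0$ such that $$1-\exp\{-e^{-a\sigma_2}\}\le d_{n,\mathrm{TV}}^{(c)}(at_n)\le 1-\exp\{-e^{-a\sigma_1}\},\quad\forall a>A',\ n\ge1.$$ In particular, $\mathcal{F}^{\mathcal{P}}_c$ has no pre-cutoff in the total variation. (2) If $k_n\to\infty$ and $\min\{\rho_{n,i}: i\ge m,\ n\ge1\}\ge4$ for $m$ large enough, then the following are equivalent: (i) $\mathcal{F}^{\mathcal{P}}_c$ has a total variation cutoff. (ii) $\mathcal{F}^{\mathcal{P}}_c$ has a total variation pre-cutoff. (iii) $t_n\ell_{n,1}\to\infty$. (iv) $T_{n,\mathrm{TV}}^{(c)}(\epsilon)\ell_{n,1}\to\infty$ for all $\epsilon\in(0,1)$. (v) $T_{n,\mathrm{TV}}^{(c)}(\epsilon)\ell_{n,1}\to\infty$ for some $\epsilon\in(0,1)$. Moreover, if $\mathcal{F}^{\mathcal{P}}_c$ has a total variation cutoff, then $T_{n,\mathrm{TV}}^{(c)}(\epsilon)\asymp t_n$ and $T_{n,\mathrm{TV}}^{(c)}(\epsilon)=T_{n,\mathrm{TV}}^{(c)}(\delta)+O(1/\ell_{n,1})$ for all $0<\epsilon<\delta<1$. When $E_{n,i}$ contains the identity of $G_{n,i}$ (for all $n,i$), (2) also holds with $\mathcal{F}^{\mathcal{P}}_c$ and $T_{n,\mathrm{TV}}^{(c)}$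 replaced by $\mathcal{F}^{\mathcal{P}}$ and $T_{n,\mathrm{TV}}$.
   Context: Random walks. A (discrete time) random walk $(G,Q,U)$ on a finite group $G$ driven by a probability $Q$ is the Markov chain on $G$ with transition matrix $K(x,y)=Q(x^{-1}y)$; $U$ is the uniform distribution on $G$. $Q$ is symmetric if $Q(x)=Q(x^{-1})$ for all $x$. Random walks are taken irreducible. The associated continuous time random walk $(G,H_t,U)$ has semigroup $H_t=e^{t(K-I)}$, $t\ge0$. The total variations (independent of the starting point $x$) are $d_{\mathrm{TV}}(m)=\max_{F\subset G}\{K^m(x,F)-U(F)\}$ and $d^{(c)}_{\mathrm{TV}}(t)=\max_{F\subset G}\{H_t(x,F)-U(F)\}$; mixing times are $T_{\mathrm{TV}}(\epsilon)=\min\{m\in\mathbb{Z}_{\ge0}: d_{\mathrm{TV}}(m)\le\epsilon\}$ and $T^{(c)}_{\mathrm{TV}}(\epsilon)=\min\{t\ge0: d^{(c)}_{\mathrm{TV}}(t)\le\epsilon\}$. Products. The product of $(G_i,Q_i,U_i)_{i=1}^n$ with respect to a probability vector $(r_1,\dots,r_n)$ is the random walk on $G_1\times\cdots\times G_n$ which at each step chooses coordinate $i$ with probability $r_i$ and moves that coordinate according to $Q_i$, leaving the others fixed (i.e. driven by $Q=\sum_i r_i\check Q_i$, $\check Q_i$ being the image of $Q_i$ under the embedding of $G_i$ as $i$th factor). Its continuous time version has $H_t=H_{1,r_1t}\otimes\cdots\otimes H_{n,r_nt}$. Moderate growth. For $E\subset G$ and $m\ge1$, $E^m=\{x_1\cdots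 x_m: x_i\in E\}$; $E$ is a generating set if $E^m=G$ for some $m>0$. For a generating set $E$, $V(m)=|E^m|$ and the diameter of $(G,E)$ is $\rho=\min\{m\ge1: V(m)=|G|\}$. $G$ has $(A,d)$-moderate growth with respect to the generating set $E$ if $V(m)/V(\rho)\ge \frac1A(m/\rho)^d$ for all $1\le m\le\rho$. Cutoff. A family of discrete time walks with total variations $d_n$ and mixing times $T_n$, such that $T_n(\epsilon_0)\to\infty$ for some $\epsilon_0\in(0,1)$, has a total variation cutoff if $T_n(\epsilon)/T_n(\delta)\to1$ for all $\epsilon,\delta\in(0,1)$; equivalently there are $s_n>0$ with $d_n(\lceil as_n\rceil)\to0$ for all $a>1$ and $d_n(\lfloor as_n\rfloor)\to1$ for all $a\in(0,1)$. For continuous time families the definition is the same without $\lceil\cdot\rceil,\lfloor\cdot\rfloor$ and without the requirement $T_n(\epsilon_0)\to\infty$. Pre-cutoff. A discrete time family has a total variation pre-cutoff if there are $B>B'>0$ and $s_n>0$ with $\lim_n d_n(\lceil Bs_n\rceil)=0$ and $\liminf_n d_n(\lfloor B's_n\rfloor)>0$; in continuous time, the same without $\lceil\cdot\rceil,\lfloor\cdot\rfloor$. Notation. For positive sequences, $a_n=O(b_n)$ means $a_n/b_n$ is bounded, and $a_n\asymp b_n$ means $a_n=O(b_n)$ and $b_n=O(a_n)$; in the expression $c_n=d_n+O(b_n)$, $|c_n-d_n|/b_n$ is bounded.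
   Formalization: In (1) the lower bound is stated only for those n for which some G_{n,i} has more than one element; if all G_{n,1},...,G_{n,k_n} are trivial (possible for finitely many n), the total variation is 0 and the printed lower bound fails. *)

theory Defs
  imports
    "HOL-Probability.Probability"
    "HOL-Library.Landau_Symbols"
    "HOL-Algebra.Product_Groups"
begin

section \<open>Matrices indexed by a finite set\<close>

definition mat_one :: "'a \<Rightarrow> 'a \<Rightarrow> real" where
  "mat_one x y = (if x = y then 1 else 0)"

primrec mat_pow :: "'a set \<Rightarrow> ('a \<Rightarrow> 'a \<Rightarrow> real) \<Rightarrow> nat \<Rightarrow> 'a \<Rightarrow> 'a \<Rightarrow> real" where
  "mat_pow S M 0 = mat_one"
| "mat_pow S M (Suc m) = (\<lambda>x y. \<Sum>z\<in>S. mat_pow S M m x z * M z y)"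

definition mat_exp :: "'a set \<Rightarrow> ('a \<Rightarrow> 'a \<Rightarrow> real) \<Rightarrow> 'a \<Rightarrow> 'a \<Rightarrow> real" where
  "mat_exp S M x y = (\<Sum>m. mat_pow S M m x y / fact m)"


section \<open>Random walks on finite groups\<close>

definition transition :: "('a, 'b) monoid_scheme \<Rightarrow> 'a pmf \<Rightarrow> 'a \<Rightarrow> 'a \<Rightarrow> real" where
  "transition G Q x y = pmf Q (inv\<^bsub>G\<^esub> x \<otimes>\<^bsub>G\<^esub> y)"

definition iterate :: "('a, 'b) monoid_scheme \<Rightarrow> 'a pmf \<Rightarrow> nat \<Rightarrow> 'a \<Rightarrow> 'a \<Rightarrow> real" where
  "iterate G Q = mat_pow (carrier G) (transition G Q)"

definition heat_kernel :: "('a, 'b) monoid_scheme \<Rightarrow> 'a pmf \<Rightarrow> real \<Rightarrow> 'a \<Rightarrow> 'a \<Rightarrow> real" where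
  "heat_kernel G Q t =
     mat_exp (carrier G) (\<lambda>x y. t * (transition G Q x y - mat_one x y))"

locale random_walk = group G for G (structure) +
  fixes Q :: "'a pmf"
  assumes finite_carrier: "finite (carrier G)"
    and support_subset: "set_pmf Q \<subseteq> carrier G"
    and irreducible:
      "\<And>x y. x \<in> carrier G \<Longrightarrow> y \<in> carrier G \<Longrightarrow> \<exists>m. iterate G Q m x y > 0"

definition symmetric_driver :: "('a, 'b) monoid_scheme \<Rightarrow> 'a pmf \<Rightarrow> bool" where
  "symmetric_driver G Q \<longleftrightarrow> (\<forall>x\<in>carrier G. pmf Q x = pmf Q (inv\<^bsub>G\<^esub> x))"

text \<open>For each coordinate \<open>i \<in> I\<close>, the embedding of \<open>G i\<close> as a factor of
  \<^const>\<open>product_group\<close>, whose elements are extensional functions on \<open>I\<close>.\<close>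

definition factor_embed :: "'i set \<Rightarrow> ('i \<Rightarrow> ('a, 'b) monoid_scheme) \<Rightarrow> 'i \<Rightarrow> 'a \<Rightarrow> 'i \<Rightarrow> 'a" where
  "factor_embed I G i x = (\<lambda>j\<in>I. if j = i then x else \<one>\<^bsub>G j\<^esub>)"

definition product_driver ::
    "'i set \<Rightarrow> ('i \<Rightarrow> real) \<Rightarrow> ('i \<Rightarrow> ('a, 'b) monoid_scheme) \<Rightarrow> ('i \<Rightarrow> 'a pmf) \<Rightarrow> ('i \<Rightarrow> 'a) pmf" where
  "product_driver I r G Q =
     bind_pmf (embed_pmf (\<lambda>i. if i \<in> I then r i else 0))
       (\<lambda>i. map_pmf (factor_embed I G i) (Q i))"

lemma pmf_product_driver:
  assumes "finite I" "\<And>i. i \<in> I \<Longrightarrow> 0 \<le> r i" "sum r I = 1"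
  shows "pmf (product_driver I r G Q) g =
         (\<Sum>i\<in>I. r i * pmf (map_pmf (factor_embed I G i) (Q i)) g)"
proof -
  let ?f = "\<lambda>i. if i \<in> I then r i else 0"
  have int: "(\<integral>\<^sup>+ i. ennreal (?f i) \<partial>count_space UNIV) = 1"
  proof -
    have "(\<integral>\<^sup>+ i. ennreal (?f i) \<partial>count_space UNIV) = (\<integral>\<^sup>+ i. ennreal (r i) \<partial>count_space I)"
      by (subst nn_integral_count_space_indicator)
         (auto intro!: nn_integral_cong simp: indicator_def)
    also have "\<dots> = (\<Sum>i\<in>I. ennreal (r i))"
      by (rule nn_integral_count_space_finite) (fact assms)
    also have "\<dots> = 1"
      using assms by (simp add: sum_ennreal)
    finally show ?thesis .
  qed
  have pmf_f: "pmf (embed_pmf ?f) i = ?f i" for i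
    by (rule pmf_embed_pmf) (use assms int in auto)
  have "set_pmf (embed_pmf ?f) \<subseteq> I"
    by (auto simp: set_pmf_eq pmf_f split: if_splits)
  then have "pmf (product_driver I r G Q) g =
      (\<Sum>i\<in>I. pmf (embed_pmf ?f) i * pmf (map_pmf (factor_embed I G i) (Q i)) g)"
    unfolding product_driver_def pmf_bind
    by (subst integral_measure_pmf[OF assms(1)]) auto
  then show ?thesis
    by (simp add: pmf_f)
qed


section \<open>Total variation and mixing times\<close>

definition tv_uniform :: "('a, 'b) monoid_scheme \<Rightarrow> ('a \<Rightarrow> real) \<Rightarrow> real" where
  "tv_uniform G \<mu> =
     Max ((\<lambda>F. (\<Sum>y\<in>F. \<mu> y) - measure_pmf.prob (pmf_of_set (carrier G)) F) ` Pow (carrier G))"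

text \<open>The walks are started at the identity; by translation invariance the starting point
  is irrelevant, see \<open>tv_start\<close> and \<open>tv_c_start\<close> below.\<close>

definition tv :: "('a, 'b) monoid_scheme \<Rightarrow> 'a pmf \<Rightarrow> nat \<Rightarrow> real" where
  "tv G Q m = tv_uniform G (iterate G Q m \<one>\<^bsub>G\<^esub>)"

definition tv_c :: "('a, 'b) monoid_scheme \<Rightarrow> 'a pmf \<Rightarrow> real \<Rightarrow> real" where
  "tv_c G Q t = tv_uniform G (heat_kernel G Q t \<one>\<^bsub>G\<^esub>)"

definition mixing_time :: "(nat \<Rightarrow> real) \<Rightarrow> real \<Rightarrow> nat" where
  "mixing_time d \<epsilon> = (LEAST m. d m \<le> \<epsilon>)"

text \<open>The infimum is a minimum, since the total variation is continuous in \<open>t\<close>.\<close>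

definition mixing_time_c :: "(real \<Rightarrow> real) \<Rightarrow> real \<Rightarrow> real" where
  "mixing_time_c d \<epsilon> = Inf {t. 0 \<le> t \<and> d t \<le> \<epsilon>}"

context group
begin

lemma mat_pow_translate:
  assumes inv: "\<And>g x y. g \<in> carrier G \<Longrightarrow> x \<in> carrier G \<Longrightarrow> y \<in> carrier G
                  \<Longrightarrow> M (g \<otimes> x) (g \<otimes> y) = M x y"
    and "g \<in> carrier G" "x \<in> carrier G" "y \<in> carrier G"
  shows "mat_pow (carrier G) M m (g \<otimes> x) (g \<otimes> y) = mat_pow (carrier G) M m x y"
  using assms(2-)
proof (induction m arbitrary: x y)
  case 0
  then show ?case by (simp add: mat_one_def)
next
  case (Suc m)
  have "(\<Sum>z\<in>carrier G. mat_pow (carrier G) M m (g \<otimes> x) z * M z (g \<otimes> y)) =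
        (\<Sum>z\<in>carrier G. mat_pow (carrier G) M m (g \<otimes> x) (g \<otimes> z) * M (g \<otimes> z) (g \<otimes> y))"
    using Suc.prems
    by (intro sum.reindex_bij_witness[where i = "\<lambda>z. g \<otimes> z" and j = "\<lambda>z. inv g \<otimes> z"])
       (auto simp: m_assoc[symmetric])
  also have "\<dots> = (\<Sum>z\<in>carrier G. mat_pow (carrier G) M m x z * M z y)"
    using Suc by (intro sum.cong) (auto simp: inv)
  finally show ?case by simp
qed

lemma transition_translate:
  assumes "g \<in> carrier G" "x \<in> carrier G" "y \<in> carrier G"
  shows "transition G Q (g \<otimes> x) (g \<otimes> y) = transition G Q x y"
proof -
  have "inv (g \<otimes> x) \<otimes> (g \<otimes> y) = inv x \<otimes> (inv g \<otimes> (g \<otimes> y))"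
    using assms by (simp add: inv_mult_group m_assoc)
  also have "\<dots> = inv x \<otimes> y"
    using assms by (simp add: m_assoc[symmetric])
  finally show ?thesis by (simp add: transition_def)
qed

lemma iterate_translate:
  assumes "g \<in> carrier G" "x \<in> carrier G" "y \<in> carrier G"
  shows "iterate G Q m (g \<otimes> x) (g \<otimes> y) = iterate G Q m x y"
  unfolding iterate_def using assms by (intro mat_pow_translate) (auto simp: transition_translate)

lemma heat_kernel_translate:
  assumes "g \<in> carrier G" "x \<in> carrier G" "y \<in> carrier G"
  shows "heat_kernel G Q t (g \<otimes> x) (g \<otimes> y) = heat_kernel G Q t x y"
  unfolding heat_kernel_def mat_exp_def using assms
  by (subst mat_pow_translate) (auto simp: transition_translate mat_one_def)

lemma tv_uniform_translate:
  assumes fin: "finite (carrier G)" and g: "g \<in> carrier G"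
    and eq: "\<And>y. y \<in> carrier G \<Longrightarrow> \<mu> (g \<otimes> y) = \<nu> y"
  shows "tv_uniform G \<mu> = tv_uniform G \<nu>"
proof -
  let ?h = "\<lambda>\<mu> F. (\<Sum>y\<in>F. \<mu> y) - measure_pmf.prob (pmf_of_set (carrier G)) F"
  let ?L = "\<lambda>F. (\<lambda>y. g \<otimes> y) ` F"
  have ne: "carrier G \<noteq> {}" by auto
  have inj: "inj_on (\<lambda>y. g \<otimes> y) (carrier G)"
    using g by (auto simp: inj_on_def)
  have surj: "(\<lambda>y. g \<otimes> y) ` carrier G = carrier G"
    using surj_const_mult[OF g] .
  have *: "?h \<mu> (?L F) = ?h \<nu> F" if F: "F \<subseteq> carrier G" for F
  proof -
    have injF: "inj_on (\<lambda>y. g \<otimes> y) F" using inj F by (rule inj_on_subset)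
    have "?L F \<subseteq> carrier G" using F g by auto
    then have "measure_pmf.prob (pmf_of_set (carrier G)) (?L F) =
          measure_pmf.prob (pmf_of_set (carrier G)) F"
      using F fin ne card_image[OF injF]
      by (simp add: measure_pmf_of_set Int_absorb1)
    moreover have "(\<Sum>y\<in>?L F. \<mu> y) = (\<Sum>y\<in>F. \<nu> y)"
      using F by (subst sum.reindex[OF injF]) (auto intro!: sum.cong simp: eq)
    ultimately show ?thesis by simp
  qed
  have P: "Pow (carrier G) = ?L ` Pow (carrier G)"
    using surj by (metis image_Pow_surj)
  have "?h \<mu> ` Pow (carrier G) = ?h \<mu> ` ?L ` Pow (carrier G)"
    by (rule arg_cong[where f = "image (?h \<mu>)", OF P])
  also have "\<dots> = ?h \<nu> ` Pow (carrier G)"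
    unfolding image_image by (rule image_cong) (use * in auto)
  finally show ?thesis
    unfolding tv_uniform_def by (rule arg_cong)
qed

lemma tv_start:
  assumes "finite (carrier G)" "x \<in> carrier G"
  shows "tv_uniform G (iterate G Q m x) = tv G Q m"
  unfolding tv_def using assms iterate_translate[of x \<one>]
  by (intro tv_uniform_translate[where g = x]) auto

lemma tv_c_start:
  assumes "finite (carrier G)" "x \<in> carrier G"
  shows "tv_uniform G (heat_kernel G Q t x) = tv_c G Q t"
  unfolding tv_c_def using assms heat_kernel_translate[of x \<one>]
  by (intro tv_uniform_translate[where g = x]) auto

end


section \<open>Cutoff and pre-cutoff\<close>

text \<open>A family is given by its sequence of total variation functions.\<close>

definition tv_cutoff :: "(nat \<Rightarrow> nat \<Rightarrow> real) \<Rightarrow> bool" where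
  "tv_cutoff d \<longleftrightarrow>
     (\<exists>\<epsilon>0. 0 < \<epsilon>0 \<and> \<epsilon>0 < 1 \<and> filterlim (\<lambda>n. mixing_time (d n) \<epsilon>0) at_top sequentially) \<and>
     (\<forall>\<epsilon> \<delta>. 0 < \<epsilon> \<and> \<epsilon> < 1 \<and> 0 < \<delta> \<and> \<delta> < 1 \<longrightarrow>
        (\<lambda>n. real (mixing_time (d n) \<epsilon>) / real (mixing_time (d n) \<delta>)) \<longlonglongrightarrow> 1)"

definition tv_cutoff_c :: "(nat \<Rightarrow> real \<Rightarrow> real) \<Rightarrow> bool" where
  "tv_cutoff_c d \<longleftrightarrow>
     (\<forall>\<epsilon> \<delta>. 0 < \<epsilon> \<and> \<epsilon> < 1 \<and> 0 < \<delta> \<and> \<delta> < 1 \<longrightarrow>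
        (\<lambda>n. mixing_time_c (d n) \<epsilon> / mixing_time_c (d n) \<delta>) \<longlonglongrightarrow> 1)"

definition tv_precutoff :: "(nat \<Rightarrow> nat \<Rightarrow> real) \<Rightarrow> bool" where
  "tv_precutoff d \<longleftrightarrow>
     (\<exists>(B::real) (B'::real) (s::nat \<Rightarrow> real). 0 < B' \<and> B' < B \<and> (\<forall>n. 0 < s n) \<and>
        (\<lambda>n. d n (nat \<lceil>B * s n\<rceil>)) \<longlonglongrightarrow> 0 \<and>
        liminf (\<lambda>n. ereal (d n (nat \<lfloor>B' * s n\<rfloor>))) > 0)"

definition tv_precutoff_c :: "(nat \<Rightarrow> real \<Rightarrow> real) \<Rightarrow> bool" where
  "tv_precutoff_c d \<longleftrightarrow>
     (\<exists>(B::real) (B'::real) (s::nat \<Rightarrow> real). 0 < B' \<and> B' < B \<and> (\<forall>n. 0 < s n) \<and>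
        (\<lambda>n. d n (B * s n)) \<longlonglongrightarrow> 0 \<and>
        liminf (\<lambda>n. ereal (d n (B' * s n))) > 0)"


section \<open>Moderate growth\<close>

primrec set_pow :: "('a, 'b) monoid_scheme \<Rightarrow> 'a set \<Rightarrow> nat \<Rightarrow> 'a set" where
  "set_pow G E 0 = {\<one>\<^bsub>G\<^esub>}"
| "set_pow G E (Suc m) = set_pow G E m <#>\<^bsub>G\<^esub> E"

text \<open>Stronger than \<^const>\<open>generate\<close>: a single power of \<open>E\<close> has to exhaust the group, and
  inverses are not adjoined.\<close>

definition generating_set :: "('a, 'b) monoid_scheme \<Rightarrow> 'a set \<Rightarrow> bool" where
  "generating_set G E \<longleftrightarrow> E \<subseteq> carrier G \<and> (\<exists>m>0. set_pow G E m = carrier G)"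

definition group_diameter :: "('a, 'b) monoid_scheme \<Rightarrow> 'a set \<Rightarrow> nat" where
  "group_diameter G E = (LEAST m. 1 \<le> m \<and> card (set_pow G E m) = card (carrier G))"

definition moderate_growth :: "real \<Rightarrow> real \<Rightarrow> ('a, 'b) monoid_scheme \<Rightarrow> 'a set \<Rightarrow> bool" where
  "moderate_growth A d G E \<longleftrightarrow>
     generating_set G E \<and>
     (\<forall>m. 1 \<le> m \<and> m \<le> group_diameter G E \<longrightarrow>
        real (card (set_pow G E m)) / real (card (set_pow G E (group_diameter G E)))
          \<ge> 1 / A * (real m / real (group_diameter G E)) powr d)"

end

theory Submission
  imports Defs
begin

text \<open>
  The proof is spectral.  A symmetric walk on a finite group has an orthonormal basis of
  eigenfunctions, with eigenvalues \<open>\<beta>\<^sub>j = 1 - \<lambda>\<^sub>j\<close>, and because the group acts transitively the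
  diagonal of every kernel built from them is constant.  Hence the squared \<open>L\<^sup>2\<close> distance of
  \<open>H\<^sub>t\<close> from uniformity is \<open>\<Sum> exp (- 2 t \<lambda>\<^sub>j)\<close>, summed over the nonconstant eigenfunctions.
  Products of eigenfunctions are eigenfunctions of a product walk, so there the heat kernel
  factorises, and with \<open>\<chi>\<^sub>i\<close> for the squared \<open>L\<^sup>2\<close> distance of the \<open>i\<close>th factor the product has squared
  \<open>L\<^sup>2\<close> distance \<open>\<Prod> (1 + \<chi>\<^sub>i) - 1\<close>.

  Moderate growth enters by averaging a function over the ball \<open>E\<^sup>r\<close>.  The average differs from
  the function by at most a multiple of \<open>r\<close> times the square root of the energy (\<open>ball_avg_poincare\<close>), whereas
  the averaging operator has squared Hilbert-Schmidt norm \<open>|G| / V(r)\<close>.  So at most a multiple of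
  \<open>|G| / V(r)\<close> eigenvalues satisfy \<open>\<lambda> \<le> c / r\<^sup>2\<close>; this gives the spectral gap \<open>c / \<rho>\<^sup>2\<close> and the bound
  \<open>\<Sum> exp (- t \<lambda>\<^sub>j) \<le> M\<close> for \<open>t \<ge> \<rho>\<^sup>2\<close> (\<open>heat_trace_le\<close>), with constants that depend on the growth and on
  the least positive mass of the driver only.  Conversely the word length is a test function
  which shows that some \<open>\<lambda>\<^sub>j\<close> is at most \<open>c / \<rho>\<^sup>2\<close> (\<open>small_eigenvalue\<close>).

  Let \<open>S(t) = \<Sum> \<chi>\<^sub>i\<close>.  Once every factor has run for its diffusive time \<open>\<rho>\<^sub>i\<^sup>2\<close>, the total variation of
  the product is controlled from both sides by \<open>S\<close>:
  \<open>1 - exp (- c S) \<le> d \<le> sqrt (exp S - 1) / 2\<close>.  The upper bound is the Cauchy-Schwarz inequality;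
  the lower one holds since Hellinger affinities multiply, and since for bounded densities the
  Hellinger distance is comparable to the \<open>L\<^sup>2\<close> distance.  Now \<open>S\<close> decays at least at rate \<open>\<ell>\<^sub>n\<^sub>,\<^sub>1\<close>, so
  \<open>d\<close> drops from near one to near zero within time \<open>O(1 / \<ell>\<^sub>n\<^sub>,\<^sub>1)\<close>; and \<open>t\<^sub>n\<close> is the right time scale,
  as at time \<open>a t\<^sub>n\<close> the \<open>i\<close>th factor contributes at most a multiple of \<open>(i + 1)\<close> to the power \<open>- c a\<close>
  (\<open>S_upper\<close>), while at a small multiple of \<open>t\<^sub>n\<close> the factors up to the maximising index make
  \<open>S\<close> large (\<open>S_large\<close>).  This proves that \<open>t\<^sub>n \<ell>\<^sub>n\<^sub>,\<^sub>1 \<rightarrow> \<infinity>\<close> implies cutoff.  If on the other hand \<open>t\<^sub>n \<ell>\<^sub>n\<^sub>,\<^sub>1\<close>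
  stays bounded along a subsequence, then the first factor alone keeps the total variation above
  \<open>exp (- c t \<ell>\<^sub>n\<^sub>,\<^sub>1) / 2\<close>, so that it does not vanish at any
  multiple of \<open>t\<^sub>n\<close> along this subsequence (\<open>precutoff_imp_separated\<close>); for a bounded number of factors this is always the case.

  In discrete time the distribution is no longer a product measure, but its \<open>L\<^sup>2\<close> norm is still a sum
  over the product spectrum.  If the identity has mass at least \<open>\<eta>\<close> then eigenvalues are at least
  \<open>2 \<eta> - 1\<close>, and \<open>\<beta>\<close> to the power \<open>2 m\<close> is at most \<open>exp (- 2 m (1 - \<beta>))\<close> plus \<open>1 - 2 \<eta>\<close> to the power
  \<open>2 m\<close>.  The second part is negligible, because the logarithm of the order of the product group is
  \<open>O(1 / \<ell>\<^sub>n\<^sub>,\<^sub>1)\<close>.  Lower bounds carry over since the heat kernel is a Poisson mixture of the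
  iterates; the comparison shifts time by a multiple of the square root of \<open>t\<^sub>n\<close>, which is
  \<open>O(1 / \<ell>\<^sub>n\<^sub>,\<^sub>1)\<close> too.
\<close>

section \<open>Orthonormal eigenbases of symmetric matrices\<close>

text \<open>Functions are tested from the left, \<open>\<phi> M = \<beta> \<phi>\<close>, which is the form that \<^const>\<open>mat_pow\<close> unfolds to.
  A frame is a basis once the completeness relation holds; completeness rather than maximality is
  the condition stored in \<open>eigenbasis\<close>, because it tensorises directly.\<close>

definition eigenframe ::
    "'a set \<Rightarrow> ('a \<Rightarrow> 'a \<Rightarrow> real) \<Rightarrow> 'j set \<Rightarrow> ('j \<Rightarrow> 'a \<Rightarrow> real) \<Rightarrow> ('j \<Rightarrow> real) \<Rightarrow> bool" where
  "eigenframe S M J \<phi> \<beta> \<longleftrightarrow> finite J \<and>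
     (\<forall>i\<in>J. \<forall>j\<in>J. (\<Sum>x\<in>S. \<phi> i x * \<phi> j x) = of_bool (i = j)) \<and>
     (\<forall>j\<in>J. \<forall>y\<in>S. (\<Sum>x\<in>S. \<phi> j x * M x y) = \<beta> j * \<phi> j y)"

definition eigenbasis ::
    "'a set \<Rightarrow> ('a \<Rightarrow> 'a \<Rightarrow> real) \<Rightarrow> 'j set \<Rightarrow> ('j \<Rightarrow> 'a \<Rightarrow> real) \<Rightarrow> ('j \<Rightarrow> real) \<Rightarrow> bool" where
  "eigenbasis S M J \<phi> \<beta> \<longleftrightarrow> eigenframe S M J \<phi> \<beta> \<and>
     (\<forall>x\<in>S. \<forall>y\<in>S. (\<Sum>j\<in>J. \<phi> j x * \<phi> j y) = of_bool (x = y))"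

lemma sum_of_bool_mult:
  assumes "finite S" "x \<in> S"
  shows "(\<Sum>y\<in>S. of_bool (x = y) * f y) = (f x :: real)"
    and "(\<Sum>y\<in>S. of_bool (y = x) * f y) = (f x :: real)"
  using assms by (simp_all add: of_bool_def if_distrib[of "\<lambda>u. u * _"] cong: if_cong)

text \<open>The function \<open>y \<mapsto> of_bool (x = y) - (\<Sum>j\<in>J. \<phi> j x * \<phi> j y)\<close> is the residual of the unit vector at \<open>x\<close> after
  projection to the frame.\<close>

lemma frame_residual:
  assumes S: "finite S" "x \<in> S" and F: "eigenframe S M J \<phi> \<beta>"
  shows "(\<Sum>y\<in>S. (of_bool (x = y) - (\<Sum>j\<in>J. \<phi> j x * \<phi> j y))\<^sup>2) = 1 - (\<Sum>j\<in>J. (\<phi> j x)\<^sup>2)"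
    and "i \<in> J \<Longrightarrow> (\<Sum>y\<in>S. (of_bool (x = y) - (\<Sum>j\<in>J. \<phi> j x * \<phi> j y)) * \<phi> i y) = 0"
proof -
  have J: "finite J" and orth: "\<And>i j. i \<in> J \<Longrightarrow> j \<in> J \<Longrightarrow> (\<Sum>x\<in>S. \<phi> i x * \<phi> j x) = of_bool (i = j)"
    using F by (auto simp: eigenframe_def)
  have proj: "(\<Sum>y\<in>S. (\<Sum>j\<in>J. \<phi> j x * \<phi> j y) * \<phi> i y) = \<phi> i x" if "i \<in> J" for i
  proof -
    have "(\<Sum>y\<in>S. (\<Sum>j\<in>J. \<phi> j x * \<phi> j y) * \<phi> i y) = (\<Sum>j\<in>J. \<phi> j x * (\<Sum>y\<in>S. \<phi> j y * \<phi> i y))"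
      by (simp add: sum_distrib_left sum_distrib_right mult.assoc) (rule sum.swap)
    also have "\<dots> = (\<Sum>j\<in>J. of_bool (j = i) * \<phi> j x)"
      using that by (intro sum.cong) (auto simp: orth)
    finally show ?thesis using sum_of_bool_mult(2)[OF J that] by simp
  qed
  show orth0: "(\<Sum>y\<in>S. (of_bool (x = y) - (\<Sum>j\<in>J. \<phi> j x * \<phi> j y)) * \<phi> i y) = 0" if "i \<in> J" for i
    using sum_of_bool_mult(1)[OF S] proj[OF that] by (simp add: left_diff_distrib sum_subtractf)
  let ?w = "\<lambda>y. of_bool (x = y) - (\<Sum>j\<in>J. \<phi> j x * \<phi> j y)"
  have "(\<Sum>y\<in>S. (?w y)\<^sup>2) = (\<Sum>y\<in>S. of_bool (x = y) * ?w y) - (\<Sum>y\<in>S. (\<Sum>j\<in>J. \<phi> j x * \<phi> j y) * ?w y)"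
    by (simp only: power2_eq_square left_diff_distrib sum_subtractf)
  also have "(\<Sum>y\<in>S. (\<Sum>j\<in>J. \<phi> j x * \<phi> j y) * ?w y) = (\<Sum>j\<in>J. \<phi> j x * (\<Sum>y\<in>S. ?w y * \<phi> j y))"
    by (simp only: sum_distrib_left sum_distrib_right) (subst sum.swap, simp add: mult_ac)
  also have "\<dots> = 0" by (simp add: orth0)
  also have "(\<Sum>y\<in>S. of_bool (x = y) * ?w y) = ?w x" by (rule sum_of_bool_mult(1)[OF S])
  finally show "(\<Sum>y\<in>S. (?w y)\<^sup>2) = 1 - (\<Sum>j\<in>J. (\<phi> j x)\<^sup>2)"
    by (simp add: power2_eq_square)
qed

lemma sum_frame_squares:
  assumes F: "eigenframe S M J \<phi> \<beta>"
  shows "(\<Sum>x\<in>S. \<Sum>j\<in>J. (\<phi> j x)\<^sup>2) = card J"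
  using F by (subst sum.swap) (simp add: eigenframe_def power2_eq_square)

text \<open>By Bessel's inequality the squared residuals are nonnegative, and they sum to
  \<open>card S - card J = 0\<close> over \<open>x\<close>.\<close>

lemma maximal_frame_is_basis:
  assumes S: "finite S" and F: "eigenframe S M J \<phi> \<beta>" and c: "card J = card S"
  shows "eigenbasis S M J \<phi> \<beta>"
  unfolding eigenbasis_def
proof (intro conjI ballI F)
  fix x y assume x: "x \<in> S" and y: "y \<in> S"
  have nonneg: "0 \<le> 1 - (\<Sum>j\<in>J. (\<phi> j x)\<^sup>2)" if "x \<in> S" for x
    unfolding frame_residual(1)[OF S that F, symmetric] by (intro sum_nonneg) auto
  have "(\<Sum>x\<in>S. 1 - (\<Sum>j\<in>J. (\<phi> j x)\<^sup>2)) = 0"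
    using sum_frame_squares[OF F] c by (simp add: sum_subtractf)
  then have "1 - (\<Sum>j\<in>J. (\<phi> j x)\<^sup>2) = 0"
    using x nonneg S by (subst (asm) sum_nonneg_eq_0_iff) auto
  then have "(\<Sum>y\<in>S. (of_bool (x = y) - (\<Sum>j\<in>J. \<phi> j x * \<phi> j y))\<^sup>2) = 0"
    using frame_residual(1)[OF S x F] by simp
  then have "(of_bool (x = y) - (\<Sum>j\<in>J. \<phi> j x * \<phi> j y))\<^sup>2 = 0"
    using S y by (subst (asm) sum_nonneg_eq_0_iff) auto
  then show "(\<Sum>j\<in>J. \<phi> j x * \<phi> j y) = of_bool (x = y)" by simp
qed

text \<open>The quadratic form of \<open>M\<close> attains its maximum on the unit sphere of the orthogonal complement of the
  frame, and a maximiser is an eigenvector.  The complement is nontrivial because the squared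
  residuals of the unit vectors sum to \<open>card S - card J > 0\<close>.\<close>

lemma frame_extend:
  fixes M :: "'a \<Rightarrow> 'a \<Rightarrow> real"
  assumes S: "finite S" and sym: "\<And>x y. x \<in> S \<Longrightarrow> y \<in> S \<Longrightarrow> M x y = M y x"
    and F: "eigenframe S M J \<phi> \<beta>" and c: "card J < card S"
  obtains f b where "(\<Sum>x\<in>S. f x * f x) = 1" "\<And>j. j \<in> J \<Longrightarrow> (\<Sum>x\<in>S. \<phi> j x * f x) = 0"
    "\<And>y. y \<in> S \<Longrightarrow> (\<Sum>x\<in>S. f x * M x y) = b * f y"
proof -
  define ip where "ip f g = (\<Sum>x\<in>S. f x * g x)" for f g :: "'a \<Rightarrow> real"
  define T where "T f y = (\<Sum>x\<in>S. f x * M x y)" for f :: "'a \<Rightarrow> real" and y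
  define P where "P f \<longleftrightarrow> (\<forall>j\<in>J. ip (\<phi> j) f = 0)" for f
  have ip_comm: "ip f g = ip g f" for f g by (simp add: ip_def mult.commute)
  have ip_add: "ip (\<lambda>x. f x + e * g x) h = ip f h + e * ip g h" for f g h e
    by (simp add: ip_def sum.distrib sum_distrib_left algebra_simps)
  have ip_scale: "ip (\<lambda>x. e * g x) h = e * ip g h" for g h e
    by (simp add: ip_def sum_distrib_left algebra_simps)
  have ip_add2: "ip h (\<lambda>x. f x + e * g x) = ip h f + e * ip h g" for f g h e
    by (simp add: ip_comm[of h] ip_add)
  have ip_scale2: "ip h (\<lambda>x. e * g x) = e * ip h g" for g h e
    by (simp add: ip_comm[of h] ip_scale)
  have T_self: "ip (T f) g = ip f (T g)" for f g
  proof -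
    have "ip (T f) g = (\<Sum>y\<in>S. \<Sum>x\<in>S. f x * M x y * g y)"
      by (simp add: ip_def T_def sum_distrib_right)
    also have "\<dots> = (\<Sum>x\<in>S. \<Sum>y\<in>S. f x * M x y * g y)" by (rule sum.swap)
    also have "\<dots> = ip f (T g)"
      unfolding ip_def T_def sum_distrib_left
      by (intro sum.cong refl) (simp add: sym mult_ac)
    finally show ?thesis .
  qed
  have T_add: "T (\<lambda>x. f x + e * g x) = (\<lambda>y. T f y + e * T g y)" for f g e
    by (rule ext) (simp add: T_def sum.distrib sum_distrib_left algebra_simps)
  have T_scale: "T (\<lambda>x. e * g x) = (\<lambda>y. e * T g y)" for g e
    by (rule ext) (simp add: T_def sum_distrib_left algebra_simps)
  have eig: "ip (\<phi> j) (T f) = \<beta> j * ip (\<phi> j) f" if "j \<in> J" for j f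
  proof -
    have "ip (T (\<phi> j)) f = ip (\<lambda>x. \<beta> j * \<phi> j x) f"
      using F that unfolding ip_def T_def eigenframe_def by (intro sum.cong) auto
    then show ?thesis using T_self[of "\<phi> j" f] ip_scale by simp
  qed
  have P_T: "P (T f)" if "P f" for f using that eig by (auto simp: P_def)
  have P_add: "P (\<lambda>x. f x + e * g x)" if "P f" "P g" for f g e
    using that by (simp add: P_def ip_add2)
  have P_scale: "P (\<lambda>x. e * g x)" if "P g" for g e
    using that by (simp add: P_def ip_scale2)
  have ip_pos: "ip f f \<ge> 0" for f by (auto simp: ip_def intro!: sum_nonneg)
  \<comment> \<open>Functions vanish off \<open>S\<close>, so that the sphere is compact in the product topology.\<close>
  define X where "X = {f. (\<forall>x. x \<notin> S \<longrightarrow> f x = 0) \<and> ip f f = 1 \<and> P f}"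
  have normed: "(\<lambda>y. (1 / sqrt (ip h h)) * h y) \<in> X"
    if "ip h h > 0" "P h" "\<And>x. x \<notin> S \<Longrightarrow> h x = 0" for h
  proof -
    have "(1 / sqrt (ip h h)) * ((1 / sqrt (ip h h)) * ip h h) = 1"
      using that(1) by (simp add: field_simps)
    then show ?thesis
      unfolding X_def using that P_scale by (simp only: ip_scale ip_scale2 mem_Collect_eq) simp
  qed
  have cont: "continuous_on UNIV (\<lambda>f::'a\<Rightarrow>real. f x)" for x by simp
  have closed: "closed X"
  proof -
    have "X = (\<Inter>x\<in>-S. {f. f x = 0}) \<inter> {f. ip f f = 1} \<inter> (\<Inter>j\<in>J. {f. ip (\<phi> j) f = 0})"
      by (auto simp: X_def P_def)
    also have "closed \<dots>"
      unfolding ip_def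
      by (intro closed_Int closed_INT ballI closed_Collect_eq continuous_intros cont)
    finally show ?thesis .
  qed
  have sub: "X \<subseteq> PiE UNIV (\<lambda>x. {-1..1})"
  proof
    fix f assume f: "f \<in> X"
    have "\<bar>f x\<bar> \<le> 1" for x
    proof (cases "x \<in> S")
      case True
      have "f x * f x \<le> ip f f"
        unfolding ip_def using S True by (intro member_le_sum) auto
      then have "(f x)\<^sup>2 \<le> 1" using f by (simp add: X_def power2_eq_square)
      then show ?thesis by (simp add: abs_square_le_1)
    qed (use f in \<open>simp add: X_def\<close>)
    then show "f \<in> PiE UNIV (\<lambda>x. {-1..1})" by (auto simp: abs_le_iff minus_le_iff)
  qed
  have "compact (PiE UNIV (\<lambda>x::'a. {-1..1::real}))"
    using compactin_PiE[of "\<lambda>x::'a. euclidean :: real topology" UNIV "\<lambda>x. {-1..1}"]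
    by (simp add: euclidean_product_topology)
  then have comp: "compact X"
    using closed sub by (metis compact_Int_closed inf.absorb_iff2)
  have ne: "X \<noteq> {}"
  proof -
    have "\<exists>x\<in>S. (\<Sum>j\<in>J. (\<phi> j x)\<^sup>2) \<noteq> 1"
    proof (rule ccontr)
      assume "\<not> ?thesis"
      then have "(\<Sum>x\<in>S. \<Sum>j\<in>J. (\<phi> j x)\<^sup>2) = card S" by simp
      then show False using sum_frame_squares[OF F] c by simp
    qed
    then obtain x where x: "x \<in> S" "(\<Sum>j\<in>J. (\<phi> j x)\<^sup>2) \<noteq> 1" by blast
    define w where "w y = (if y \<in> S then of_bool (x = y) - (\<Sum>j\<in>J. \<phi> j x * \<phi> j y) else 0)" for y
    have ww: "ip w w = 1 - (\<Sum>j\<in>J. (\<phi> j x)\<^sup>2)"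
      using frame_residual(1)[OF S x(1) F] by (simp add: ip_def w_def power2_eq_square)
    have Pw: "P w"
      using frame_residual(2)[OF S x(1) F] by (simp add: P_def ip_def w_def mult.commute)
    have pos: "ip w w > 0" using ww x(2) ip_pos[of w] by simp
    have "(\<lambda>y. (1 / sqrt (ip w w)) * w y) \<in> X"
      by (rule normed[OF pos Pw]) (simp add: w_def)
    then show ?thesis by blast
  qed
  have contq: "continuous_on X (\<lambda>f. ip f (T f))"
    unfolding ip_def T_def by (intro continuous_intros continuous_on_subset[OF cont]) auto
  obtain f where f: "f \<in> X" and max: "\<And>g. g \<in> X \<Longrightarrow> ip g (T g) \<le> ip f (T f)"
    using continuous_attains_sup[OF comp ne contq] by blast
  define b where "b = ip f (T f)"
  have Pf: "P f" and ff: "ip f f = 1" and f0: "\<And>x. x \<notin> S \<Longrightarrow> f x = 0" using f by (auto simp: X_def)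
  have bound: "ip h (T h) \<le> b * ip h h" if "P h" "\<And>x. x \<notin> S \<Longrightarrow> h x = 0" for h
  proof (cases "ip h h = 0")
    case True
    then have "h x = 0" if "x \<in> S" for x
      using S that unfolding ip_def by (subst (asm) sum_nonneg_eq_0_iff) auto
    then show ?thesis by (simp add: ip_def)
  next
    case False
    then have pos: "ip h h > 0" using ip_pos[of h] by simp
    have "(\<lambda>y. (1 / sqrt (ip h h)) * h y) \<in> X" by (rule normed[OF pos that])
    from max[OF this] have "(1 / sqrt (ip h h)) * ((1 / sqrt (ip h h)) * ip h (T h)) \<le> b"
      by (simp only: ip_scale ip_scale2 T_scale b_def)
    then show ?thesis using pos by (simp add: field_simps)
  qed
  \<comment> \<open>The first variation in the direction of the residual \<open>g = T f - b f\<close> itself forces \<open>g = 0\<close>.\<close>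
  define g where "g y = (if y \<in> S then T f y - b * f y else 0)" for y
  have gT: "ip g h = ip (T f) h - b * ip f h" for h
    unfolding ip_def g_def by (simp add: sum_subtractf sum_distrib_left algebra_simps)
  have Pg: "P g"
    using P_T[OF Pf] Pf by (simp add: P_def ip_comm[of _ g] gT) (simp add: ip_comm)
  have var: "2 * e * ip g g \<le> e\<^sup>2 * (b * ip g g - ip g (T g))" for e
  proof -
    have "ip (\<lambda>x. f x + e * g x) (T (\<lambda>x. f x + e * g x)) \<le> b * ip (\<lambda>x. f x + e * g x) (\<lambda>x. f x + e * g x)"
      using f0 by (intro bound P_add Pf Pg) (auto simp: g_def)
    moreover have "ip (\<lambda>x. f x + e * g x) (T (\<lambda>x. f x + e * g x)) =
        b + 2 * e * ip (T f) g + e\<^sup>2 * ip g (T g)"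
      using T_self[of f g] ip_comm[of g "T f"]
      by (simp add: T_add ip_add ip_add2 b_def power2_eq_square algebra_simps)
    moreover have "ip (\<lambda>x. f x + e * g x) (\<lambda>x. f x + e * g x) = 1 + 2 * e * ip f g + e\<^sup>2 * ip g g"
      using ip_comm[of g f]
      by (simp add: ip_add ip_add2 ff power2_eq_square algebra_simps)
    ultimately have "2 * e * (ip (T f) g - b * ip f g) \<le> e\<^sup>2 * (b * ip g g - ip g (T g))"
      by (simp add: algebra_simps)
    then show ?thesis by (simp add: gT)
  qed
  have "ip g g = 0"
  proof (rule ccontr)
    assume "ip g g \<noteq> 0"
    then have c: "ip g g > 0" using ip_pos[of g] by simp
    define k where "k = b * ip g g - ip g (T g)"
    have k: "k > 0" using var[of 1] c by (simp add: k_def)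
    \<comment> \<open>The step size \<open>ip g g / k\<close> minimises the quadratic polynomial of \<open>var\<close>.\<close>
    have "2 * (ip g g / k) * ip g g \<le> (ip g g / k)\<^sup>2 * k"
      using var[of "ip g g / k"] by (simp only: k_def[symmetric])
    also have "\<dots> = (ip g g / k) * ip g g" using k by (simp add: power2_eq_square field_simps)
    finally show False using c k by (simp add: field_simps)
  qed
  then have "g y = 0" if "y \<in> S" for y
    using S that unfolding ip_def by (subst (asm) sum_nonneg_eq_0_iff) auto
  then have "T f y = b * f y" if "y \<in> S" for y using that by (auto simp: g_def)
  then show thesis
    using Pf ff by (intro that[of f b]) (auto simp: P_def ip_def T_def)
qed

text \<open>A given unit eigenvector can be put at index \<open>0\<close>; for random walks this will be the constant function.\<close>

theorem symmetric_eigenbasis: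
  fixes M :: "'a \<Rightarrow> 'a \<Rightarrow> real"
  assumes S: "finite S" "S \<noteq> {}" and sym: "\<And>x y. x \<in> S \<Longrightarrow> y \<in> S \<Longrightarrow> M x y = M y x"
    and f0: "(\<Sum>x\<in>S. f0 x * f0 x) = 1" "\<And>y. y \<in> S \<Longrightarrow> (\<Sum>x\<in>S. f0 x * M x y) = b0 * f0 y"
  obtains \<phi> \<beta> where "eigenbasis S M {..<card S} \<phi> \<beta>" "\<phi> 0 = f0" "\<beta> 0 = b0"
proof -
  have "\<exists>\<phi> \<beta>. eigenframe S M {..<Suc r} \<phi> \<beta> \<and> \<phi> 0 = f0 \<and> \<beta> 0 = b0" if "Suc r \<le> card S" for r
    using that
  proof (induction r)
    case 0
    show ?case
      by (intro exI[of _ "\<lambda>_. f0"] exI[of _ "\<lambda>_. b0"]) (use f0 in \<open>auto simp: eigenframe_def\<close>)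
  next
    case (Suc r)
    then obtain \<phi> \<beta> where F: "eigenframe S M {..<Suc r} \<phi> \<beta>" and 0: "\<phi> 0 = f0" "\<beta> 0 = b0" by auto
    obtain f b where f: "(\<Sum>x\<in>S. f x * f x) = 1"
      "\<And>j. j < Suc r \<Longrightarrow> (\<Sum>x\<in>S. \<phi> j x * f x) = 0"
      "\<And>y. y \<in> S \<Longrightarrow> (\<Sum>x\<in>S. f x * M x y) = b * f y"
      using frame_extend[OF S(1) sym F] Suc.prems by auto
    have "eigenframe S M {..<Suc (Suc r)} (\<phi>(Suc r := f)) (\<beta>(Suc r := b))"
      unfolding eigenframe_def
    proof (intro conjI ballI)
      fix i j assume ij: "i \<in> {..<Suc (Suc r)}" "j \<in> {..<Suc (Suc r)}"
      consider "i < Suc r" "j < Suc r" | "i = Suc r" "j < Suc r" | "i < Suc r" "j = Suc r"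
        | "i = Suc r" "j = Suc r" using ij by fastforce
      then show "(\<Sum>x\<in>S. (\<phi>(Suc r := f)) i x * (\<phi>(Suc r := f)) j x) = of_bool (i = j)"
      proof cases
        case 1
        then show ?thesis using F by (simp add: eigenframe_def)
      next
        case 2
        then show ?thesis using f(2)[of j] by (simp add: mult.commute)
      next
        case 3
        then show ?thesis using f(2)[of i] by simp
      next
        case 4
        then show ?thesis using f(1) by simp
      qed
    qed (use F f(3) in \<open>auto simp: eigenframe_def less_Suc_eq\<close>)
    moreover have "(\<phi>(Suc r := f)) 0 = f0" "(\<beta>(Suc r := b)) 0 = b0" using 0 by auto
    ultimately show ?case by blast
  qed
  moreover have c: "Suc (card S - 1) = card S" using S by (simp add: card_gt_0_iff)
  ultimately have "\<exists>\<phi> \<beta>. eigenframe S M {..<card S} \<phi> \<beta> \<and> \<phi> 0 = f0 \<and> \<beta> 0 = b0"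
    by (metis order_refl)
  then obtain \<phi> \<beta> where F: "eigenframe S M {..<card S} \<phi> \<beta>" "\<phi> 0 = f0" "\<beta> 0 = b0"
    by blast
  show thesis
    by (rule that[OF maximal_frame_is_basis[OF S(1) F(1)] F(2,3)]) simp
qed

lemma eigenbasis_mat_pow:
  assumes B: "eigenbasis S M J \<phi> \<beta>" and S: "finite S" "x \<in> S" "y \<in> S"
  shows "mat_pow S M m x y = (\<Sum>j\<in>J. \<beta> j ^ m * \<phi> j x * \<phi> j y)"
  using S(2,3)
proof (induction m arbitrary: y)
  case 0
  then show ?case using B by (auto simp: eigenbasis_def mat_one_def)
next
  case (Suc m)
  have "mat_pow S M (Suc m) x y = (\<Sum>z\<in>S. \<Sum>j\<in>J. \<beta> j ^ m * \<phi> j x * (\<phi> j z * M z y))"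
    using Suc by (simp add: sum_distrib_right sum_distrib_left mult.assoc)
  also have "\<dots> = (\<Sum>j\<in>J. \<beta> j ^ m * \<phi> j x * (\<Sum>z\<in>S. \<phi> j z * M z y))"
    by (subst sum.swap) (simp add: sum_distrib_left)
  also have "\<dots> = (\<Sum>j\<in>J. \<beta> j ^ Suc m * \<phi> j x * \<phi> j y)"
    using B Suc.prems by (intro sum.cong) (auto simp: eigenbasis_def eigenframe_def)
  finally show ?case .
qed

lemma eigenbasis_mat_exp:
  assumes B: "eigenbasis S M J \<phi> \<beta>" and S: "finite S" "x \<in> S" "y \<in> S"
  shows "mat_exp S M x y = (\<Sum>j\<in>J. exp (\<beta> j) * \<phi> j x * \<phi> j y)"
proof -
  have "(\<lambda>m. \<Sum>j\<in>J. (\<beta> j ^ m /\<^sub>R fact m) * (\<phi> j x * \<phi> j y)) sums (\<Sum>j\<in>J. exp (\<beta> j) * (\<phi> j x * \<phi> j y))"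
    by (intro sums_sum sums_mult2 exp_converges)
  moreover have "(\<Sum>j\<in>J. (\<beta> j ^ m /\<^sub>R fact m) * (\<phi> j x * \<phi> j y)) =
      (\<Sum>j\<in>J. \<beta> j ^ m * \<phi> j x * \<phi> j y) / fact m" for m
    unfolding divide_inverse sum_distrib_right by (intro sum.cong refl) (simp add: mult_ac)
  ultimately have "(\<lambda>m. mat_pow S M m x y / fact m) sums (\<Sum>j\<in>J. exp (\<beta> j) * (\<phi> j x * \<phi> j y))"
    by (simp add: eigenbasis_mat_pow[OF B S])
  from sums_unique[OF this] show ?thesis
    by (simp add: mat_exp_def mult.assoc)
qed

lemma eigenbasis_affine:
  assumes B: "eigenbasis S M J \<phi> \<beta>" and S: "finite S"
  shows "eigenbasis S (\<lambda>x y. t * (M x y - mat_one x y)) J \<phi> (\<lambda>j. t * (\<beta> j - 1))"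
proof -
  have "(\<Sum>x\<in>S. \<phi> j x * (t * (M x y - mat_one x y))) = t * (\<beta> j - 1) * \<phi> j y"
    if "j \<in> J" "y \<in> S" for j y
  proof -
    have "(\<Sum>x\<in>S. \<phi> j x * (t * (M x y - mat_one x y))) =
        t * ((\<Sum>x\<in>S. \<phi> j x * M x y) - (\<Sum>x\<in>S. of_bool (x = y) * \<phi> j x))"
      unfolding sum_distrib_left right_diff_distrib sum_subtractf
      by (auto simp: mat_one_def mult_ac intro!: arg_cong2[of _ _ _ _ "(-)"] sum.cong)
    also have "\<dots> = t * (\<beta> j * \<phi> j y - \<phi> j y)"
      using B that sum_of_bool_mult(2)[OF S that(2)] by (auto simp: eigenbasis_def eigenframe_def)
    finally show ?thesis by (simp add: algebra_simps)
  qed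
  then show ?thesis using B by (auto simp: eigenbasis_def eigenframe_def)
qed

section \<open>Total variation and the spectrum of a walk\<close>

lemma tv_uniform_cases:
  assumes fin: "finite (carrier G)" and ne: "carrier G \<noteq> {}"
  shows "F \<subseteq> carrier G \<Longrightarrow> (\<Sum>y\<in>F. \<mu> y - 1 / card (carrier G)) \<le> tv_uniform G \<mu>"
    and "(\<And>F. F \<subseteq> carrier G \<Longrightarrow> (\<Sum>y\<in>F. \<mu> y - 1 / card (carrier G)) \<le> b) \<Longrightarrow> tv_uniform G \<mu> \<le> b"
proof -
  let ?h = "\<lambda>F. (\<Sum>y\<in>F. \<mu> y) - measure_pmf.prob (pmf_of_set (carrier G)) F"
  have eq: "?h F = (\<Sum>y\<in>F. \<mu> y - 1 / card (carrier G))" if "F \<subseteq> carrier G" for F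
    using that fin ne by (simp add: measure_pmf_of_set Int_absorb1 sum_subtractf)
  show "(\<Sum>y\<in>F. \<mu> y - 1 / card (carrier G)) \<le> tv_uniform G \<mu>" if "F \<subseteq> carrier G"
    unfolding tv_uniform_def eq[OF that, symmetric] using that fin by (intro Max_ge) auto
  show "tv_uniform G \<mu> \<le> b"
    if "\<And>F. F \<subseteq> carrier G \<Longrightarrow> (\<Sum>y\<in>F. \<mu> y - 1 / card (carrier G)) \<le> b"
  proof -
    have "?h F \<le> b" if "F \<subseteq> carrier G" for F using that eq \<open>\<And>F. _ \<Longrightarrow> _ \<le> b\<close> by simp
    then show ?thesis
      unfolding tv_uniform_def using fin by (subst Max_le_iff) auto
  qed
qed

lemma tv_uniform_eq_half_l1:
  assumes fin: "finite (carrier G)" and ne: "carrier G \<noteq> {}"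
    and total: "(\<Sum>y\<in>carrier G. \<mu> y) = 1"
  shows "tv_uniform G \<mu> = (\<Sum>y\<in>carrier G. \<bar>\<mu> y - 1 / card (carrier G)\<bar>) / 2"
proof -
  define g where "g y = \<mu> y - 1 / card (carrier G)" for y
  have g0: "(\<Sum>y\<in>carrier G. g y) = 0"
    using fin ne total by (simp add: g_def sum_subtractf)
  have "(\<Sum>y\<in>carrier G. \<bar>g y\<bar>) = (\<Sum>y\<in>carrier G. 2 * max (g y) 0 - g y)"
    by (intro sum.cong) auto
  then have pos: "(\<Sum>y\<in>carrier G. max (g y) 0) = (\<Sum>y\<in>carrier G. \<bar>g y\<bar>) / 2"
    using g0 by (simp add: sum_subtractf sum_distrib_left[symmetric])
  show ?thesis
  proof (rule antisym)
    show "tv_uniform G \<mu> \<le> (\<Sum>y\<in>carrier G. \<bar>\<mu> y - 1 / card (carrier G)\<bar>) / 2"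
    proof (rule tv_uniform_cases(2)[OF fin ne])
      fix F assume F: "F \<subseteq> carrier G"
      have "(\<Sum>y\<in>F. g y) \<le> (\<Sum>y\<in>F. max (g y) 0)" by (intro sum_mono) auto
      also have "\<dots> \<le> (\<Sum>y\<in>carrier G. max (g y) 0)" using F fin by (intro sum_mono2) auto
      finally show "(\<Sum>y\<in>F. \<mu> y - 1 / card (carrier G)) \<le> (\<Sum>y\<in>carrier G. \<bar>\<mu> y - 1 / card (carrier G)\<bar>) / 2"
        using pos by (simp add: g_def)
    qed
    have "(\<Sum>y\<in>carrier G. max (g y) 0) = (\<Sum>y\<in>{y\<in>carrier G. 0 \<le> g y}. g y)"
      using fin by (intro sum.mono_neutral_cong_right) auto
    also have "\<dots> \<le> tv_uniform G \<mu>"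
      unfolding g_def by (rule tv_uniform_cases(1)[OF fin ne]) auto
    finally show "(\<Sum>y\<in>carrier G. \<bar>\<mu> y - 1 / card (carrier G)\<bar>) / 2 \<le> tv_uniform G \<mu>"
      using pos by (simp add: g_def)
  qed
qed

text \<open>\<open>1 - d\<close> is the total mass of the pointwise minimum, and a minimum is at most a geometric mean.
  Affinities are preferred to \<open>d\<close> itself since they are multiplicative over products.\<close>

lemma one_minus_tv_le_affinity:
  assumes fin: "finite (carrier G)" and ne: "carrier G \<noteq> {}"
    and total: "(\<Sum>y\<in>carrier G. \<mu> y) = 1" and nonneg: "\<And>y. y \<in> carrier G \<Longrightarrow> 0 \<le> \<mu> y"
  shows "1 - tv_uniform G \<mu> \<le> (\<Sum>y\<in>carrier G. sqrt (\<mu> y * (1 / card (carrier G))))"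
proof -
  let ?u = "1 / real (card (carrier G))"
  have "1 - tv_uniform G \<mu> = ((\<Sum>y\<in>carrier G. \<mu> y) + (\<Sum>y\<in>carrier G. ?u) - (\<Sum>y\<in>carrier G. \<bar>\<mu> y - ?u\<bar>)) / 2"
    using fin ne total by (simp add: tv_uniform_eq_half_l1[OF fin ne total])
  also have "\<dots> = (\<Sum>y\<in>carrier G. min (\<mu> y) ?u)"
    unfolding sum.distrib[symmetric] sum_subtractf[symmetric] sum_divide_distrib
    by (intro sum.cong) (auto simp: min_def abs_if)
  also have "\<dots> \<le> (\<Sum>y\<in>carrier G. sqrt (\<mu> y * ?u))"
  proof (rule sum_mono)
    fix y assume y: "y \<in> carrier G"
    have "min (\<mu> y) ?u = sqrt (min (\<mu> y) ?u * min (\<mu> y) ?u)"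
      using nonneg[OF y] by simp
    also have "\<dots> \<le> sqrt (\<mu> y * ?u)"
      using nonneg[OF y] by (intro real_sqrt_le_mono mult_mono) auto
    finally show "min (\<mu> y) ?u \<le> sqrt (\<mu> y * ?u)" .
  qed
  finally show ?thesis .
qed

text \<open>The index type of the eigenbasis is left open: single walks are indexed by numbers, products by
  choice functions of indices of their factors.\<close>

locale spectral_walk = group G for G (structure) +
  fixes Q :: "'a pmf" and J :: "'j set" and j0 :: 'j and \<phi> :: "'j \<Rightarrow> 'a \<Rightarrow> real" and \<beta> :: "'j \<Rightarrow> real"
  assumes finite_carrier: "finite (carrier G)"
    and support_subset: "set_pmf Q \<subseteq> carrier G"
    and basis: "eigenbasis (carrier G) (transition G Q) J \<phi> \<beta>"
    and j0: "j0 \<in> J" "\<beta> j0 = 1"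
    and const_j0: "\<And>x. x \<in> carrier G \<Longrightarrow> \<phi> j0 x = 1 / sqrt (card (carrier G))"
begin

abbreviation "N \<equiv> card (carrier G)"

definition decay :: "real \<Rightarrow> 'j \<Rightarrow> real" where
  "decay t j = exp (- (t * (1 - \<beta> j)))"

lemma decay_j0 [simp]: "decay t j0 = 1"
  by (simp add: decay_def j0)

lemma decay_nonneg [simp]: "0 \<le> decay t j"
  by (simp add: decay_def)

lemma decay_add: "decay s j * decay t j = decay (s + t) j"
  by (simp add: decay_def exp_add[symmetric] algebra_simps)

lemma decay_square: "(decay t j)\<^sup>2 = decay (2 * t) j"
  by (simp add: power2_eq_square decay_add)

text \<open>The matrix \<open>g(K)\<close> of the functional calculus, where \<open>g\<close> is given by its values at the eigenvalues.\<close>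

definition kernel :: "('j \<Rightarrow> real) \<Rightarrow> 'a \<Rightarrow> 'a \<Rightarrow> real" where
  "kernel g x y = (\<Sum>j\<in>J. g j * \<phi> j x * \<phi> j y)"

lemma finite_J: "finite J" and
  orth: "i \<in> J \<Longrightarrow> j \<in> J \<Longrightarrow> (\<Sum>x\<in>carrier G. \<phi> i x * \<phi> j x) = of_bool (i = j)" and
  complete: "x \<in> carrier G \<Longrightarrow> y \<in> carrier G \<Longrightarrow> (\<Sum>j\<in>J. \<phi> j x * \<phi> j y) = of_bool (x = y)"
  using basis by (auto simp: eigenbasis_def eigenframe_def)

lemma N_pos: "N > 0" using finite_carrier one_closed by (auto simp: card_gt_0_iff)

lemma carrier_ne: "carrier G \<noteq> {}" using one_closed by blast

lemma iterate_eq: "x \<in> carrier G \<Longrightarrow> y \<in> carrier G \<Longrightarrow> iterate G Q m x y = kernel (\<lambda>j. \<beta> j ^ m) x y"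
  unfolding iterate_def kernel_def by (rule eigenbasis_mat_pow[OF basis finite_carrier])

lemma heat_eq: "x \<in> carrier G \<Longrightarrow> y \<in> carrier G \<Longrightarrow>
    heat_kernel G Q t x y = kernel (decay t) x y"
  unfolding heat_kernel_def kernel_def
  by (subst eigenbasis_mat_exp[OF eigenbasis_affine[OF basis finite_carrier] finite_carrier])
     (auto simp: decay_def algebra_simps)

lemma sum_eigenfunction:
  assumes "j \<in> J" shows "(\<Sum>y\<in>carrier G. \<phi> j y) = of_bool (j = j0) * sqrt N"
proof -
  have "of_bool (j = j0) = (\<Sum>y\<in>carrier G. \<phi> j y * (1 / sqrt N))"
    using orth[OF assms j0(1)] const_j0 by simp
  then show ?thesis using N_pos by (simp add: sum_divide_distrib[symmetric] field_simps)
qed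

lemma kernel_mult_eigenfunction:
  assumes "j \<in> J" shows "(\<Sum>y\<in>carrier G. kernel g x y * \<phi> j y) = g j * \<phi> j x"
proof -
  have "(\<Sum>y\<in>carrier G. kernel g x y * \<phi> j y) = (\<Sum>i\<in>J. g i * \<phi> i x * (\<Sum>y\<in>carrier G. \<phi> i y * \<phi> j y))"
    unfolding kernel_def sum_distrib_left sum_distrib_right
    by (subst sum.swap) (simp add: mult_ac)
  also have "\<dots> = (\<Sum>i\<in>J. of_bool (i = j) * (g i * \<phi> i x))"
    using assms by (intro sum.cong) (auto simp: orth)
  finally show ?thesis using sum_of_bool_mult(2)[OF finite_J assms] by simp
qed

lemma kernel_compose:
  "(\<Sum>z\<in>carrier G. kernel g x z * kernel h z y) = kernel (\<lambda>j. g j * h j) x y"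
proof -
  have "(\<Sum>z\<in>carrier G. kernel g x z * kernel h z y) =
      (\<Sum>j\<in>J. h j * \<phi> j y * (\<Sum>z\<in>carrier G. kernel g x z * \<phi> j z))"
    unfolding kernel_def[of h] sum_distrib_left by (subst sum.swap) (simp add: mult_ac)
  also have "\<dots> = kernel (\<lambda>j. g j * h j) x y"
    unfolding kernel_def by (intro sum.cong refl) (simp add: kernel_mult_eigenfunction[unfolded kernel_def])
  finally show ?thesis .
qed

lemma kernel_sym: "kernel g x y = kernel g y x"
  by (simp add: kernel_def mult_ac)

lemma kernel_total:
  assumes "g j0 = 1" "x \<in> carrier G"
  shows "(\<Sum>y\<in>carrier G. kernel g x y) = 1"
proof -
  have "(\<Sum>y\<in>carrier G. kernel g x y) = (\<Sum>y\<in>carrier G. kernel g x y * \<phi> j0 y) * sqrt N"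
    using N_pos by (simp add: const_j0 sum_distrib_right)
  also have "\<dots> = 1"
    unfolding kernel_mult_eigenfunction[OF j0(1)] using assms N_pos by (simp add: const_j0)
  finally show ?thesis .
qed

lemma kernel_trace: "(\<Sum>x\<in>carrier G. kernel g x x) = (\<Sum>j\<in>J. g j)"
  unfolding kernel_def mult.assoc
  by (subst sum.swap) (simp add: sum_distrib_left[symmetric] orth)

text \<open>Eigenfunctions need not be invariant in any sense, but \<open>g(K)\<close> commutes with left translations when
  it is a power or an exponential of \<open>K\<close>.  Only the consequence for the diagonal is recorded.\<close>

definition homogeneous :: "('j \<Rightarrow> real) \<Rightarrow> bool" where
  "homogeneous g \<longleftrightarrow> (\<forall>x\<in>carrier G. \<forall>y\<in>carrier G. kernel g (x \<otimes> y) (x \<otimes> y) = kernel g y y)"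

lemma homogeneous_diag: "homogeneous g \<Longrightarrow> x \<in> carrier G \<Longrightarrow> kernel g x x = kernel g \<one> \<one>"
  unfolding homogeneous_def by (metis one_closed r_one)

lemma homogeneous_iterate: "homogeneous (\<lambda>j. \<beta> j ^ m)"
  unfolding homogeneous_def
  by (auto simp: iterate_eq[symmetric] iterate_translate)

lemma homogeneous_heat: "homogeneous (decay t)"
  unfolding homogeneous_def
  by (auto simp: heat_eq[symmetric] heat_kernel_translate)

lemma homogeneous_trace: "homogeneous g \<Longrightarrow> N * kernel g \<one> \<one> = (\<Sum>j\<in>J. g j)"
  unfolding kernel_trace[symmetric]
  by (subst sum.cong[OF refl homogeneous_diag[of g]]) auto

text \<open>The Plancherel formula for the starting point \<open>\<one>\<close>: the weights \<open>(\<phi> j \<one>)\<^sup>2\<close> disappear because, by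
  homogeneity, the starting point may be averaged over the group.\<close>

lemma kernel_l2:
  assumes g: "g j0 = 1" and hom: "homogeneous (\<lambda>j. (g j)\<^sup>2)"
  shows "N * (\<Sum>y\<in>carrier G. (kernel g \<one> y - 1 / N)\<^sup>2) = (\<Sum>j\<in>J-{j0}. (g j)\<^sup>2)"
proof -
  have "(\<Sum>y\<in>carrier G. (kernel g \<one> y - 1 / N)\<^sup>2) =
      (\<Sum>y\<in>carrier G. kernel g \<one> y * kernel g y \<one> - 2 / N * kernel g \<one> y + 1 / N * (1 / N))"
    by (intro sum.cong) (auto simp: kernel_sym[of g _ \<one>] power2_eq_square algebra_simps)
  also have "\<dots> = kernel (\<lambda>j. (g j)\<^sup>2) \<one> \<one> - 2 / N + 1 / N"
    using N_pos kernel_total[of g, OF g one_closed]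
    by (simp only: sum.distrib sum_subtractf kernel_compose sum_distrib_left[symmetric])
       (simp add: power2_eq_square)
  finally have "N * (\<Sum>y\<in>carrier G. (kernel g \<one> y - 1 / N)\<^sup>2) = N * kernel (\<lambda>j. (g j)\<^sup>2) \<one> \<one> - 1"
    using N_pos by (simp add: field_simps)
  also have "\<dots> = (\<Sum>j\<in>J-{j0}. (g j)\<^sup>2)"
    using homogeneous_trace[OF hom] g j0 finite_J by (simp add: sum_diff1)
  finally show ?thesis .
qed

lemma tv_le_l2:
  assumes g: "g j0 = 1" and hom: "homogeneous (\<lambda>j. (g j)\<^sup>2)"
  shows "tv_uniform G (kernel g \<one>) \<le> sqrt (\<Sum>j\<in>J-{j0}. (g j)\<^sup>2) / 2"
proof -
  have "(\<Sum>y\<in>carrier G. \<bar>kernel g \<one> y - 1 / N\<bar>)\<^sup>2 \<le> N * (\<Sum>y\<in>carrier G. (kernel g \<one> y - 1 / N)\<^sup>2)"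
    using sum_squared_le_sum_of_squares[of "\<lambda>y. \<bar>kernel g \<one> y - 1 / N\<bar>" "carrier G"]
    by (simp add: mult.commute)
  then have "(\<Sum>y\<in>carrier G. \<bar>kernel g \<one> y - 1 / N\<bar>)\<^sup>2 \<le> (\<Sum>j\<in>J-{j0}. (g j)\<^sup>2)"
    by (simp add: kernel_l2[OF g hom])
  then have "(\<Sum>y\<in>carrier G. \<bar>kernel g \<one> y - 1 / N\<bar>) \<le> sqrt (\<Sum>j\<in>J-{j0}. (g j)\<^sup>2)"
    by (rule real_le_rsqrt)
  then show ?thesis
    by (simp add: tv_uniform_eq_half_l1[OF finite_carrier carrier_ne kernel_total[of g, OF g one_closed]])
qed

lemma tv_eq: "tv G Q m = tv_uniform G (kernel (\<lambda>j. \<beta> j ^ m) \<one>)"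
  and tv_start_eq: "x \<in> carrier G \<Longrightarrow> tv G Q m = tv_uniform G (kernel (\<lambda>j. \<beta> j ^ m) x)"
proof -
  have "tv_uniform G (iterate G Q m x) = tv_uniform G (kernel (\<lambda>j. \<beta> j ^ m) x)" if "x \<in> carrier G" for x
    unfolding tv_uniform_def
    by (intro arg_cong[where f = Max] image_cong refl arg_cong2[where f = "(-)"] sum.cong)
       (use that in \<open>auto simp: iterate_eq\<close>)
  then show "x \<in> carrier G \<Longrightarrow> tv G Q m = tv_uniform G (kernel (\<lambda>j. \<beta> j ^ m) x)" for x
    using tv_start[OF finite_carrier] by simp
  then show "tv G Q m = tv_uniform G (kernel (\<lambda>j. \<beta> j ^ m) \<one>)" by simp
qed

lemma tv_c_eq: "tv_c G Q t = tv_uniform G (kernel (decay t) \<one>)"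
  and tv_c_start_eq: "x \<in> carrier G \<Longrightarrow> tv_c G Q t = tv_uniform G (kernel (decay t) x)"
proof -
  have "tv_uniform G (heat_kernel G Q t x) = tv_uniform G (kernel (decay t) x)"
    if "x \<in> carrier G" for x
    unfolding tv_uniform_def
    by (intro arg_cong[where f = Max] image_cong refl arg_cong2[where f = "(-)"] sum.cong)
       (use that in \<open>auto simp: heat_eq\<close>)
  then show "x \<in> carrier G \<Longrightarrow> tv_c G Q t = tv_uniform G (kernel (decay t) x)" for x
    using tv_c_start[OF finite_carrier] by simp
  then show "tv_c G Q t = tv_uniform G (kernel (decay t) \<one>)" by simp
qed

lemma tv_upper: "tv G Q m \<le> sqrt (\<Sum>j\<in>J-{j0}. \<beta> j ^ (2 * m)) / 2"
proof -
  have "homogeneous (\<lambda>j. (\<beta> j ^ m)\<^sup>2)"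
    using homogeneous_iterate[of "2 * m"] by (simp add: power_mult[symmetric] mult.commute)
  from tv_le_l2[of "\<lambda>j. \<beta> j ^ m", OF _ this] show ?thesis
    using j0 by (simp add: tv_eq power_mult[symmetric] mult.commute)
qed

lemma tv_c_upper: "tv_c G Q t \<le> sqrt (\<Sum>j\<in>J-{j0}. decay (2 * t) j) / 2"
  using tv_le_l2[of "\<lambda>j. decay t j"] homogeneous_heat[of "2 * t"] j0
  unfolding decay_square tv_c_eq by simp

text \<open>Started at a maximum of \<open>|\<phi> j|\<close>, the walk has \<open>\<phi> j\<close>-expectation \<open>g j * \<phi> j x\<close>, while the uniform
  expectation is \<open>0\<close>; the difference is at most twice the total variation times \<open>|\<phi> j x|\<close>.\<close>

lemma tv_eigen_lower:
  assumes g: "g j0 = 1" and j: "j \<in> J - {j0}"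
    and start: "\<And>x. x \<in> carrier G \<Longrightarrow> tv_uniform G (kernel g x) = d"
  shows "\<bar>g j\<bar> / 2 \<le> d"
proof -
  obtain x where x: "x \<in> carrier G" and max: "\<And>y. y \<in> carrier G \<Longrightarrow> \<bar>\<phi> j y\<bar> \<le> \<bar>\<phi> j x\<bar>"
  proof -
    have "Max ((\<lambda>y. \<bar>\<phi> j y\<bar>) ` carrier G) \<in> (\<lambda>y. \<bar>\<phi> j y\<bar>) ` carrier G"
      using finite_carrier carrier_ne by (intro Max_in) auto
    then obtain x where "x \<in> carrier G" "Max ((\<lambda>y. \<bar>\<phi> j y\<bar>) ` carrier G) = \<bar>\<phi> j x\<bar>" by auto
    then show thesis using that[of x] finite_carrier by (metis Max_ge finite_imageI image_eqI)
  qed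
  have pos: "\<bar>\<phi> j x\<bar> > 0"
  proof (rule ccontr)
    assume "\<not> \<bar>\<phi> j x\<bar> > 0"
    then have "\<phi> j y = 0" if "y \<in> carrier G" for y using max[OF that] by simp
    then show False using orth[of j j] j by simp
  qed
  have "g j * \<phi> j x = (\<Sum>y\<in>carrier G. (kernel g x y - 1 / N) * \<phi> j y)"
    using kernel_mult_eigenfunction[of j g x] sum_eigenfunction[of j] j
    by (simp add: left_diff_distrib sum_subtractf sum_divide_distrib[symmetric])
  then have "\<bar>g j\<bar> * \<bar>\<phi> j x\<bar> \<le> (\<Sum>y\<in>carrier G. \<bar>kernel g x y - 1 / N\<bar> * \<bar>\<phi> j y\<bar>)"
    by (simp add: abs_mult[symmetric])
  also have "\<dots> \<le> (\<Sum>y\<in>carrier G. \<bar>kernel g x y - 1 / N\<bar> * \<bar>\<phi> j x\<bar>)"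
    by (intro sum_mono mult_left_mono max) auto
  also have "\<dots> = 2 * d * \<bar>\<phi> j x\<bar>"
    using start[OF x] tv_uniform_eq_half_l1[OF finite_carrier carrier_ne kernel_total[of g, OF g x]]
    by (simp add: sum_distrib_right[symmetric])
  finally show ?thesis using pos by simp
qed

lemma tv_lower: "j \<in> J - {j0} \<Longrightarrow> \<bar>\<beta> j\<bar> ^ m / 2 \<le> tv G Q m"
  using tv_eigen_lower[of "\<lambda>j. \<beta> j ^ m" j "tv G Q m"] tv_start_eq[of _ m] j0 by (simp add: power_abs)

lemma tv_c_lower: "j \<in> J - {j0} \<Longrightarrow> decay t j / 2 \<le> tv_c G Q t"
  using tv_eigen_lower[of "\<lambda>j. decay t j" j "tv_c G Q t"] tv_c_start_eq[of _ t] j0 by simp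

lemma iterate_nonneg: "x \<in> carrier G \<Longrightarrow> y \<in> carrier G \<Longrightarrow> 0 \<le> kernel (\<lambda>j. \<beta> j ^ m) x y"
proof (induction m arbitrary: y)
  case 0
  then show ?case by (simp add: kernel_def complete)
next
  case (Suc m)
  have "iterate G Q (Suc m) x y = (\<Sum>z\<in>carrier G. iterate G Q m x z * transition G Q z y)"
    by (simp add: iterate_def)
  also have "0 \<le> \<dots>"
    using Suc by (auto simp: iterate_eq transition_def intro!: sum_nonneg mult_nonneg_nonneg)
  finally have "0 \<le> iterate G Q (Suc m) x y" .
  then show ?case using Suc.prems by (simp only: iterate_eq)
qed

text \<open>The heat kernel is the Poisson mixture of the iterates of \<open>K\<close>.\<close>

lemma heat_sums:
  "(\<lambda>k. exp (- t) * t ^ k / fact k * kernel (\<lambda>j. \<beta> j ^ k) x y) sums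
     kernel (decay t) x y"
proof -
  have "(\<lambda>k. \<Sum>j\<in>J. exp (- t) * (((t * \<beta> j) ^ k /\<^sub>R fact k) * (\<phi> j x * \<phi> j y))) sums
      (\<Sum>j\<in>J. exp (- t) * (exp (t * \<beta> j) * (\<phi> j x * \<phi> j y)))"
    by (intro sums_sum sums_mult sums_mult2 exp_converges)
  moreover have "(\<Sum>j\<in>J. exp (- t) * (exp (t * \<beta> j) * (\<phi> j x * \<phi> j y))) =
      kernel (decay t) x y"
    unfolding kernel_def
    by (intro sum.cong refl) (simp add: decay_def right_diff_distrib exp_diff exp_minus field_simps)
  moreover have "(\<Sum>j\<in>J. exp (- t) * (((t * \<beta> j) ^ k /\<^sub>R fact k) * (\<phi> j x * \<phi> j y))) =
      exp (- t) * t ^ k / fact k * kernel (\<lambda>j. \<beta> j ^ k) x y" for k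
    unfolding kernel_def sum_distrib_left
    by (intro sum.cong refl) (simp add: power_mult_distrib divide_inverse mult_ac)
  ultimately show ?thesis by simp
qed

lemma heat_nonneg:
  assumes "t \<ge> 0" "x \<in> carrier G" "y \<in> carrier G"
  shows "0 \<le> kernel (decay t) x y"
  using heat_sums[of t x y] by (rule sums_le[OF _ sums_zero, rotated])
    (use assms iterate_nonneg in auto)

text \<open>A further step averages over starting points, all of which give the same total variation.\<close>

lemma tv_compose_le:
  assumes g: "g j0 = 1" and h: "h j0 = 1"
    and start: "\<And>x. x \<in> carrier G \<Longrightarrow> tv_uniform G (kernel g x) = d"
    and nonneg: "\<And>x. x \<in> carrier G \<Longrightarrow> 0 \<le> kernel h \<one> x"
  shows "tv_uniform G (kernel (\<lambda>j. h j * g j) \<one>) \<le> d"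
proof -
  have "(\<Sum>y\<in>carrier G. \<bar>kernel (\<lambda>j. h j * g j) \<one> y - 1 / N\<bar>) =
      (\<Sum>y\<in>carrier G. \<bar>\<Sum>z\<in>carrier G. kernel h \<one> z * (kernel g z y - 1 / N)\<bar>)"
    using kernel_total[of h \<one>] h
    by (simp add: kernel_compose[symmetric] right_diff_distrib sum_subtractf sum_divide_distrib[symmetric])
  also have "\<dots> \<le> (\<Sum>y\<in>carrier G. \<Sum>z\<in>carrier G. kernel h \<one> z * \<bar>kernel g z y - 1 / N\<bar>)"
    by (intro sum_mono order.trans[OF sum_abs]) (simp add: abs_mult nonneg)
  also have "\<dots> = (\<Sum>z\<in>carrier G. kernel h \<one> z * (\<Sum>y\<in>carrier G. \<bar>kernel g z y - 1 / N\<bar>))"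
    by (subst sum.swap) (simp add: sum_distrib_left)
  also have "\<dots> = (\<Sum>z\<in>carrier G. kernel h \<one> z * (2 * d))"
    using start by (intro sum.cong refl)
      (simp add: tv_uniform_eq_half_l1[OF finite_carrier carrier_ne kernel_total[of g, OF g]])
  also have "\<dots> = 2 * d" using kernel_total[of h \<one>] h by (simp add: sum_distrib_right[symmetric])
  finally show ?thesis
    using kernel_total[of "\<lambda>j. h j * g j" \<one>] g h
    by (simp add: tv_uniform_eq_half_l1[OF finite_carrier carrier_ne])
qed

lemma tv_antimono: assumes "m \<le> m'" shows "tv G Q m' \<le> tv G Q m"
proof -
  have "tv_uniform G (kernel (\<lambda>j. \<beta> j ^ (m' - m) * \<beta> j ^ m) \<one>) \<le> tv G Q m"
    using j0 iterate_nonneg tv_start_eq by (intro tv_compose_le) auto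
  then show ?thesis using assms by (simp add: tv_eq power_add[symmetric])
qed

lemma tv_c_antimono: assumes "s \<le> t" shows "tv_c G Q t \<le> tv_c G Q s"
proof -
  have "tv_uniform G (kernel (\<lambda>j. decay (t - s) j * decay s j) \<one>) \<le> tv_c G Q s"
    using j0 assms heat_nonneg[of "t - s" \<one>] tv_c_start_eq by (intro tv_compose_le) auto
  then show ?thesis by (simp add: tv_c_eq decay_add)
qed

lemma tv_kernel_bounds:
  assumes g: "g j0 = 1" and nonneg: "\<And>x. x \<in> carrier G \<Longrightarrow> 0 \<le> kernel g \<one> x"
  shows "0 \<le> tv_uniform G (kernel g \<one>)" "tv_uniform G (kernel g \<one>) \<le> 1"
proof -
  have eq: "tv_uniform G (kernel g \<one>) = (\<Sum>y\<in>carrier G. \<bar>kernel g \<one> y - 1 / N\<bar>) / 2"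
    by (rule tv_uniform_eq_half_l1[OF finite_carrier carrier_ne kernel_total[of g, OF g one_closed]])
  show "0 \<le> tv_uniform G (kernel g \<one>)" unfolding eq by (simp add: sum_nonneg)
  have "(\<Sum>y\<in>carrier G. \<bar>kernel g \<one> y - 1 / N\<bar>) \<le> (\<Sum>y\<in>carrier G. kernel g \<one> y + 1 / N)"
    using nonneg by (intro sum_mono) (auto simp: abs_le_iff intro: order.trans[OF _ add_mono])
  also have "\<dots> = 2" using N_pos kernel_total[of g, OF g one_closed] by (simp add: sum.distrib)
  finally show "tv_uniform G (kernel g \<one>) \<le> 1" unfolding eq by simp
qed

lemma tv_bounds: "0 \<le> tv G Q m" "tv G Q m \<le> 1"
  unfolding tv_eq using j0 iterate_nonneg by (auto intro!: tv_kernel_bounds)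

lemma tv_c_nonneg: "t \<ge> 0 \<Longrightarrow> 0 \<le> tv_c G Q t"
  unfolding tv_c_eq using j0 heat_nonneg by (auto intro!: tv_kernel_bounds)

text \<open>In the Poisson mixture, iterates before step \<open>m\<close> contribute at most their probability and later ones
  at most \<open>tv G Q m\<close>.\<close>

lemma tv_c_le_tv:
  assumes t: "t \<ge> 0"
  shows "tv_c G Q t \<le> tv G Q m + (\<Sum>k<m. exp (- t) * t ^ k / fact k)"
  unfolding tv_c_eq
proof (rule tv_uniform_cases(2)[OF finite_carrier carrier_ne])
  fix F assume F: "F \<subseteq> carrier G"
  define p where "p k = exp (- t) * t ^ k / fact k" for k
  have p0: "p k \<ge> 0" for k using t by (simp add: p_def)
  have psum: "p sums 1"
  proof -
    have "(\<lambda>k. exp (- t) * (t ^ k /\<^sub>R fact k)) sums (exp (- t) * exp t)"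
      by (intro sums_mult exp_converges)
    then show ?thesis by (simp add: p_def[abs_def] exp_add[symmetric] divide_inverse mult_ac)
  qed
  have "(\<lambda>k. \<Sum>y\<in>F. p k * kernel (\<lambda>j. \<beta> j ^ k) \<one> y - p k * (1 / N)) sums
      (\<Sum>y\<in>F. kernel (decay t) \<one> y - 1 * (1 / N))"
    unfolding p_def by (intro sums_sum sums_diff heat_sums sums_mult2 psum[unfolded p_def[abs_def]])
  then have 1: "(\<lambda>k. p k * (\<Sum>y\<in>F. kernel (\<lambda>j. \<beta> j ^ k) \<one> y - 1 / N)) sums
      (\<Sum>y\<in>F. kernel (decay t) \<one> y - 1 / N)"
    by (simp add: right_diff_distrib sum_distrib_left)
  have "(\<lambda>k. tv G Q m * p k + (if k \<in> {..<m} then p k else 0)) sums (tv G Q m * 1 + (\<Sum>k<m. p k))"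
    by (intro sums_add sums_mult psum sums_If_finite_set) auto
  then have 2: "(\<lambda>k. tv G Q m * p k + (if k < m then p k else 0)) sums (tv G Q m + (\<Sum>k<m. p k))"
    by simp
  show "(\<Sum>y\<in>F. kernel (decay t) \<one> y - 1 / N) \<le>
      tv G Q m + (\<Sum>k<m. exp (- t) * t ^ k / fact k)"
    unfolding p_def[symmetric]
  proof (rule sums_le[OF _ 1 2])
    fix k
    have le: "(\<Sum>y\<in>F. kernel (\<lambda>j. \<beta> j ^ k) \<one> y - 1 / N) \<le> tv G Q k"
      unfolding tv_eq by (rule tv_uniform_cases(1)[OF finite_carrier carrier_ne F])
    show "p k * (\<Sum>y\<in>F. kernel (\<lambda>j. \<beta> j ^ k) \<one> y - 1 / N) \<le> tv G Q m * p k + (if k < m then p k else 0)"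
    proof (cases "k < m")
      case True
      have "p k * (\<Sum>y\<in>F. kernel (\<lambda>j. \<beta> j ^ k) \<one> y - 1 / N) \<le> p k * 1"
        using le tv_bounds(2)[of k] p0 by (intro mult_left_mono) auto
      then show ?thesis using True tv_bounds(1)[of m] p0[of k] by (simp add: add_increasing)
    next
      case False
      then have "p k * (\<Sum>y\<in>F. kernel (\<lambda>j. \<beta> j ^ k) \<one> y - 1 / N) \<le> p k * tv G Q m"
        using le tv_antimono[of m k] p0 by (intro mult_left_mono) auto
      then show ?thesis using False by (simp add: mult.commute)
    qed
  qed
qed

lemma one_minus_tv_c_le_affinity:
  assumes "t \<ge> 0"
  shows "1 - tv_c G Q t \<le> (\<Sum>y\<in>carrier G. sqrt (heat_kernel G Q t \<one> y * (1 / N)))"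
proof -
  have "1 - tv_c G Q t \<le> (\<Sum>y\<in>carrier G. sqrt (kernel (decay t) \<one> y * (1 / N)))"
    unfolding tv_c_eq using j0 heat_nonneg[OF assms]
    by (intro one_minus_tv_le_affinity finite_carrier carrier_ne kernel_total) auto
  then show ?thesis by (simp add: heat_eq)
qed

text \<open>The heat trace dominates the density of \<open>H\<^sub>t\<close> with respect to the uniform distribution, since by
  the Cauchy-Schwarz inequality kernels are largest on the diagonal.  For a bounded density the squared
  Hellinger distance is at least a multiple of the squared \<open>L\<^sup>2\<close> distance.\<close>

lemma affinity_le:
  assumes t: "t \<ge> 0" and M: "(\<Sum>j\<in>J. decay t j) \<le> M"
  shows "(\<Sum>y\<in>carrier G. sqrt (heat_kernel G Q t \<one> y * (1 / N))) \<le>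
    1 - (\<Sum>j\<in>J-{j0}. decay (2 * t) j) / (2 * (sqrt M + 1)\<^sup>2)"
proof -
  define g where "g = (decay t)"
  define h where "h y = kernel g \<one> y" for y
  define u where "u = 1 / real N"
  have u: "u > 0" using N_pos by (simp add: u_def)
  have h0: "h y \<ge> 0" if "y \<in> carrier G" for y
    unfolding h_def g_def using that t by (intro heat_nonneg) auto
  have hM: "h y \<le> M * u" if y: "y \<in> carrier G" for y
  proof -
    have "h y \<le> (\<Sum>j\<in>J. g j * ((\<phi> j \<one>)\<^sup>2 + (\<phi> j y)\<^sup>2) / 2)"
      unfolding h_def kernel_def
    proof (rule sum_mono)
      fix j
      have "\<phi> j \<one> * \<phi> j y \<le> ((\<phi> j \<one>)\<^sup>2 + (\<phi> j y)\<^sup>2) / 2"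
        using sum_squares_bound[of "\<phi> j \<one>" "\<phi> j y"] by simp
      from mult_left_mono[OF this, of "g j"] show "g j * \<phi> j \<one> * \<phi> j y \<le> g j * ((\<phi> j \<one>)\<^sup>2 + (\<phi> j y)\<^sup>2) / 2"
        by (simp add: g_def mult.assoc)
    qed
    also have "\<dots> = (kernel g \<one> \<one> + kernel g y y) / 2"
      by (simp add: kernel_def sum.distrib[symmetric] sum_divide_distrib power2_eq_square algebra_simps add_divide_distrib)
    also have "\<dots> = kernel g \<one> \<one>"
      using homogeneous_diag[OF homogeneous_heat y] by (simp add: g_def)
    also have "\<dots> = (\<Sum>j\<in>J. g j) * u"
      using homogeneous_trace[OF homogeneous_heat, of t] N_pos by (simp add: g_def u_def field_simps)
    also have "\<dots> \<le> M * u" using M u by (intro mult_right_mono) (auto simp: g_def)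
    finally show ?thesis .
  qed
  have M0: "M \<ge> 0" by (rule order.trans[OF _ M]) (simp add: sum_nonneg)
  have total: "(\<Sum>y\<in>carrier G. h y) = 1"
    unfolding h_def by (rule kernel_total) (use j0 in \<open>auto simp: g_def\<close>)
  have total_u: "(\<Sum>y\<in>carrier G. u) = 1" using N_pos by (simp add: u_def)
  \<comment> \<open>\<open>h - u\<close> is the product of the difference and the sum of the square roots, and the sum is bounded.\<close>
  have pw: "sqrt (h y * u) \<le> (h y + u) / 2 - (h y - u)\<^sup>2 / (u * (2 * (sqrt M + 1)\<^sup>2))"
    if y: "y \<in> carrier G" for y
  proof -
    have sq: "(sqrt (h y))\<^sup>2 = h y" "(sqrt u)\<^sup>2 = u" using h0[OF y] u by auto
    have "sqrt (h y) \<le> sqrt M * sqrt u"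
      using hM[OF y] by (simp add: real_sqrt_mult[symmetric])
    then have "sqrt (h y) + sqrt u \<le> sqrt u * (sqrt M + 1)" by (simp add: algebra_simps)
    then have "(sqrt (h y) + sqrt u)\<^sup>2 \<le> (sqrt u * (sqrt M + 1))\<^sup>2"
      using h0[OF y] u by (intro power_mono) auto
    also have "\<dots> = u * (sqrt M + 1)\<^sup>2" using u by (simp add: power_mult_distrib)
    finally have le: "(sqrt (h y) + sqrt u)\<^sup>2 \<le> u * (sqrt M + 1)\<^sup>2" .
    have "h y - u = (sqrt (h y) - sqrt u) * (sqrt (h y) + sqrt u)"
      using sq by (simp add: algebra_simps power2_eq_square)
    then have "(h y - u)\<^sup>2 = (sqrt (h y) - sqrt u)\<^sup>2 * (sqrt (h y) + sqrt u)\<^sup>2"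
      by (simp add: power_mult_distrib)
    also have "\<dots> \<le> (sqrt (h y) - sqrt u)\<^sup>2 * (u * (sqrt M + 1)\<^sup>2)"
      by (intro mult_left_mono le) auto
    finally have "(h y - u)\<^sup>2 / (u * (sqrt M + 1)\<^sup>2) \<le> (sqrt (h y) - sqrt u)\<^sup>2"
      using u M0 by (subst pos_divide_le_eq) (auto intro!: mult_pos_pos zero_less_power add_nonneg_pos)
    also have "\<dots> = h y + u - 2 * sqrt (h y * u)"
      using sq by (simp add: power2_diff real_sqrt_mult)
    finally show ?thesis by (simp add: field_simps)
  qed
  have hom2: "homogeneous (\<lambda>j. (g j)\<^sup>2)" unfolding g_def decay_square by (rule homogeneous_heat)
  have "(\<Sum>y\<in>carrier G. sqrt (h y * u)) \<le> (\<Sum>y\<in>carrier G. (h y + u) / 2 - (h y - u)\<^sup>2 / (u * (2 * (sqrt M + 1)\<^sup>2)))"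
    by (intro sum_mono pw)
  also have "\<dots> = 1 - (\<Sum>y\<in>carrier G. (h y - u)\<^sup>2) / (u * (2 * (sqrt M + 1)\<^sup>2))"
    using total total_u by (simp add: sum_subtractf sum_divide_distrib[symmetric] sum.distrib)
  also have "(\<Sum>y\<in>carrier G. (h y - u)\<^sup>2) = u * (\<Sum>j\<in>J-{j0}. (g j)\<^sup>2)"
    using kernel_l2[OF _ hom2] j0 N_pos by (simp add: g_def h_def u_def field_simps)
  finally have "(\<Sum>y\<in>carrier G. sqrt (h y * u)) \<le> 1 - (\<Sum>j\<in>J-{j0}. (g j)\<^sup>2) / (2 * (sqrt M + 1)\<^sup>2)"
    using u by simp
  then show ?thesis
    unfolding g_def decay_square by (simp add: h_def g_def u_def heat_eq)
qed

end

section \<open>Moderate growth and the spectrum\<close>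

context group begin

lemma set_pow_closed: "E \<subseteq> carrier G \<Longrightarrow> set_pow G E m \<subseteq> carrier G"
  by (induction m) (auto dest: set_mult_closed)

lemma set_pow_add:
  assumes E: "E \<subseteq> carrier G" and x: "x \<in> set_pow G E a" and y: "y \<in> set_pow G E b"
  shows "x \<otimes> y \<in> set_pow G E (a + b)"
  using y
proof (induction b arbitrary: y)
  case 0
  then show ?case using x set_pow_closed[OF E, of a] by (auto dest!: subsetD)
next
  case (Suc b)
  then obtain z s where zs: "z \<in> set_pow G E b" "s \<in> E" "y = z \<otimes> s"
    by (auto simp: set_mult_def)
  then have "x \<otimes> y = (x \<otimes> z) \<otimes> s"
    using x E set_pow_closed[OF E] by (auto simp: m_assoc subset_iff)
  moreover have "x \<otimes> z \<in> set_pow G E (a + b)" using Suc.IH zs by simp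
  ultimately show ?case using zs by (auto simp: set_mult_def)
qed

lemma set_pow_one: "E \<subseteq> carrier G \<Longrightarrow> set_pow G E 1 = E"
  by (auto simp: set_mult_def subset_iff)

lemma set_pow_full:
  assumes E: "E \<subseteq> carrier G" "E \<noteq> {}" and full: "set_pow G E m = carrier G" and le: "m \<le> m'"
  shows "set_pow G E m' = carrier G"
  using le
proof (induction m' rule: dec_induct)
  case (step m')
  obtain s where s: "s \<in> E" using E by blast
  have "y \<in> carrier G <#> E" if y: "y \<in> carrier G" for y
  proof -
    have c: "s \<in> carrier G" using s E by blast
    then have "(y \<otimes> inv s) \<otimes> s \<in> carrier G <#> E" using y s by (auto simp: set_mult_def)
    then show ?thesis using y c by (simp add: m_assoc)
  qed
  then show ?case using step E set_mult_closed[of "carrier G" E] by auto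
qed (fact full)

lemma group_diameter_props:
  assumes fin: "finite (carrier G)" and gen: "generating_set G E"
  shows "group_diameter G E \<ge> 1" "set_pow G E (group_diameter G E) = carrier G"
    and "1 \<le> m \<Longrightarrow> set_pow G E m = carrier G \<Longrightarrow> group_diameter G E \<le> m"
proof -
  from gen obtain m0 where E: "E \<subseteq> carrier G" and m0: "m0 > 0" "set_pow G E m0 = carrier G"
    by (auto simp: generating_set_def)
  let ?P = "\<lambda>m. 1 \<le> m \<and> card (set_pow G E m) = card (carrier G)"
  have "?P m0" using m0 by simp
  then have *: "?P (group_diameter G E)" unfolding group_diameter_def by (rule LeastI)
  then show "group_diameter G E \<ge> 1" by simp
  show "set_pow G E (group_diameter G E) = carrier G"
    using * fin set_pow_closed[OF E] by (intro card_subset_eq) auto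
  show "1 \<le> m \<Longrightarrow> set_pow G E m = carrier G \<Longrightarrow> group_diameter G E \<le> m"
    unfolding group_diameter_def by (rule Least_le) simp
qed

end

context spectral_walk begin

lemma transition_eq: "x \<in> carrier G \<Longrightarrow> y \<in> carrier G \<Longrightarrow> transition G Q x y = kernel \<beta> x y"
proof -
  assume xy: "x \<in> carrier G" "y \<in> carrier G"
  have "iterate G Q 1 x y = (\<Sum>z\<in>carrier G. of_bool (x = z) * transition G Q z y)"
    by (simp add: iterate_def mat_one_def of_bool_def)
  also have "\<dots> = transition G Q x y" by (rule sum_of_bool_mult(1)[OF finite_carrier xy(1)])
  finally show ?thesis using iterate_eq[OF xy, of 1] by simp
qed

text \<open>One step of the walk multiplies by an increment drawn from \<open>Q\<close>.\<close>

lemma sum_shift: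
  assumes "x \<in> carrier G"
  shows "(\<Sum>y\<in>carrier G. transition G Q x y * h y) = (\<Sum>s\<in>carrier G. pmf Q s * h (x \<otimes> s))"
  using assms unfolding transition_def
  by (intro sum.reindex_bij_witness[where i = "\<lambda>s. x \<otimes> s" and j = "\<lambda>y. inv x \<otimes> y"])
     (auto simp: m_assoc[symmetric])

lemma sum_right_translate:
  "y \<in> carrier G \<Longrightarrow> (\<Sum>x\<in>carrier G. h (x \<otimes> y)) = (\<Sum>x\<in>carrier G. h x)"
  by (intro sum.reindex_bij_witness[where i = "\<lambda>x. x \<otimes> inv y" and j = "\<lambda>x. x \<otimes> y"])
     (auto simp: m_assoc)

definition coef :: "('a \<Rightarrow> real) \<Rightarrow> 'j \<Rightarrow> real" where
  "coef f j = (\<Sum>x\<in>carrier G. f x * \<phi> j x)"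

text \<open>Twice the Dirichlet form of \<open>I - K\<close> with respect to counting measure.\<close>

definition energy :: "('a \<Rightarrow> real) \<Rightarrow> real" where
  "energy f = (\<Sum>x\<in>carrier G. \<Sum>y\<in>carrier G. transition G Q x y * (f x - f y)\<^sup>2)"

lemma quadratic_form:
  "(\<Sum>x\<in>carrier G. \<Sum>y\<in>carrier G. kernel g x y * (f x * f y)) = (\<Sum>j\<in>J. g j * (coef f j)\<^sup>2)"
proof -
  have "(\<Sum>x\<in>carrier G. \<Sum>y\<in>carrier G. kernel g x y * (f x * f y)) =
      (\<Sum>x\<in>carrier G. \<Sum>j\<in>J. \<Sum>y\<in>carrier G. g j * ((f x * \<phi> j x) * (f y * \<phi> j y)))"
    unfolding kernel_def sum_distrib_right
    by (intro sum.cong refl, subst sum.swap) (simp add: mult_ac)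
  also have "\<dots> = (\<Sum>j\<in>J. g j * (\<Sum>x\<in>carrier G. \<Sum>y\<in>carrier G. (f x * \<phi> j x) * (f y * \<phi> j y)))"
    by (subst sum.swap) (simp add: sum_distrib_left)
  also have "\<dots> = (\<Sum>j\<in>J. g j * (coef f j)\<^sup>2)"
    by (simp only: coef_def power2_eq_square sum_product)
  finally show ?thesis .
qed

lemma parseval: "(\<Sum>x\<in>carrier G. (f x)\<^sup>2) = (\<Sum>j\<in>J. (coef f j)\<^sup>2)"
proof -
  have "(\<Sum>x\<in>carrier G. (f x)\<^sup>2) = (\<Sum>x\<in>carrier G. \<Sum>y\<in>carrier G. of_bool (x = y) * (f x * f y))"
    by (intro sum.cong refl) (simp add: sum_of_bool_mult(1)[OF finite_carrier] power2_eq_square)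
  also have "\<dots> = (\<Sum>x\<in>carrier G. \<Sum>y\<in>carrier G. kernel (\<lambda>_. 1) x y * (f x * f y))"
    by (intro sum.cong refl) (simp add: kernel_def complete)
  finally show ?thesis by (simp add: quadratic_form)
qed

lemma transition_row: "x \<in> carrier G \<Longrightarrow> (\<Sum>y\<in>carrier G. transition G Q x y) = 1"
  and transition_col: "y \<in> carrier G \<Longrightarrow> (\<Sum>x\<in>carrier G. transition G Q x y) = 1"
  using kernel_total[of \<beta>] j0 by (auto simp: transition_eq kernel_sym[of \<beta> _ y])

text \<open>The sign \<open>e = -1\<close> gives the form of \<open>I + K\<close>, which bounds eigenvalues from below.\<close>

lemma energy_signed:
  assumes e: "e\<^sup>2 = 1"
  shows "(\<Sum>x\<in>carrier G. \<Sum>y\<in>carrier G. transition G Q x y * (f x - e * f y)\<^sup>2) =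
    2 * (\<Sum>j\<in>J. (1 - e * \<beta> j) * (coef f j)\<^sup>2)"
proof -
  have "(\<Sum>x\<in>carrier G. \<Sum>y\<in>carrier G. transition G Q x y * (f x - e * f y)\<^sup>2) =
      (\<Sum>x\<in>carrier G. \<Sum>y\<in>carrier G. transition G Q x y * (f x)\<^sup>2) +
      (\<Sum>x\<in>carrier G. \<Sum>y\<in>carrier G. transition G Q x y * (f y)\<^sup>2) -
      2 * e * (\<Sum>x\<in>carrier G. \<Sum>y\<in>carrier G. transition G Q x y * (f x * f y))"
    unfolding sum_distrib_left sum.distrib[symmetric] sum_subtractf[symmetric]
    using e by (intro sum.cong refl) (simp add: power2_diff power_mult_distrib algebra_simps)
  also have "(\<Sum>x\<in>carrier G. \<Sum>y\<in>carrier G. transition G Q x y * (f x)\<^sup>2) = (\<Sum>x\<in>carrier G. (f x)\<^sup>2)"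
    by (simp add: sum_distrib_right[symmetric] transition_row)
  also have "(\<Sum>x\<in>carrier G. \<Sum>y\<in>carrier G. transition G Q x y * (f y)\<^sup>2) = (\<Sum>x\<in>carrier G. (f x)\<^sup>2)"
    by (subst sum.swap) (simp add: sum_distrib_right[symmetric] transition_col)
  also have "(\<Sum>x\<in>carrier G. \<Sum>y\<in>carrier G. transition G Q x y * (f x * f y)) = (\<Sum>j\<in>J. \<beta> j * (coef f j)\<^sup>2)"
    unfolding quadratic_form[symmetric] by (intro sum.cong refl) (simp add: transition_eq)
  finally show ?thesis
    by (simp add: parseval left_diff_distrib sum_subtractf sum_distrib_left algebra_simps)
qed

lemma energy_spectral: "energy f = 2 * (\<Sum>j\<in>J. (1 - \<beta> j) * (coef f j)\<^sup>2)"
  using energy_signed[of 1 f] by (simp add: energy_def)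

lemma coef_eigenfunction: "i \<in> J \<Longrightarrow> j \<in> J \<Longrightarrow> coef (\<phi> i) j = of_bool (i = j)"
  by (simp add: coef_def orth)

lemma sum_coef_eigenfunction: "i \<in> J \<Longrightarrow> (\<Sum>j\<in>J. h j * (coef (\<phi> i) j)\<^sup>2) = h i"
proof -
  assume i: "i \<in> J"
  have "(\<Sum>j\<in>J. h j * (coef (\<phi> i) j)\<^sup>2) = (\<Sum>j\<in>J. of_bool (i = j) * h j)"
    using i by (intro sum.cong refl) (auto simp: coef_eigenfunction)
  then show ?thesis using sum_of_bool_mult(1)[OF finite_J i] by simp
qed

lemma energy_eigenfunction: "i \<in> J \<Longrightarrow> energy (\<phi> i) = 2 * (1 - \<beta> i)"
  by (simp only: energy_spectral sum_coef_eigenfunction)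

text \<open>In the form of \<open>I + K\<close> the diagonal terms alone, each with \<open>K x x = Q \<one>\<close>, contribute \<open>4 Q \<one>\<close>.\<close>

lemma beta_lower: assumes i: "i \<in> J" shows "2 * pmf Q \<one> - 1 \<le> \<beta> i"
proof -
  have "4 * pmf Q \<one> = 4 * pmf Q \<one> * (\<Sum>x\<in>carrier G. \<phi> i x * \<phi> i x)"
    using orth[OF i i] by simp
  also have "\<dots> = (\<Sum>x\<in>carrier G. transition G Q x x * (\<phi> i x - (-1) * \<phi> i x)\<^sup>2)"
    unfolding sum_distrib_left
    by (intro sum.cong refl) (simp add: transition_def power2_eq_square algebra_simps)
  also have "\<dots> \<le> (\<Sum>x\<in>carrier G. \<Sum>y\<in>carrier G. transition G Q x y * (\<phi> i x - (-1) * \<phi> i y)\<^sup>2)"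
    using finite_carrier by (intro sum_mono member_le_sum) (auto simp: transition_def)
  also have "\<dots> = 2 * (1 + \<beta> i)"
    by (subst energy_signed) (use sum_coef_eigenfunction[OF i, of "\<lambda>j. 1 + \<beta> j"] in auto)
  finally show ?thesis by simp
qed

lemma energy_shift:
  "energy f = (\<Sum>s\<in>carrier G. pmf Q s * (\<Sum>x\<in>carrier G. (f x - f (x \<otimes> s))\<^sup>2))"
proof -
  have "energy f = (\<Sum>x\<in>carrier G. \<Sum>s\<in>carrier G. pmf Q s * (f x - f (x \<otimes> s))\<^sup>2)"
    unfolding energy_def by (intro sum.cong refl sum_shift)
  also have "\<dots> = (\<Sum>s\<in>carrier G. \<Sum>x\<in>carrier G. pmf Q s * (f x - f (x \<otimes> s))\<^sup>2)" by (rule sum.swap)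
  finally show ?thesis by (simp add: sum_distrib_left)
qed

lemma card_J: "card J = N"
proof -
  have "real (card J) = (\<Sum>x\<in>carrier G. kernel (\<lambda>_. 1) x x)" by (simp add: kernel_trace)
  also have "\<dots> = N" by (simp add: kernel_def complete)
  finally show ?thesis by simp
qed

end

text \<open>The growth exponent is a natural number here, which is no loss since \<open>m / \<rho> \<le> 1\<close>
  (\<open>moderate_growth_power\<close>).\<close>

locale growing_walk = spectral_walk +
  fixes A \<eta> :: real and D :: nat
  assumes symmetric: "symmetric_driver G Q"
    and eta_pos: "\<eta> > 0" and eta_le: "\<And>s. s \<in> set_pmf Q \<Longrightarrow> \<eta> \<le> pmf Q s"
    and generating: "generating_set G (set_pmf Q)"
    and A_pos: "A > 0"
    and growth: "\<And>m. 1 \<le> m \<Longrightarrow> m \<le> group_diameter G (set_pmf Q) \<Longrightarrow>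
      (real m / real (group_diameter G (set_pmf Q))) ^ D * card (carrier G) \<le>
        A * card (set_pow G (set_pmf Q) m)"
begin

abbreviation "E \<equiv> set_pmf Q"
abbreviation "V m \<equiv> card (set_pow G E m)"
abbreviation "\<rho> \<equiv> group_diameter G E"

lemmas rho_ge_1 = group_diameter_props(1)[OF finite_carrier generating]
  and rho_full = group_diameter_props(2)[OF finite_carrier generating]
  and rho_le = group_diameter_props(3)[OF finite_carrier generating]

lemma E_ne: "E \<noteq> {}" by (rule set_pmf_not_empty)

lemma pow_closed: "x \<in> set_pow G E m \<Longrightarrow> x \<in> carrier G"
  using set_pow_closed[OF support_subset] by blast

lemma finite_pow: "finite (set_pow G E m)"
  using finite_carrier set_pow_closed[OF support_subset] by (rule rev_finite_subset)

lemma inv_E: assumes "s \<in> E" shows "inv s \<in> E"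
proof -
  have "pmf Q (inv s) = pmf Q s"
    using symmetric assms support_subset unfolding symmetric_driver_def by (metis subsetD)
  then show ?thesis using assms by (simp add: set_pmf_iff)
qed

lemma inv_pow: "x \<in> set_pow G E m \<Longrightarrow> inv x \<in> set_pow G E m"
proof (induction m arbitrary: x)
  case (Suc m)
  then obtain z s where zs: "z \<in> set_pow G E m" "s \<in> E" "x = z \<otimes> s" by (auto simp: set_mult_def)
  have c: "z \<in> carrier G" "s \<in> carrier G" using zs pow_closed support_subset by auto
  have "inv s \<in> set_pow G E 1" using inv_E[OF zs(2)] set_pow_one[OF support_subset] by simp
  from set_pow_add[OF support_subset this Suc.IH[OF zs(1)]]
  show ?case using zs(3) c by (simp add: inv_mult_group)
qed simp

lemma V_pos: "V m > 0"
proof -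
  obtain s where "s \<in> E" using E_ne by blast
  then have "set_pow G E m \<noteq> {}" by (induction m) (auto simp: set_mult_def)
  then show ?thesis using finite_pow by (simp add: card_gt_0_iff)
qed

lemma eta_le_1: "\<eta> \<le> 1"
  using E_ne eta_le pmf_le_1 by (metis all_not_in_conv order.trans)

lemma card_E: "card E * \<eta> \<le> 1"
proof -
  have fin: "finite E" using support_subset finite_carrier by (rule finite_subset)
  have "card E * \<eta> \<le> (\<Sum>s\<in>E. pmf Q s)" using sum_mono[of E "\<lambda>_. \<eta>" "pmf Q"] eta_le by simp
  also have "\<dots> = 1" using fin by (intro sum_pmf_eq_1) auto
  finally show ?thesis .
qed

lemma N_le: "N \<le> A * \<rho> ^ D / \<eta>"
proof -
  have "(1 / real \<rho>) ^ D * N \<le> A * card E"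
    using growth[of 1] rho_ge_1 set_pow_one[OF support_subset] by simp
  then have "N \<le> A * card E * \<rho> ^ D" using rho_ge_1 by (simp add: power_divide field_simps)
  also have "\<dots> \<le> A * (1 / \<eta>) * \<rho> ^ D"
    using card_E eta_pos A_pos by (intro mult_right_mono mult_left_mono) (auto simp: field_simps)
  finally show ?thesis by simp
qed

section \<open>Averages over balls\<close>

text \<open>The triangle inequality along a word of length \<open>m\<close>; right translations preserve the norm, and one letter
  costs at most \<open>sqrt (energy f / \<eta>)\<close> because it is chosen with probability at least \<open>\<eta>\<close>.\<close>

lemma shift_norm:
  assumes "y \<in> set_pow G E m"
  shows "L2_set (\<lambda>x. f x - f (x \<otimes> y)) (carrier G) \<le> m * sqrt (energy f / \<eta>)"
  using assms
proof (induction m arbitrary: y)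
  case 0
  then show ?case by (auto simp: L2_set_def)
next
  case (Suc m)
  then obtain z s where zs: "z \<in> set_pow G E m" "s \<in> E" "y = z \<otimes> s" by (auto simp: set_mult_def)
  have c: "z \<in> carrier G" "s \<in> carrier G" using zs pow_closed support_subset by auto
  have "L2_set (\<lambda>x. f x - f (x \<otimes> y)) (carrier G) =
      L2_set (\<lambda>x. (f x - f (x \<otimes> z)) + (f (x \<otimes> z) - f ((x \<otimes> z) \<otimes> s))) (carrier G)"
    using zs(3) c by (intro L2_set_cong refl) (simp add: m_assoc)
  also have "\<dots> \<le> L2_set (\<lambda>x. f x - f (x \<otimes> z)) (carrier G) +
      L2_set (\<lambda>x. f (x \<otimes> z) - f ((x \<otimes> z) \<otimes> s)) (carrier G)"
    by (rule L2_set_triangle_ineq)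
  also have "L2_set (\<lambda>x. f (x \<otimes> z) - f ((x \<otimes> z) \<otimes> s)) (carrier G) = L2_set (\<lambda>x. f x - f (x \<otimes> s)) (carrier G)"
    unfolding L2_set_def using sum_right_translate[OF c(1), of "\<lambda>x. (f x - f (x \<otimes> s))\<^sup>2"] by simp
  also have "\<dots> \<le> sqrt (energy f / \<eta>)"
  proof -
    have "\<eta> * (\<Sum>x\<in>carrier G. (f x - f (x \<otimes> s))\<^sup>2) \<le> pmf Q s * (\<Sum>x\<in>carrier G. (f x - f (x \<otimes> s))\<^sup>2)"
      using eta_le[OF zs(2)] by (intro mult_right_mono sum_nonneg) auto
    also have "\<dots> \<le> energy f"
      unfolding energy_shift using c finite_carrier
      by (intro member_le_sum[of s "carrier G" "\<lambda>s. pmf Q s * (\<Sum>x\<in>carrier G. (f x - f (x \<otimes> s))\<^sup>2)"])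
         (auto intro!: mult_nonneg_nonneg sum_nonneg)
    finally show ?thesis
      unfolding L2_set_def using eta_pos by (intro real_sqrt_le_mono) (simp add: field_simps)
  qed
  also have "L2_set (\<lambda>x. f x - f (x \<otimes> z)) (carrier G) \<le> m * sqrt (energy f / \<eta>)"
    by (rule Suc.IH[OF zs(1)])
  finally show ?case by (simp add: algebra_simps)
qed

definition ball_avg :: "nat \<Rightarrow> ('a \<Rightarrow> real) \<Rightarrow> 'a \<Rightarrow> real" where
  "ball_avg r f x = (\<Sum>y\<in>set_pow G E r. f (x \<otimes> y)) / V r"

lemma energy_nonneg: "energy f \<ge> 0"
  by (auto simp: energy_def transition_def intro!: sum_nonneg mult_nonneg_nonneg)

lemma ball_avg_poincare:
  "(\<Sum>x\<in>carrier G. (f x - ball_avg r f x)\<^sup>2) \<le> (real r)\<^sup>2 * energy f / \<eta>"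
proof -
  have "(f x - ball_avg r f x)\<^sup>2 \<le> (\<Sum>y\<in>set_pow G E r. (f x - f (x \<otimes> y))\<^sup>2) / V r" for x
  proof -
    have "f x - ball_avg r f x = (\<Sum>y\<in>set_pow G E r. f x - f (x \<otimes> y)) / V r"
      using V_pos[of r] by (simp add: ball_avg_def sum_subtractf field_simps)
    then have "(f x - ball_avg r f x)\<^sup>2 = (\<Sum>y\<in>set_pow G E r. f x - f (x \<otimes> y))\<^sup>2 / (V r)\<^sup>2"
      by (simp add: power_divide)
    also have "\<dots> \<le> ((\<Sum>y\<in>set_pow G E r. (f x - f (x \<otimes> y))\<^sup>2) * V r) / (V r)\<^sup>2"
      by (intro divide_right_mono sum_squared_le_sum_of_squares) auto
    finally show ?thesis using V_pos[of r] by (simp add: power2_eq_square)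
  qed
  then have "(\<Sum>x\<in>carrier G. (f x - ball_avg r f x)\<^sup>2) \<le>
      (\<Sum>x\<in>carrier G. (\<Sum>y\<in>set_pow G E r. (f x - f (x \<otimes> y))\<^sup>2) / V r)"
    by (rule sum_mono)
  also have "\<dots> = (\<Sum>y\<in>set_pow G E r. (\<Sum>x\<in>carrier G. (f x - f (x \<otimes> y))\<^sup>2)) / V r"
    by (simp only: sum_divide_distrib[symmetric] sum.swap[of _ "set_pow G E r" "carrier G"])
  also have "\<dots> \<le> (\<Sum>y\<in>set_pow G E r. (real r)\<^sup>2 * energy f / \<eta>) / V r"
  proof (intro divide_right_mono sum_mono)
    fix y assume y: "y \<in> set_pow G E r"
    have "(\<Sum>x\<in>carrier G. (f x - f (x \<otimes> y))\<^sup>2) = (L2_set (\<lambda>x. f x - f (x \<otimes> y)) (carrier G))\<^sup>2"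
      by (simp add: L2_set_def sum_nonneg)
    also have "\<dots> \<le> (r * sqrt (energy f / \<eta>))\<^sup>2"
      by (intro power_mono shift_norm y L2_set_nonneg)
    also have "\<dots> = (real r)\<^sup>2 * energy f / \<eta>"
      using energy_nonneg[of f] eta_pos by (simp add: power_mult_distrib)
    finally show "(\<Sum>x\<in>carrier G. (f x - f (x \<otimes> y))\<^sup>2) \<le> (real r)\<^sup>2 * energy f / \<eta>" .
  qed auto
  finally show ?thesis using V_pos[of r] by simp
qed

text \<open>Up to the order of the sums this is the squared Hilbert-Schmidt norm of the averaging operator,
  whose matrix has \<open>V r\<close> entries \<open>1 / V r\<close> in each row.\<close>

lemma ball_avg_hilbert_schmidt:
  "(\<Sum>j\<in>J. \<Sum>x\<in>carrier G. (ball_avg r (\<phi> j) x)\<^sup>2) = N / V r"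
proof -
  have "(\<Sum>j\<in>J. (ball_avg r (\<phi> j) x)\<^sup>2) = 1 / V r" if x: "x \<in> carrier G" for x
  proof -
    have "(\<Sum>j\<in>J. (ball_avg r (\<phi> j) x)\<^sup>2) =
        (\<Sum>j\<in>J. \<Sum>y\<in>set_pow G E r. \<Sum>z\<in>set_pow G E r. \<phi> j (x \<otimes> y) * \<phi> j (x \<otimes> z)) / (V r)\<^sup>2"
      unfolding ball_avg_def power_divide sum_divide_distrib
      by (simp add: power2_eq_square sum_product sum_divide_distrib)
    also have "(\<Sum>j\<in>J. \<Sum>y\<in>set_pow G E r. \<Sum>z\<in>set_pow G E r. \<phi> j (x \<otimes> y) * \<phi> j (x \<otimes> z)) =
        (\<Sum>y\<in>set_pow G E r. \<Sum>z\<in>set_pow G E r. \<Sum>j\<in>J. \<phi> j (x \<otimes> y) * \<phi> j (x \<otimes> z))"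
      by (subst sum.swap, intro sum.cong refl, subst sum.swap) auto
    also have "\<dots> = (\<Sum>y\<in>set_pow G E r. \<Sum>z\<in>set_pow G E r. of_bool (y = z) * 1)"
      using x by (intro sum.cong refl) (auto simp: complete pow_closed)
    also have "\<dots> = (\<Sum>y\<in>set_pow G E r. 1)"
      by (intro sum.cong refl sum_of_bool_mult(1) finite_pow)
    finally show ?thesis using V_pos[of r] by (simp add: power2_eq_square)
  qed
  then show ?thesis by (subst sum.swap) simp
qed

text \<open>A ball of radius \<open>\<rho>\<close> is the whole group, so its averages of a nonconstant eigenfunction vanish.\<close>

lemma spectral_gap:
  assumes j: "j \<in> J - {j0}" shows "\<eta> / (2 * \<rho>\<^sup>2) \<le> 1 - \<beta> j"
proof -
  have "ball_avg \<rho> (\<phi> j) x = 0" if x: "x \<in> carrier G" for x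
  proof -
    have "(\<Sum>y\<in>carrier G. \<phi> j (x \<otimes> y)) = (\<Sum>y\<in>carrier G. \<phi> j y)"
      using x by (intro sum.reindex_bij_witness[where i = "\<lambda>y. inv x \<otimes> y" and j = "\<lambda>y. x \<otimes> y"])
        (auto simp: m_assoc[symmetric])
    then show ?thesis using sum_eigenfunction[of j] j by (simp add: ball_avg_def rho_full)
  qed
  then have "1 \<le> (real \<rho>)\<^sup>2 * (2 * (1 - \<beta> j)) / \<eta>"
    using ball_avg_poincare[of "\<phi> j" \<rho>] j orth[of j j]
    by (simp add: energy_eigenfunction power2_eq_square)
  then show ?thesis using eta_pos rho_ge_1 by (simp add: field_simps)
qed

lemma beta_le_1: "j \<in> J \<Longrightarrow> \<beta> j \<le> 1"
proof (cases "j = j0")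
  case False
  assume "j \<in> J"
  then have "\<eta> / (2 * \<rho>\<^sup>2) \<le> 1 - \<beta> j" using False by (intro spectral_gap) auto
  moreover have "0 \<le> \<eta> / (2 * \<rho>\<^sup>2)" using eta_pos by simp
  ultimately show ?thesis by linarith
qed (simp add: j0)

text \<open>An eigenfunction of small energy is close to its ball averages, so these keep a quarter of its squared
  norm; the total is limited by the Hilbert-Schmidt norm.\<close>

lemma eigenvalue_count:
  "card {j\<in>J. 8 * (real r)\<^sup>2 * (1 - \<beta> j) \<le> \<eta>} \<le> 4 * N / V r"
proof -
  let ?B = "{j\<in>J. 8 * (real r)\<^sup>2 * (1 - \<beta> j) \<le> \<eta>}"
  have quarter: "1 / 4 \<le> (\<Sum>x\<in>carrier G. (ball_avg r (\<phi> j) x)\<^sup>2)" if j: "j \<in> ?B" for j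
  proof -
    have "(\<Sum>x\<in>carrier G. (\<phi> j x - ball_avg r (\<phi> j) x)\<^sup>2) \<le> (real r)\<^sup>2 * (2 * (1 - \<beta> j)) / \<eta>"
      using ball_avg_poincare[of "\<phi> j" r] j by (simp add: energy_eigenfunction)
    also have "\<dots> \<le> 1 / 4" using j eta_pos by (simp add: field_simps)
    finally have le: "(\<Sum>x\<in>carrier G. (\<phi> j x - ball_avg r (\<phi> j) x)\<^sup>2) \<le> 1 / 4" .
    have "(\<phi> j x)\<^sup>2 \<le> 2 * (\<phi> j x - ball_avg r (\<phi> j) x)\<^sup>2 + 2 * (ball_avg r (\<phi> j) x)\<^sup>2" for x
      using zero_le_power2[of "\<phi> j x - 2 * ball_avg r (\<phi> j) x"]
      by (simp add: power2_eq_square algebra_simps)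
    from sum_mono[OF this, of "\<lambda>x. x" "carrier G"]
    have "(\<Sum>x\<in>carrier G. (\<phi> j x)\<^sup>2) \<le> 2 * (\<Sum>x\<in>carrier G. (\<phi> j x - ball_avg r (\<phi> j) x)\<^sup>2) +
        2 * (\<Sum>x\<in>carrier G. (ball_avg r (\<phi> j) x)\<^sup>2)"
      by (simp add: sum.distrib sum_distrib_left)
    then show ?thesis using le orth[of j j] j by (simp add: power2_eq_square)
  qed
  have "card ?B / 4 = (\<Sum>j\<in>?B. 1 / 4)" by simp
  also have "\<dots> \<le> (\<Sum>j\<in>?B. \<Sum>x\<in>carrier G. (ball_avg r (\<phi> j) x)\<^sup>2)"
    by (rule sum_mono) (rule quarter)
  also have "\<dots> \<le> (\<Sum>j\<in>J. \<Sum>x\<in>carrier G. (ball_avg r (\<phi> j) x)\<^sup>2)"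
    using finite_J by (intro sum_mono2 sum_nonneg) auto
  also have "\<dots> = N / V r" by (rule ball_avg_hilbert_schmidt)
  finally show ?thesis by (simp add: mult.commute)
qed

lemma eigenvalue_count_growth:
  "card {j\<in>J. 8 * (real \<rho>)\<^sup>2 * (1 - \<beta> j) \<le> \<eta> * (real (Suc s))\<^sup>2} \<le> 4 * A / \<eta> * (2 * real (Suc s)) ^ D"
proof (cases "Suc s \<le> \<rho>")
  case True
  \<comment> \<open>The largest radius for which the eigenvalues in question are small on its scale; \<open>\<rho> / r \<le> 2 (s + 1)\<close>.\<close>
  define r where "r = \<rho> div Suc s"
  have r1: "1 \<le> r" using True unfolding r_def by (simp add: div_greater_zero_iff Suc_le_eq)
  have rs: "r * Suc s \<le> \<rho>" unfolding r_def by (rule div_times_less_eq_dividend)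
  have rle: "r \<le> \<rho>" by (simp add: r_def)
  have "\<rho> < (r + 1) * Suc s" using dividend_less_div_times[of "Suc s" \<rho>] by (simp add: r_def algebra_simps)
  also have "\<dots> \<le> 2 * r * Suc s" using r1 by (intro mult_right_mono) auto
  finally have "real \<rho> \<le> 2 * real r * real (Suc s)" by (metis less_imp_le of_nat_le_iff of_nat_mult of_nat_numeral)
  then have ratio: "real \<rho> / real r \<le> 2 * real (Suc s)" using r1 by (simp add: divide_simps mult_ac)
  have sub: "{j\<in>J. 8 * (real \<rho>)\<^sup>2 * (1 - \<beta> j) \<le> \<eta> * (real (Suc s))\<^sup>2} \<subseteq> {j\<in>J. 8 * (real r)\<^sup>2 * (1 - \<beta> j) \<le> \<eta>}"
  proof safe
    fix j assume j: "j \<in> J" and le: "8 * (real \<rho>)\<^sup>2 * (1 - \<beta> j) \<le> \<eta> * (real (Suc s))\<^sup>2"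
    have "real r * real (Suc s) \<le> real \<rho>" using rs by (metis of_nat_le_iff of_nat_mult)
    then have "(real r * real (Suc s))\<^sup>2 \<le> (real \<rho>)\<^sup>2" by (intro power_mono) auto
    then have "8 * (real r * real (Suc s))\<^sup>2 * (1 - \<beta> j) \<le> 8 * (real \<rho>)\<^sup>2 * (1 - \<beta> j)"
      using beta_le_1[OF j] by (intro mult_right_mono mult_left_mono) auto
    also note le
    finally have "(8 * (real r)\<^sup>2 * (1 - \<beta> j)) * (real (Suc s))\<^sup>2 \<le> \<eta> * (real (Suc s))\<^sup>2"
      by (simp only: power_mult_distrib mult_ac)
    then show "8 * (real r)\<^sup>2 * (1 - \<beta> j) \<le> \<eta>"
      by (rule mult_right_le_imp_le) simp
  qed
  have "real (card {j\<in>J. 8 * (real \<rho>)\<^sup>2 * (1 - \<beta> j) \<le> \<eta> * (real (Suc s))\<^sup>2}) \<le>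
      real (card {j\<in>J. 8 * (real r)\<^sup>2 * (1 - \<beta> j) \<le> \<eta>})"
    using sub finite_J by (intro of_nat_mono card_mono) auto
  also have "\<dots> \<le> 4 * N / V r" by (rule eigenvalue_count)
  also have "\<dots> \<le> 4 * (A * (real \<rho> / real r) ^ D)"
    using growth[OF r1 rle] V_pos[of r] r1 rho_ge_1 by (simp add: power_divide field_simps)
  also have "\<dots> \<le> 4 * (A * (2 * real (Suc s)) ^ D)"
    using A_pos by (intro mult_left_mono power_mono ratio) auto
  also have "\<dots> \<le> 4 * A / \<eta> * (2 * real (Suc s)) ^ D"
  proof -
    have "4 * A * 1 \<le> 4 * A / \<eta>" using eta_le_1 eta_pos A_pos by (simp add: field_simps)
    from mult_right_mono[OF this, of "(2 * real (Suc s)) ^ D"] show ?thesis by (simp add: mult_ac)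
  qed
  finally show ?thesis .
next
  case False
  \<comment> \<open>When \<open>s \<ge> \<rho>\<close> the order of the group is a sufficient bound, by growth at radius one.\<close>
  have "real (card {j\<in>J. 8 * (real \<rho>)\<^sup>2 * (1 - \<beta> j) \<le> \<eta> * (real (Suc s))\<^sup>2}) \<le> real (card J)"
    using finite_J by (intro of_nat_mono card_mono) auto
  also have "\<dots> \<le> A * \<rho> ^ D / \<eta>" using N_le by (simp add: card_J)
  also have "\<dots> \<le> 4 * A / \<eta> * (2 * real (Suc s)) ^ D"
  proof -
    have "real \<rho> ^ D \<le> (2 * real (Suc s)) ^ D" using False by (intro power_mono) auto
    moreover have "A / \<eta> \<le> 4 * A / \<eta>" using A_pos eta_pos by (simp add: field_simps)
    ultimately have "A / \<eta> * real \<rho> ^ D \<le> 4 * A / \<eta> * (2 * real (Suc s)) ^ D"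
      using A_pos eta_pos by (intro mult_mono) auto
    then show ?thesis by simp
  qed
  finally show ?thesis .
qed

end

text \<open>A bound for the number of eigenvalues with \<open>\<eta> s\<^sup>2 \<le> 8 \<rho>\<^sup>2 \<lambda> \<le> \<eta> (s + 1)\<^sup>2\<close>, times the largest value that
  \<open>exp (- \<rho>\<^sup>2 \<lambda>)\<close> can take among them.\<close>

definition trace_term :: "real \<Rightarrow> real \<Rightarrow> nat \<Rightarrow> nat \<Rightarrow> real" where
  "trace_term A \<eta> D s = 4 * A / \<eta> * (2 * real (Suc s)) ^ D * exp (- (\<eta> * (real s)\<^sup>2 / 8))"

lemma summable_trace_term:
  assumes "\<eta> > 0" shows "summable (trace_term A \<eta> D)"
proof -
  have "(\<lambda>s. (2 * real (Suc s)) ^ D * exp (- (\<eta> * (real s)\<^sup>2 / 8))) \<in> O(\<lambda>s. 1 / real s ^ 2)"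
    using assms by real_asymp
  then have "summable (\<lambda>s. (2 * real (Suc s)) ^ D * exp (- (\<eta> * (real s)\<^sup>2 / 8)))"
    by (rule summable_comparison_test_bigo[rotated])
       (simp add: inverse_power_summable[of 2, unfolded inverse_eq_divide] power_one_over)
  from summable_mult[OF this, of "4 * A / \<eta>"] show ?thesis
    by (simp add: trace_term_def[abs_def] mult.assoc)
qed

context growing_walk begin

text \<open>Summation over layers of eigenvalues.  The bound does not grow with the group, which is what makes \<open>\<rho>\<^sup>2\<close>
  rather than \<open>\<rho>\<^sup>2 log \<rho>\<close> the mixing time of a factor.\<close>

lemma heat_trace_le:
  assumes t: "t \<ge> (real \<rho>)\<^sup>2"
  shows "(\<Sum>j\<in>J. decay t j) \<le> (\<Sum>s. trace_term A \<eta> D s)"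
proof -
  define P where "P j s \<longleftrightarrow> 8 * (real \<rho>)\<^sup>2 * (1 - \<beta> j) \<le> \<eta> * (real (Suc s))\<^sup>2" for j s
  define lev where "lev j = (LEAST s. P j s)" for j
  have ex: "\<exists>s. P j s" for j
  proof -
    obtain s :: nat where "8 * (real \<rho>)\<^sup>2 * (1 - \<beta> j) / \<eta> \<le> real s" using real_arch_simple by blast
    also have "real s \<le> (real (Suc s))\<^sup>2" by (simp add: power2_eq_square algebra_simps)
    finally show ?thesis using eta_pos by (auto simp: P_def field_simps)
  qed
  have lev: "P j (lev j)" for j unfolding lev_def by (rule LeastI_ex[OF ex])
  have dec: "decay t j \<le> exp (- (\<eta> * (real (lev j))\<^sup>2 / 8))" if j: "j \<in> J" for j
  proof -
    have "\<eta> * (real (lev j))\<^sup>2 \<le> 8 * (real \<rho>)\<^sup>2 * (1 - \<beta> j)"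
    proof (cases "lev j")
      case 0
      then show ?thesis using beta_le_1[OF j] by simp
    next
      case (Suc s)
      then have "\<not> P j s" unfolding lev_def using not_less_Least by (metis lessI)
      then show ?thesis using Suc by (simp add: P_def)
    qed
    also have "\<dots> \<le> 8 * t * (1 - \<beta> j)"
      using t beta_le_1[OF j] by (intro mult_right_mono mult_left_mono) auto
    finally show ?thesis by (simp add: decay_def)
  qed
  have "(\<Sum>j\<in>J. decay t j) \<le> (\<Sum>j\<in>J. exp (- (\<eta> * (real (lev j))\<^sup>2 / 8)))"
    by (intro sum_mono dec)
  also have "\<dots> = (\<Sum>s\<in>lev ` J. \<Sum>j\<in>{j\<in>J. lev j = s}. exp (- (\<eta> * (real (lev j))\<^sup>2 / 8)))"
    by (rule sum.image_gen[OF finite_J])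
  also have "\<dots> \<le> (\<Sum>s\<in>lev ` J. trace_term A \<eta> D s)"
  proof (rule sum_mono)
    fix s
    have "real (card {j\<in>J. lev j = s}) \<le> real (card {j\<in>J. P j s})"
      using finite_J lev by (intro of_nat_mono card_mono) auto
    also have "\<dots> \<le> 4 * A / \<eta> * (2 * real (Suc s)) ^ D"
      unfolding P_def by (rule eigenvalue_count_growth)
    finally have "real (card {j\<in>J. lev j = s}) * exp (- (\<eta> * (real s)\<^sup>2 / 8)) \<le> trace_term A \<eta> D s"
      unfolding trace_term_def by (intro mult_right_mono) auto
    then show "(\<Sum>j\<in>{j\<in>J. lev j = s}. exp (- (\<eta> * (real (lev j))\<^sup>2 / 8))) \<le> trace_term A \<eta> D s"
      by simp
  qed
  also have "\<dots> \<le> (\<Sum>s. trace_term A \<eta> D s)"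
    using finite_J A_pos eta_pos
    by (intro sum_le_suminf summable_trace_term) (auto simp: trace_term_def)
  finally show ?thesis .
qed

section \<open>Word length as a test function\<close>

definition wlen :: "'a \<Rightarrow> nat" where
  "wlen x = (LEAST m. x \<in> set_pow G E m)"

lemma wlen_mem: "x \<in> carrier G \<Longrightarrow> x \<in> set_pow G E (wlen x)"
  unfolding wlen_def by (rule LeastI[where k = \<rho>]) (simp add: rho_full)

lemma wlen_le: "x \<in> set_pow G E m \<Longrightarrow> wlen x \<le> m"
  unfolding wlen_def by (rule Least_le)

lemma wlen_le_rho: "x \<in> carrier G \<Longrightarrow> wlen x \<le> \<rho>"
  by (rule wlen_le) (simp add: rho_full)

lemma wlen_mult: "x \<in> carrier G \<Longrightarrow> y \<in> set_pow G E m \<Longrightarrow> wlen (x \<otimes> y) \<le> wlen x + m"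
  by (intro wlen_le set_pow_add support_subset wlen_mem)

lemma wlen_mult_ge:
  assumes x: "x \<in> carrier G" and y: "y \<in> set_pow G E m"
  shows "wlen x \<le> wlen (x \<otimes> y) + m"
proof -
  have "wlen ((x \<otimes> y) \<otimes> inv y) \<le> wlen (x \<otimes> y) + m"
    using x y pow_closed by (intro wlen_mult inv_pow) auto
  then show ?thesis using x y pow_closed by (simp add: m_assoc)
qed

text \<open>If word length changed along every edge, it would have the parity of the number of letters of any word;
  but some powers of \<open>E\<close> of both parities exhaust the group.\<close>

lemma odd_edge: "\<exists>x\<in>carrier G. \<exists>s\<in>E. wlen (x \<otimes> s) = wlen x"
proof (rule ccontr)
  assume no: "\<not> ?thesis"
  have parity: "even (wlen y) \<longleftrightarrow> even m" if "y \<in> set_pow G E m" for y m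
    using that
  proof (induction m arbitrary: y)
    case 0
    then have "wlen y \<le> 0" by (intro wlen_le)
    then show ?case by simp
  next
    case (Suc m)
    then obtain z s where zs: "z \<in> set_pow G E m" "s \<in> E" "y = z \<otimes> s" by (auto simp: set_mult_def)
    have c: "z \<in> carrier G" and s1: "s \<in> set_pow G E 1"
      using zs pow_closed set_pow_one[OF support_subset] by auto
    have "wlen y \<noteq> wlen z" using no c zs by auto
    then have "wlen y = wlen z + 1 \<or> wlen z = wlen y + 1"
      using wlen_mult[OF c s1] wlen_mult_ge[OF c s1] zs(3) by auto
    then show ?case using Suc.IH[OF zs(1)] by auto
  qed
  have "\<one> \<in> set_pow G E \<rho>" "\<one> \<in> set_pow G E (Suc \<rho>)"
    using set_pow_full[OF support_subset E_ne rho_full, of "Suc \<rho>"] rho_full by auto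
  from parity[OF this(1)] parity[OF this(2)] show False by simp
qed

text \<open>The powers \<open>E\<^sup>m\<close> need not increase, since \<open>E\<close> may lack the identity, so word lengths up to \<open>R\<close> do
  not give \<open>\<rho> \<le> R\<close>.  An edge between elements of equal length closes to an odd loop at \<open>\<one>\<close>, of length at most
  \<open>2 R + 1\<close>; together with loops \<open>s \<otimes> inv s\<close> it pads every word to length exactly \<open>3 R + 1\<close>.\<close>

lemma rho_le_wlen:
  assumes R: "\<And>x. x \<in> carrier G \<Longrightarrow> wlen x \<le> R"
  shows "\<rho> \<le> 3 * R + 1"
proof (rule rho_le)
  obtain x s where x: "x \<in> carrier G" and s: "s \<in> E" and eq: "wlen (x \<otimes> s) = wlen x"
    using odd_edge by blast
  define r where "r = wlen x"
  have rR: "r \<le> R" using R[OF x] by (simp add: r_def)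
  have sc: "s \<in> carrier G" and s1: "s \<in> set_pow G E 1"
    using s support_subset set_pow_one[OF support_subset] by auto
  have odd1: "\<one> \<in> set_pow G E (2 * r + 1)"
  proof -
    have "x \<otimes> s \<in> set_pow G E (r + 1)"
      using set_pow_add[OF support_subset wlen_mem[OF x] s1] by (simp add: r_def)
    moreover have "inv (x \<otimes> s) \<in> set_pow G E r"
      using inv_pow[OF wlen_mem[of "x \<otimes> s"]] x sc eq by (simp add: r_def)
    ultimately have "(x \<otimes> s) \<otimes> inv (x \<otimes> s) \<in> set_pow G E ((r + 1) + r)"
      by (rule set_pow_add[OF support_subset])
    then show ?thesis using x sc by (simp add: mult_2)
  qed
  have "s \<otimes> inv s \<in> set_pow G E (1 + 1)"
    by (intro set_pow_add support_subset s1 inv_pow)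
  then have two: "\<one> \<in> set_pow G E 2" using sc by (simp add: numeral_2_eq_2)
  have even: "\<one> \<in> set_pow G E (2 * k)" for k
  proof (induction k)
    case (Suc k)
    from set_pow_add[OF support_subset two this] show ?case by simp
  qed simp
  have "y \<in> set_pow G E (3 * R + 1)" if y: "y \<in> carrier G" for y
  proof -
    have wR: "wlen y \<le> R" by (rule R[OF y])
    show ?thesis
    proof (cases "even (3 * R + 1 - wlen y)")
      case True
      then obtain k where "3 * R + 1 - wlen y = 2 * k" by blast
      then have "3 * R + 1 = wlen y + 2 * k" using wR by simp
      then show ?thesis
        using set_pow_add[OF support_subset wlen_mem[OF y] even[of k]] y by simp
    next
      case False
      then have "even (3 * R + 1 - wlen y - (2 * r + 1))" using wR rR by simp
      then obtain k where "3 * R + 1 - wlen y - (2 * r + 1) = 2 * k" by blast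
      then have "3 * R + 1 = wlen y + ((2 * r + 1) + 2 * k)" using wR rR by simp
      then show ?thesis
        using set_pow_add[OF support_subset wlen_mem[OF y] set_pow_add[OF support_subset odd1 even[of k]]] y
        by simp
    qed
  qed
  then show "set_pow G E (3 * R + 1) = carrier G" using pow_closed by blast
qed simp

lemma variance_spectral:
  "(\<Sum>x\<in>carrier G. \<Sum>y\<in>carrier G. (f x - f y)\<^sup>2) = 2 * N * (\<Sum>j\<in>J-{j0}. (coef f j)\<^sup>2)"
proof -
  have "(\<Sum>x\<in>carrier G. \<Sum>y\<in>carrier G. (f x - f y)\<^sup>2) =
      (\<Sum>x\<in>carrier G. \<Sum>y\<in>carrier G. (f x)\<^sup>2 + (f y)\<^sup>2 - 2 * (f x * f y))"
    by (simp add: power2_diff mult.assoc)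
  also have "\<dots> = 2 * N * (\<Sum>x\<in>carrier G. (f x)\<^sup>2) - 2 * (\<Sum>x\<in>carrier G. f x)\<^sup>2"
    by (simp add: sum.distrib sum_subtractf sum_distrib_left[symmetric] sum_distrib_right[symmetric]
        power2_eq_square)
  also have "(\<Sum>x\<in>carrier G. f x)\<^sup>2 = N * (coef f j0)\<^sup>2"
    using N_pos by (simp add: coef_def const_j0 sum_divide_distrib[symmetric] power_divide)
  also have "(\<Sum>x\<in>carrier G. (f x)\<^sup>2) = (coef f j0)\<^sup>2 + (\<Sum>j\<in>J-{j0}. (coef f j)\<^sup>2)"
    unfolding parseval using j0 finite_J by (simp add: sum.remove)
  finally show ?thesis by (simp add: algebra_simps)
qed

lemma rayleigh:
  assumes le: "\<And>j. j \<in> J - {j0} \<Longrightarrow> L \<le> 1 - \<beta> j"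
  shows "L * (\<Sum>x\<in>carrier G. \<Sum>y\<in>carrier G. (f x - f y)\<^sup>2) \<le> N * energy f"
proof -
  have "L * (\<Sum>j\<in>J-{j0}. (coef f j)\<^sup>2) \<le> (\<Sum>j\<in>J-{j0}. (1 - \<beta> j) * (coef f j)\<^sup>2)"
    unfolding sum_distrib_left by (intro sum_mono mult_right_mono le) auto
  also have "\<dots> = (\<Sum>j\<in>J. (1 - \<beta> j) * (coef f j)\<^sup>2)"
    using finite_J j0 by (intro sum.mono_neutral_left) auto
  finally have "2 * N * (L * (\<Sum>j\<in>J-{j0}. (coef f j)\<^sup>2)) \<le> 2 * N * (\<Sum>j\<in>J. (1 - \<beta> j) * (coef f j)\<^sup>2)"
    by (intro mult_left_mono) auto
  then show ?thesis unfolding variance_spectral energy_spectral by (simp add: algebra_simps)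
qed

lemma energy_wlen: "energy (\<lambda>x. real (wlen x)) \<le> N"
proof -
  have "transition G Q x y * (real (wlen x) - real (wlen y))\<^sup>2 \<le> transition G Q x y"
    if x: "x \<in> carrier G" and y: "y \<in> carrier G" for x y
  proof (cases "inv x \<otimes> y \<in> E")
    case True
    then have s1: "inv x \<otimes> y \<in> set_pow G E 1" using set_pow_one[OF support_subset] by simp
    have "x \<otimes> (inv x \<otimes> y) = y" using x y by (simp add: m_assoc[symmetric])
    then have "wlen y \<le> wlen x + 1" "wlen x \<le> wlen y + 1"
      using wlen_mult[OF x s1] wlen_mult_ge[OF x s1] by auto
    then have "\<bar>real (wlen x) - real (wlen y)\<bar> \<le> 1" by linarith
    then have "(real (wlen x) - real (wlen y))\<^sup>2 \<le> 1" by (simp add: abs_square_le_1)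
    from mult_left_mono[OF this, of "transition G Q x y"] show ?thesis by (simp add: transition_def)
  next
    case False
    then show ?thesis by (simp add: transition_def set_pmf_iff)
  qed
  then have "energy (\<lambda>x. real (wlen x)) \<le> (\<Sum>x\<in>carrier G. \<Sum>y\<in>carrier G. transition G Q x y)"
    unfolding energy_def by (intro sum_mono) auto
  also have "\<dots> = N" by (simp add: transition_row)
  finally show ?thesis .
qed

text \<open>The word length changes by at most one in a step, so its energy is at most \<open>N\<close>, whereas it varies by a
  multiple of \<open>\<rho>\<close> on a positive fraction of pairs: by growth, balls of radius \<open>R / 4\<close> around \<open>\<one>\<close> and around
  an element of maximal length \<open>R\<close> fill such a fraction.\<close>

lemma small_eigenvalue:
  assumes N1: "N > 1"
  shows "\<exists>j\<in>J-{j0}. (1 - \<beta> j) * (real \<rho>)\<^sup>2 \<le> 200 + 64 * A\<^sup>2 * (32 ^ D)\<^sup>2"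
proof -
  have ne: "J - {j0} \<noteq> {}"
    using N1 card_J finite_J j0 by (metis card_Diff_singleton card.empty diff_is_0_eq not_le)
  define R where "R = Max (wlen ` carrier G)"
  have R: "wlen x \<le> R" if "x \<in> carrier G" for x
    unfolding R_def using that finite_carrier by auto
  obtain z where z: "z \<in> carrier G" "wlen z = R"
  proof -
    have "R \<in> wlen ` carrier G"
      unfolding R_def using finite_carrier carrier_ne by (intro Max_in) auto
    then show thesis using that by blast
  qed
  have rho3: "\<rho> \<le> 3 * R + 1" by (rule rho_le_wlen[OF R])
  show ?thesis
  proof (cases "R < 4")
    case True
    \<comment> \<open>A bounded diameter leaves only the trivial bound \<open>\<lambda> \<le> 2\<close>, where \<open>\<rho> \<le> 10\<close>.\<close>
    obtain j where j: "j \<in> J - {j0}" using ne by blast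
    have "1 - \<beta> j \<le> 2" using beta_lower[of j] j pmf_nonneg[of Q \<one>] by (auto simp del: pmf_nonneg)
    moreover have "(real \<rho>)\<^sup>2 \<le> 10\<^sup>2" using rho3 True by (intro power_mono) auto
    ultimately have "(1 - \<beta> j) * (real \<rho>)\<^sup>2 \<le> 2 * 10\<^sup>2"
      using beta_le_1[of j] j by (intro mult_mono) auto
    also have "\<dots> \<le> 200 + 64 * A\<^sup>2 * (32 ^ D)\<^sup>2" by simp
    finally show ?thesis using j by blast
  next
    case False
    define m where "m = R div 4"
    have m1: "1 \<le> m" using False by (simp add: m_def)
    have R8: "R \<le> 8 * m" using False unfolding m_def by presburger
    have m4: "4 * m \<le> R" by (simp add: m_def)
    have rho4: "\<rho> \<le> 4 * R" using rho3 False by simp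
    have mrho: "m \<le> \<rho>" using m4 wlen_le_rho[OF z(1)] z(2) by simp
    define L where "L = Min ((\<lambda>j. 1 - \<beta> j) ` (J - {j0}))"
    have "L \<in> (\<lambda>j. 1 - \<beta> j) ` (J - {j0})"
      unfolding L_def using ne finite_J by (intro Min_in) auto
    then obtain j where j: "j \<in> J - {j0}" "L = 1 - \<beta> j" by auto
    have L: "L \<le> 1 - \<beta> i" if "i \<in> J - {j0}" for i
      unfolding L_def using that finite_J by auto
    have L0: "L \<ge> 0" using j beta_le_1[of j] by simp
    define f where "f x = real (wlen x)" for x
    let ?B0 = "set_pow G E m" and ?B1 = "(\<lambda>y. z \<otimes> y) ` set_pow G E m"
    have inj: "inj_on (\<lambda>y. z \<otimes> y) (set_pow G E m)"
      using z pow_closed by (auto simp: inj_on_def)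
    have sub: "?B0 \<subseteq> carrier G" "?B1 \<subseteq> carrier G" using z pow_closed by auto
    have sq: "(real R / 2)\<^sup>2 \<le> (f x - f y)\<^sup>2" if x: "x \<in> ?B1" and y: "y \<in> ?B0" for x y
    proof -
      from x obtain w where w: "w \<in> set_pow G E m" "x = z \<otimes> w" by auto
      have "R \<le> wlen x + m" using wlen_mult_ge[OF z(1) w(1)] w z by simp
      moreover have "wlen y \<le> m" by (rule wlen_le[OF y])
      ultimately have "real R / 2 \<le> f x - f y" using m4 unfolding f_def by linarith
      then show ?thesis by (intro power_mono) auto
    qed
    have "(real (V m))\<^sup>2 * (real R / 2)\<^sup>2 = (\<Sum>x\<in>?B1. \<Sum>y\<in>?B0. (real R / 2)\<^sup>2)"
      by (simp add: card_image[OF inj] power2_eq_square)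
    also have "\<dots> \<le> (\<Sum>x\<in>?B1. \<Sum>y\<in>?B0. (f x - f y)\<^sup>2)" by (intro sum_mono sq)
    also have "\<dots> \<le> (\<Sum>x\<in>?B1. \<Sum>y\<in>carrier G. (f x - f y)\<^sup>2)"
      using finite_carrier sub by (intro sum_mono sum_mono2) auto
    also have "\<dots> \<le> (\<Sum>x\<in>carrier G. \<Sum>y\<in>carrier G. (f x - f y)\<^sup>2)"
      using finite_carrier sub by (intro sum_mono2 sum_nonneg) auto
    finally have "L * ((real (V m))\<^sup>2 * (real R / 2)\<^sup>2) \<le> L * (\<Sum>x\<in>carrier G. \<Sum>y\<in>carrier G. (f x - f y)\<^sup>2)"
      using L0 by (rule mult_left_mono)
    also have "\<dots> \<le> N * energy f" by (rule rayleigh[OF L])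
    also have "\<dots> \<le> real N * real N" using energy_wlen by (intro mult_left_mono) (auto simp: f_def[abs_def])
    finally have main: "L * ((real (V m))\<^sup>2 * (real R / 2)\<^sup>2) \<le> (real N)\<^sup>2" by (simp add: power2_eq_square)
    have "real N \<le> 32 ^ D * (A * V m)"
    proof -
      have "1 / 32 \<le> real m / real \<rho>" using rho4 R8 rho_ge_1 by (simp add: field_simps)
      then have "(1 / 32) ^ D * real N \<le> (real m / real \<rho>) ^ D * N"
        by (intro mult_right_mono power_mono) auto
      also have "\<dots> \<le> A * V m" by (rule growth[OF m1 mrho])
      finally show ?thesis by (simp add: power_divide field_simps)
    qed
    then have "(real N)\<^sup>2 \<le> (32 ^ D * (A * V m))\<^sup>2" by (intro power_mono) auto
    with main have "(real (V m))\<^sup>2 * (L * (real R / 2)\<^sup>2) \<le> (real (V m))\<^sup>2 * ((32 ^ D)\<^sup>2 * A\<^sup>2)"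
      by (simp add: power_mult_distrib mult_ac)
    then have LR: "L * (real R / 2)\<^sup>2 \<le> (32 ^ D)\<^sup>2 * A\<^sup>2"
      using V_pos[of m] by simp
    have "(real \<rho>)\<^sup>2 \<le> (8 * (real R / 2))\<^sup>2" using rho4 by (intro power_mono) auto
    then have "L * (real \<rho>)\<^sup>2 \<le> L * (8 * (real R / 2))\<^sup>2" using L0 by (intro mult_left_mono)
    also have "\<dots> = 64 * (L * (real R / 2)\<^sup>2)" by (simp only: power_mult_distrib) simp
    also have "\<dots> \<le> 200 + 64 * A\<^sup>2 * (32 ^ D)\<^sup>2" using LR by (simp add: mult_ac)
    finally have "(1 - \<beta> j) * (real \<rho>)\<^sup>2 \<le> 200 + 64 * A\<^sup>2 * (32 ^ D)\<^sup>2" using j by simp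
    then show ?thesis using j by blast
  qed
qed

end

section \<open>Products of walks\<close>

lemma sqrt_prod: "sqrt (prod f I) = (\<Prod>i\<in>I. sqrt (f i))"
  by (induction I rule: infinite_finite_induct) (auto simp: real_sqrt_mult)

locale product_walk =
  fixes I :: "'i set" and G :: "'i \<Rightarrow> ('a, 'b) monoid_scheme" and Q :: "'i \<Rightarrow> 'a pmf"
    and J :: "'i \<Rightarrow> 'j set" and j0 :: "'i \<Rightarrow> 'j" and \<phi> :: "'i \<Rightarrow> 'j \<Rightarrow> 'a \<Rightarrow> real"
    and \<beta> :: "'i \<Rightarrow> 'j \<Rightarrow> real" and r :: "'i \<Rightarrow> real"
  assumes finite_I: "finite I"
    and factor: "\<And>i. i \<in> I \<Longrightarrow> spectral_walk (G i) (Q i) (J i) (j0 i) (\<phi> i) (\<beta> i)"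
    and r_nonneg: "\<And>i. i \<in> I \<Longrightarrow> 0 \<le> r i" and r_sum: "sum r I = 1"
begin

text \<open>Eigenfunctions of the product and their eigenvalues.\<close>

definition \<Phi> :: "('i \<Rightarrow> 'j) \<Rightarrow> ('i \<Rightarrow> 'a) \<Rightarrow> real" where
  "\<Phi> \<alpha> x = (\<Prod>i\<in>I. \<phi> i (\<alpha> i) (x i))"

definition B :: "('i \<Rightarrow> 'j) \<Rightarrow> real" where
  "B \<alpha> = (\<Sum>i\<in>I. r i * \<beta> i (\<alpha> i))"

lemma factor_group: "i \<in> I \<Longrightarrow> group (G i)"
  using factor by (simp add: spectral_walk_def)

lemma factor_finite: "i \<in> I \<Longrightarrow> finite (carrier (G i))"
  by (rule spectral_walk.finite_carrier[OF factor])

lemma finite_product: "finite (PiE I (\<lambda>i. carrier (G i)))"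
  using finite_I factor_finite by (intro finite_PiE) auto

lemma pmf_factor_embed:
  assumes i: "i \<in> I"
  shows "pmf (map_pmf (factor_embed I G i) (Q i)) g =
    (if g = factor_embed I G i (g i) then pmf (Q i) (g i) else 0)"
proof -
  have at: "factor_embed I G i x i = x" for x using i by (simp add: factor_embed_def)
  show ?thesis
  proof (cases "g = factor_embed I G i (g i)")
    case True
    have "inj (factor_embed I G i)" by (rule injI) (metis at)
    then have "pmf (map_pmf (factor_embed I G i) (Q i)) (factor_embed I G i (g i)) = pmf (Q i) (g i)"
      by (rule pmf_map_inj')
    then show ?thesis using True by simp
  next
    case False
    then have "g \<notin> factor_embed I G i ` set_pmf (Q i)" using at by auto
    then show ?thesis using False by (simp add: pmf_map_outside)
  qed
qed

lemma pmf_product: "pmf (product_driver I r G Q) g =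
    (\<Sum>i\<in>I. r i * (if g = factor_embed I G i (g i) then pmf (Q i) (g i) else 0))"
  by (simp add: pmf_product_driver[OF finite_I r_nonneg r_sum] pmf_factor_embed)

lemma product_support: "set_pmf (product_driver I r G Q) \<subseteq> PiE I (\<lambda>i. carrier (G i))"
proof
  fix g assume "g \<in> set_pmf (product_driver I r G Q)"
  then have "pmf (product_driver I r G Q) g \<noteq> 0" by (simp add: set_pmf_iff)
  then obtain i where i: "i \<in> I"
      "r i * (if g = factor_embed I G i (g i) then pmf (Q i) (g i) else 0) \<noteq> 0"
    unfolding pmf_product using sum.not_neutral_contains_not_neutral by blast
  then have g: "g = factor_embed I G i (g i)" and "g i \<in> set_pmf (Q i)"
    by (auto simp: set_pmf_iff split: if_splits)
  then have gi: "g i \<in> carrier (G i)"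
    using spectral_walk.support_subset[OF factor[OF i(1)]] by blast
  have "factor_embed I G i (g i) \<in> PiE I (\<lambda>i. carrier (G i))"
    using gi factor_group by (auto simp: factor_embed_def intro!: monoid.one_closed group.is_monoid)
  then show "g \<in> PiE I (\<lambda>i. carrier (G i))" using g by simp
qed

lemma of_bool_PiE:
  assumes "\<alpha> \<in> PiE I X" "\<gamma> \<in> PiE I X"
  shows "(\<Prod>i\<in>I. of_bool (\<alpha> i = \<gamma> i)) = (of_bool (\<alpha> = \<gamma>) :: real)"
proof (cases "\<alpha> = \<gamma>")
  case False
  then obtain i where "i \<in> I" "\<alpha> i \<noteq> \<gamma> i" using assms by (meson PiE_ext)
  then show ?thesis using False finite_I by (auto simp: prod_zero_iff)
qed simp

text \<open>A move of coordinate \<open>i\<close> ends at \<open>y\<close> only if it starts at \<open>y(i := w)\<close> for some \<open>w\<close>, so the sum over starting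
  points reduces to the eigenvalue equation of the \<open>i\<close>th factor.\<close>

lemma coordinate_move:
  assumes i: "i \<in> I" and \<alpha>: "\<alpha> \<in> PiE I J" and y: "y \<in> PiE I (\<lambda>i. carrier (G i))"
  defines "g \<equiv> \<lambda>x. inv\<^bsub>product_group I G\<^esub> x \<otimes>\<^bsub>product_group I G\<^esub> y"
  shows "(\<Sum>x\<in>PiE I (\<lambda>i. carrier (G i)).
      \<Phi> \<alpha> x * (if g x = factor_embed I G i (g x i) then pmf (Q i) (g x i) else 0)) =
    \<beta> i (\<alpha> i) * \<Phi> \<alpha> y"
proof -
  interpret F: spectral_walk "G i" "Q i" "J i" "j0 i" "\<phi> i" "\<beta> i" by (rule factor[OF i])
  let ?C = "PiE I (\<lambda>i. carrier (G i))"
  let ?h = "\<lambda>x. \<Phi> \<alpha> x * (if g x = factor_embed I G i (g x i) then pmf (Q i) (g x i) else 0)"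
  have g: "g x = (\<lambda>j\<in>I. inv\<^bsub>G j\<^esub> x j \<otimes>\<^bsub>G j\<^esub> y j)" if "x \<in> ?C" for x
    unfolding g_def using that factor_group by (auto simp: fun_eq_iff)
  have upd: "y(i := w) \<in> ?C" if "w \<in> carrier (G i)" for w
    using y i that by (auto simp: PiE_iff extensional_def)
  have outside: "?h x = 0" if x: "x \<in> ?C" "x \<notin> (\<lambda>w. y(i := w)) ` carrier (G i)" for x
  proof -
    have "g x \<noteq> factor_embed I G i (g x i)"
    proof
      assume eq: "g x = factor_embed I G i (g x i)"
      have "x j = y j" if j: "j \<in> I" "j \<noteq> i" for j
      proof -
        interpret Gj: group "G j" by (rule factor_group[OF j(1)])
        have "inv\<^bsub>G j\<^esub> x j \<otimes>\<^bsub>G j\<^esub> y j = \<one>\<^bsub>G j\<^esub>"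
          using fun_cong[OF eq, of j] j by (simp add: g[OF x(1)] factor_embed_def)
        moreover have "x j \<in> carrier (G j)" "y j \<in> carrier (G j)" using x(1) y j by auto
        ultimately show ?thesis
          by (metis Gj.inv_closed Gj.inv_inv Gj.inv_equality Gj.inv_comm)
      qed
      then have "x = y(i := x i)"
        using x(1) y i by (intro PiE_ext[of _ I "\<lambda>i. carrier (G i)"]) (auto simp: PiE_iff extensional_def)
      moreover have "x i \<in> carrier (G i)" using x(1) i by auto
      ultimately show False using x(2) by blast
    qed
    then show ?thesis by simp
  qed
  have inside: "?h (y(i := w)) = (\<phi> i (\<alpha> i) w * transition (G i) (Q i) w (y i)) *
      (\<Prod>j\<in>I-{i}. \<phi> j (\<alpha> j) (y j))" if w: "w \<in> carrier (G i)" for w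
  proof -
    have gi: "g (y(i := w)) i = inv\<^bsub>G i\<^esub> w \<otimes>\<^bsub>G i\<^esub> y i" using g[OF upd[OF w]] i by simp
    have "g (y(i := w)) = factor_embed I G i (g (y(i := w)) i)"
    proof
      fix j show "g (y(i := w)) j = factor_embed I G i (g (y(i := w)) i) j"
      proof (cases "j \<in> I \<and> j \<noteq> i")
        case True
        then have "y j \<in> carrier (G j)" "group (G j)" using y factor_group by auto
        then show ?thesis using True by (simp add: g[OF upd[OF w]] factor_embed_def group.l_inv)
      next
        case False
        then show ?thesis using i by (auto simp: g[OF upd[OF w]] factor_embed_def)
      qed
    qed
    moreover have "\<Phi> \<alpha> (y(i := w)) = \<phi> i (\<alpha> i) w * (\<Prod>j\<in>I-{i}. \<phi> j (\<alpha> j) (y j))"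
      unfolding \<Phi>_def using finite_I i by (subst prod.remove[of I i]) (auto intro!: prod.cong)
    ultimately have "?h (y(i := w)) = \<phi> i (\<alpha> i) w * (\<Prod>j\<in>I-{i}. \<phi> j (\<alpha> j) (y j)) *
        pmf (Q i) (g (y(i := w)) i)"
      by (simp only: if_True simp_thms)
    then show ?thesis by (simp add: gi transition_def mult_ac)
  qed
  have "(\<Sum>x\<in>?C. ?h x) = (\<Sum>x\<in>(\<lambda>w. y(i := w)) ` carrier (G i). ?h x)"
    using finite_product upd outside by (intro sum.mono_neutral_right) auto
  also have "\<dots> = (\<Sum>w\<in>carrier (G i). ?h (y(i := w)))"
    by (subst sum.reindex) (auto simp: inj_on_def dest: fun_upd_eqD)
  also have "\<dots> = (\<Sum>w\<in>carrier (G i). \<phi> i (\<alpha> i) w * transition (G i) (Q i) w (y i)) *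
      (\<Prod>j\<in>I-{i}. \<phi> j (\<alpha> j) (y j))"
    unfolding sum_distrib_right by (intro sum.cong refl inside)
  also have "(\<Sum>w\<in>carrier (G i). \<phi> i (\<alpha> i) w * transition (G i) (Q i) w (y i)) = \<beta> i (\<alpha> i) * \<phi> i (\<alpha> i) (y i)"
    using F.basis PiE_mem[OF \<alpha> i] PiE_mem[OF y i] by (simp add: eigenbasis_def eigenframe_def)
  also have "\<beta> i (\<alpha> i) * \<phi> i (\<alpha> i) (y i) * (\<Prod>j\<in>I-{i}. \<phi> j (\<alpha> j) (y j)) = \<beta> i (\<alpha> i) * \<Phi> \<alpha> y"
    unfolding \<Phi>_def using finite_I i by (subst prod.remove[of I i]) auto
  finally show ?thesis .
qed

lemma product_spectral_walk:
  "spectral_walk (product_group I G) (product_driver I r G Q) (PiE I J) (restrict j0 I) \<Phi> B"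
proof -
  let ?C = "PiE I (\<lambda>i. carrier (G i))"
  have "group (product_group I G)" using factor_group by simp
  moreover have "spectral_walk_axioms (product_group I G) (product_driver I r G Q) (PiE I J) (restrict j0 I) \<Phi> B"
  proof
    show "finite (carrier (product_group I G))" using finite_product by simp
    show "set_pmf (product_driver I r G Q) \<subseteq> carrier (product_group I G)" using product_support by simp
    show "restrict j0 I \<in> PiE I J" using spectral_walk.j0(1)[OF factor] by auto
    show "B (restrict j0 I) = 1" using spectral_walk.j0(2)[OF factor] r_sum by (simp add: B_def)
    show "\<Phi> (restrict j0 I) x = 1 / sqrt (real (card (carrier (product_group I G))))"
      if "x \<in> carrier (product_group I G)" for x
    proof -
      have "\<Phi> (restrict j0 I) x = (\<Prod>i\<in>I. 1 / sqrt (card (carrier (G i))))"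
        unfolding \<Phi>_def using that
        by (intro prod.cong refl) (auto simp: PiE_iff spectral_walk.const_j0[OF factor])
      also have "\<dots> = 1 / sqrt (\<Prod>i\<in>I. real (card (carrier (G i))))"
        by (simp add: prod_dividef sqrt_prod)
      finally show ?thesis using finite_I by (simp add: card_PiE)
    qed
    show "eigenbasis (carrier (product_group I G)) (transition (product_group I G) (product_driver I r G Q)) (PiE I J) \<Phi> B"
      unfolding eigenbasis_def eigenframe_def
    proof (intro conjI ballI)
      show "finite (PiE I J)"
        using finite_I spectral_walk.finite_J[OF factor] by (intro finite_PiE) auto
      fix \<alpha> assume \<alpha>: "\<alpha> \<in> PiE I J"
      {
        fix \<gamma> assume \<gamma>: "\<gamma> \<in> PiE I J"
        have "(\<Sum>x\<in>?C. \<Phi> \<alpha> x * \<Phi> \<gamma> x) = (\<Prod>i\<in>I. \<Sum>w\<in>carrier (G i). \<phi> i (\<alpha> i) w * \<phi> i (\<gamma> i) w)"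
          using finite_I factor_finite by (subst prod_sum_PiE) (auto simp: \<Phi>_def prod.distrib)
        also have "\<dots> = (\<Prod>i\<in>I. of_bool (\<alpha> i = \<gamma> i))"
          using \<alpha> \<gamma> by (intro prod.cong refl) (auto simp: PiE_iff spectral_walk.orth[OF factor])
        finally show "(\<Sum>x\<in>carrier (product_group I G). \<Phi> \<alpha> x * \<Phi> \<gamma> x) = of_bool (\<alpha> = \<gamma>)"
          using of_bool_PiE[OF \<alpha> \<gamma>] by simp
      }
      fix y assume "y \<in> carrier (product_group I G)"
      then have y: "y \<in> ?C" by simp
      let ?g = "\<lambda>x. inv\<^bsub>product_group I G\<^esub> x \<otimes>\<^bsub>product_group I G\<^esub> y"
      let ?p = "\<lambda>i x. if ?g x = factor_embed I G i (?g x i) then pmf (Q i) (?g x i) else 0"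
      have "(\<Sum>x\<in>?C. \<Phi> \<alpha> x * transition (product_group I G) (product_driver I r G Q) x y) =
          (\<Sum>x\<in>?C. \<Sum>i\<in>I. r i * (\<Phi> \<alpha> x * ?p i x))"
        unfolding transition_def pmf_product sum_distrib_left
        by (intro sum.cong refl) (simp only: mult_ac)
      also have "\<dots> = (\<Sum>i\<in>I. r i * (\<Sum>x\<in>?C. \<Phi> \<alpha> x * ?p i x))"
        by (subst sum.swap) (simp only: sum_distrib_left)
      also have "\<dots> = (\<Sum>i\<in>I. r i * (\<beta> i (\<alpha> i) * \<Phi> \<alpha> y))"
        by (intro sum.cong refl arg_cong2[where f = "(*)"] coordinate_move \<alpha> y)
      also have "\<dots> = B \<alpha> * \<Phi> \<alpha> y" by (simp add: B_def sum_distrib_right mult.assoc)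
      finally show "(\<Sum>x\<in>carrier (product_group I G). \<Phi> \<alpha> x *
          transition (product_group I G) (product_driver I r G Q) x y) = B \<alpha> * \<Phi> \<alpha> y"
        by (simp only: carrier_product_group)
    next
      fix x y assume "x \<in> carrier (product_group I G)" "y \<in> carrier (product_group I G)"
      then have x: "x \<in> ?C" and y: "y \<in> ?C" by auto
      have "(\<Sum>\<alpha>\<in>PiE I J. \<Phi> \<alpha> x * \<Phi> \<alpha> y) = (\<Prod>i\<in>I. \<Sum>j\<in>J i. \<phi> i j (x i) * \<phi> i j (y i))"
        using finite_I spectral_walk.finite_J[OF factor]
        by (subst prod_sum_PiE) (auto simp: \<Phi>_def prod.distrib)
      also have "\<dots> = (\<Prod>i\<in>I. of_bool (x i = y i))"
        using x y by (intro prod.cong refl) (auto simp: PiE_iff spectral_walk.complete[OF factor])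
      finally show "(\<Sum>\<alpha>\<in>PiE I J. \<Phi> \<alpha> x * \<Phi> \<alpha> y) = of_bool (x = y)"
        using of_bool_PiE[OF x y] by simp
    qed
  qed
  ultimately show ?thesis by (simp add: spectral_walk_def)
qed

sublocale prod: spectral_walk "product_group I G" "product_driver I r G Q" "PiE I J" "restrict j0 I" \<Phi> B
  by (rule product_spectral_walk)

lemma decay_product:
  "prod.decay t \<alpha> = (\<Prod>i\<in>I. exp (- (r i * t * (1 - \<beta> i (\<alpha> i)))))"
proof -
  have "t * (1 - B \<alpha>) = (\<Sum>i\<in>I. r i * t * (1 - \<beta> i (\<alpha> i)))"
  proof -
    have "(\<Sum>i\<in>I. r i * t * (1 - \<beta> i (\<alpha> i))) = (\<Sum>i\<in>I. t * r i - t * (r i * \<beta> i (\<alpha> i)))"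
      by (intro sum.cong) (auto simp: algebra_simps)
    also have "\<dots> = t * sum r I - t * B \<alpha>"
      by (simp add: B_def sum_subtractf sum_distrib_left)
    finally show ?thesis using r_sum by (simp add: algebra_simps)
  qed
  then show ?thesis using finite_I by (simp add: prod.decay_def exp_sum sum_negf[symmetric])
qed

lemma heat_product:
  assumes x: "x \<in> PiE I (\<lambda>i. carrier (G i))" and y: "y \<in> PiE I (\<lambda>i. carrier (G i))"
  shows "heat_kernel (product_group I G) (product_driver I r G Q) t x y =
    (\<Prod>i\<in>I. heat_kernel (G i) (Q i) (r i * t) (x i) (y i))"
proof -
  have "heat_kernel (product_group I G) (product_driver I r G Q) t x y =
      (\<Sum>\<alpha>\<in>PiE I J. \<Prod>i\<in>I. exp (- (r i * t * (1 - \<beta> i (\<alpha> i)))) * \<phi> i (\<alpha> i) (x i) * \<phi> i (\<alpha> i) (y i))"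
    using x y by (simp add: prod.heat_eq prod.kernel_def decay_product \<Phi>_def prod.distrib)
  also have "\<dots> = (\<Prod>i\<in>I. \<Sum>j\<in>J i. exp (- (r i * t * (1 - \<beta> i j))) * \<phi> i j (x i) * \<phi> i j (y i))"
    using finite_I spectral_walk.finite_J[OF factor] by (subst prod_sum_PiE) auto
  also have "\<dots> = (\<Prod>i\<in>I. heat_kernel (G i) (Q i) (r i * t) (x i) (y i))"
  proof (intro prod.cong refl)
    fix i assume i: "i \<in> I"
    then interpret F: spectral_walk "G i" "Q i" "J i" "j0 i" "\<phi> i" "\<beta> i" by (intro factor)
    show "(\<Sum>j\<in>J i. exp (- (r i * t * (1 - \<beta> i j))) * \<phi> i j (x i) * \<phi> i j (y i)) =
        heat_kernel (G i) (Q i) (r i * t) (x i) (y i)"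
      using x y i by (subst F.heat_eq) (auto simp: F.kernel_def F.decay_def)
  qed
  finally show ?thesis .
qed

text \<open>The squared \<open>L\<^sup>2\<close> distance of the \<open>i\<close>th factor from uniformity; \<open>t\<close> is the time of the product, of which
  the factor experiences \<open>r i * t\<close>.\<close>

definition chi2 :: "'i \<Rightarrow> real \<Rightarrow> real" where
  "chi2 i t = (\<Sum>j\<in>J i - {j0 i}. exp (- (2 * (r i * t) * (1 - \<beta> i j))))"

lemma chi2_nonneg: "0 \<le> chi2 i t" by (simp add: chi2_def sum_nonneg)

lemma product_l2:
  "(\<Sum>\<alpha>\<in>PiE I J - {restrict j0 I}. prod.decay (2 * t) \<alpha>) = (\<Prod>i\<in>I. 1 + chi2 i t) - 1"
proof -
  have "(\<Sum>\<alpha>\<in>PiE I J. prod.decay (2 * t) \<alpha>) =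
      (\<Prod>i\<in>I. \<Sum>j\<in>J i. exp (- (r i * (2 * t) * (1 - \<beta> i j))))"
    unfolding decay_product using finite_I spectral_walk.finite_J[OF factor] by (subst prod_sum_PiE) auto
  also have "\<dots> = (\<Prod>i\<in>I. 1 + chi2 i t)"
  proof (intro prod.cong refl)
    fix i assume i: "i \<in> I"
    then interpret F: spectral_walk "G i" "Q i" "J i" "j0 i" "\<phi> i" "\<beta> i" by (intro factor)
    show "(\<Sum>j\<in>J i. exp (- (r i * (2 * t) * (1 - \<beta> i j)))) = 1 + chi2 i t"
      unfolding chi2_def using F.finite_J F.j0 by (subst sum.remove[of _ "j0 i"]) (auto simp: mult_ac)
  qed
  finally show ?thesis using prod.finite_J prod.j0(1) by (simp add: sum_diff1)
qed

lemma product_l2_le: "(\<Prod>i\<in>I. 1 + chi2 i t) - 1 \<le> exp (\<Sum>i\<in>I. chi2 i t) - 1"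
proof -
  have "(\<Prod>i\<in>I. 1 + chi2 i t) \<le> (\<Prod>i\<in>I. exp (chi2 i t))"
    using chi2_nonneg by (intro prod_mono conjI exp_ge_add_one_self) (auto intro: add_nonneg_nonneg)
  then show ?thesis using finite_I by (simp add: exp_sum)
qed

lemma tv_c_product_upper:
  "tv_c (product_group I G) (product_driver I r G Q) t \<le> sqrt (exp (\<Sum>i\<in>I. chi2 i t) - 1) / 2"
  using prod.tv_c_upper[of t] product_l2_le[of t] unfolding product_l2
  by (meson divide_right_mono order.trans real_sqrt_le_mono zero_le_numeral)

text \<open>The affinity of the product measure is the product of the affinities of its factors.\<close>

lemma tv_c_product_lower:
  assumes t: "t \<ge> 0"
    and M: "\<And>i. i \<in> I \<Longrightarrow> (\<Sum>j\<in>J i. exp (- (r i * t * (1 - \<beta> i j)))) \<le> M"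
  shows "1 - tv_c (product_group I G) (product_driver I r G Q) t \<le>
    exp (- ((\<Sum>i\<in>I. chi2 i t) / (2 * (sqrt M + 1)\<^sup>2)))"
proof -
  let ?C = "PiE I (\<lambda>i. carrier (G i))"
  let ?a = "\<lambda>i w. sqrt (heat_kernel (G i) (Q i) (r i * t) \<one>\<^bsub>G i\<^esub> w * (1 / card (carrier (G i))))"
  have one: "\<one>\<^bsub>product_group I G\<^esub> \<in> ?C"
    using prod.one_closed by simp
  have "1 - tv_c (product_group I G) (product_driver I r G Q) t \<le>
      (\<Sum>y\<in>?C. sqrt (heat_kernel (product_group I G) (product_driver I r G Q) t \<one>\<^bsub>product_group I G\<^esub> y *
        (1 / card ?C)))"
    using prod.one_minus_tv_c_le_affinity[OF t] by simp
  also have "\<dots> = (\<Sum>y\<in>?C. \<Prod>i\<in>I. ?a i (y i))"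
    using finite_I one by (intro sum.cong refl)
      (auto simp: heat_product card_PiE prod_dividef prod.distrib sqrt_prod[symmetric])
  also have "\<dots> = (\<Prod>i\<in>I. \<Sum>w\<in>carrier (G i). ?a i w)"
    using finite_I factor_finite by (subst prod_sum_PiE) auto
  also have "\<dots> \<le> (\<Prod>i\<in>I. exp (- (chi2 i t / (2 * (sqrt M + 1)\<^sup>2))))"
  proof (intro prod_mono conjI)
    fix i assume i: "i \<in> I"
    then interpret F: spectral_walk "G i" "Q i" "J i" "j0 i" "\<phi> i" "\<beta> i" by (intro factor)
    have rt: "r i * t \<ge> 0" using r_nonneg[OF i] t by simp
    show "0 \<le> (\<Sum>w\<in>carrier (G i). ?a i w)"
      using F.heat_nonneg[OF rt F.one_closed] by (intro sum_nonneg) (auto simp: F.heat_eq)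
    have "(\<Sum>w\<in>carrier (G i). ?a i w) \<le> 1 - chi2 i t / (2 * (sqrt M + 1)\<^sup>2)"
      using F.affinity_le[OF rt, of M] M[OF i] by (simp add: F.decay_def chi2_def)
    also have "\<dots> \<le> exp (- (chi2 i t / (2 * (sqrt M + 1)\<^sup>2)))"
      using exp_ge_add_one_self[of "- (chi2 i t / (2 * (sqrt M + 1)\<^sup>2))"] by simp
    finally show "(\<Sum>w\<in>carrier (G i). ?a i w) \<le> exp (- (chi2 i t / (2 * (sqrt M + 1)\<^sup>2)))" .
  qed
  also have "\<dots> = exp (- ((\<Sum>i\<in>I. chi2 i t) / (2 * (sqrt M + 1)\<^sup>2)))"
    using finite_I by (simp add: exp_sum[symmetric] sum_negf sum_divide_distrib)
  finally show ?thesis .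
qed

text \<open>An eigenfunction of one factor is an eigenfunction of the product, with \<open>1 - \<beta>\<close> slowed down by
  the factor \<open>r i\<close>.\<close>

lemma single_coordinate:
  assumes i: "i \<in> I" and j: "j \<in> J i - {j0 i}"
  shows "(restrict j0 I)(i := j) \<in> PiE I J - {restrict j0 I}"
    and "B ((restrict j0 I)(i := j)) = 1 - r i * (1 - \<beta> i j)"
proof -
  have j0: "j0 k \<in> J k" "\<beta> k (j0 k) = 1" if "k \<in> I" for k using spectral_walk.j0[OF factor[OF that]] by auto
  have "(restrict j0 I)(i := j) \<in> PiE I J" using i j j0 by (auto simp: PiE_iff extensional_def)
  moreover have "(restrict j0 I)(i := j) \<noteq> restrict j0 I"
    using i j by (metis DiffE fun_upd_same restrict_apply' singletonI)
  ultimately show "(restrict j0 I)(i := j) \<in> PiE I J - {restrict j0 I}" by blast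
  have "B ((restrict j0 I)(i := j)) = r i * \<beta> i j + (\<Sum>k\<in>I-{i}. r k)"
    unfolding B_def using finite_I i j0 by (subst sum.remove[of I i]) auto
  also have "(\<Sum>k\<in>I-{i}. r k) = 1 - r i" using r_sum finite_I i by (simp add: sum_diff1)
  finally show "B ((restrict j0 I)(i := j)) = 1 - r i * (1 - \<beta> i j)"
    unfolding right_diff_distrib by linarith
qed

lemma tv_c_coordinate_lower:
  assumes "i \<in> I" "j \<in> J i - {j0 i}"
  shows "exp (- (r i * t * (1 - \<beta> i j))) / 2 \<le> tv_c (product_group I G) (product_driver I r G Q) t"
  using prod.tv_c_lower[OF single_coordinate(1)[OF assms], of t] single_coordinate(2)[OF assms]
  by (simp add: prod.decay_def mult_ac)

lemma tv_coordinate_lower: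
  assumes "i \<in> I" "j \<in> J i - {j0 i}"
  shows "\<bar>1 - r i * (1 - \<beta> i j)\<bar> ^ m / 2 \<le> tv (product_group I G) (product_driver I r G Q) m"
  using prod.tv_lower[OF single_coordinate(1)[OF assms], of m] single_coordinate(2)[OF assms] by simp

text \<open>A nonnegative eigenvalue satisfies \<open>B \<alpha> \<le> exp (- (1 - B \<alpha>))\<close>, hence contributes no more than in
  continuous time.  A negative one is at most \<open>1 - 2 \<eta>\<close> in absolute value, and there are no more of them
  than elements of the product group.\<close>

lemma tv_product_upper:
  assumes low: "\<And>i j. i \<in> I \<Longrightarrow> j \<in> J i \<Longrightarrow> 2 * \<eta> - 1 \<le> \<beta> i j"
  shows "tv (product_group I G) (product_driver I r G Q) m \<le>
    sqrt (exp (\<Sum>i\<in>I. chi2 i m) - 1 + (\<Prod>i\<in>I. real (card (carrier (G i)))) * (1 - 2 * \<eta>) ^ (2 * m)) / 2"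
proof -
  have power_le: "B \<alpha> ^ (2 * m) \<le> prod.decay (2 * real m) \<alpha> + (1 - 2 * \<eta>) ^ (2 * m)" if \<alpha>: "\<alpha> \<in> PiE I J" for \<alpha>
  proof (cases "B \<alpha> \<ge> 0")
    case True
    have "B \<alpha> \<le> exp (- (1 - B \<alpha>))" using exp_ge_add_one_self[of "- (1 - B \<alpha>)"] by simp
    then have "B \<alpha> ^ (2 * m) \<le> exp (- (1 - B \<alpha>)) ^ (2 * m)" using True by (rule power_mono)
    also have "\<dots> = prod.decay (2 * real m) \<alpha>"
      by (simp add: prod.decay_def exp_of_nat_mult[symmetric] algebra_simps)
    also have "\<dots> \<le> prod.decay (2 * real m) \<alpha> + (1 - 2 * \<eta>) ^ (2 * m)" by simp
    finally show ?thesis .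
  next
    case False
    have "2 * \<eta> - 1 = (\<Sum>i\<in>I. r i * (2 * \<eta> - 1))" using r_sum by (simp add: sum_distrib_right[symmetric])
    also have "\<dots> \<le> B \<alpha>"
      unfolding B_def using \<alpha> by (intro sum_mono mult_left_mono low r_nonneg) auto
    finally have "- B \<alpha> \<le> 1 - 2 * \<eta>" by simp
    then have "(- B \<alpha>) ^ (2 * m) \<le> (1 - 2 * \<eta>) ^ (2 * m)" using False by (intro power_mono) auto
    then show ?thesis by (simp add: add_increasing)
  qed
  have "(\<Sum>\<alpha>\<in>PiE I J - {restrict j0 I}. B \<alpha> ^ (2 * m)) \<le>
      (\<Sum>\<alpha>\<in>PiE I J - {restrict j0 I}. prod.decay (2 * real m) \<alpha> + (1 - 2 * \<eta>) ^ (2 * m))"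
    by (intro sum_mono power_le) auto
  also have "\<dots> = (\<Prod>i\<in>I. 1 + chi2 i m) - 1 + card (PiE I J - {restrict j0 I}) * (1 - 2 * \<eta>) ^ (2 * m)"
    using product_l2[of "real m"] by (simp add: sum.distrib)
  also have "\<dots> \<le> exp (\<Sum>i\<in>I. chi2 i m) - 1 + (\<Prod>i\<in>I. real (card (carrier (G i)))) * (1 - 2 * \<eta>) ^ (2 * m)"
  proof (intro add_mono product_l2_le mult_right_mono)
    have "card (PiE I J - {restrict j0 I}) \<le> card (PiE I J)"
      using prod.finite_J by (intro card_mono) auto
    also have "\<dots> = card (PiE I (\<lambda>i. carrier (G i)))" using prod.card_J by simp
    also have "\<dots> = (\<Prod>i\<in>I. card (carrier (G i)))" using finite_I by (rule card_PiE)
    finally show "real (card (PiE I J - {restrict j0 I})) \<le> (\<Prod>i\<in>I. real (card (carrier (G i))))"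
      by (metis of_nat_le_iff of_nat_prod)
  qed simp
  finally show ?thesis
    using prod.tv_upper[of m] by (meson divide_right_mono order.trans real_sqrt_le_mono zero_le_numeral)
qed

end

section \<open>Mixing times, cutoff and pre-cutoff\<close>

lemma mixing_time_c_props:
  assumes anti: "\<And>s t. s \<le> t \<Longrightarrow> d t \<le> d s" and ex: "\<exists>t\<ge>0. d t \<le> \<epsilon>"
  shows "0 \<le> mixing_time_c d \<epsilon>"
    and "0 \<le> t \<Longrightarrow> d t \<le> \<epsilon> \<Longrightarrow> mixing_time_c d \<epsilon> \<le> t"
    and "mixing_time_c d \<epsilon> < t \<Longrightarrow> d t \<le> \<epsilon>"
proof -
  let ?A = "{t. 0 \<le> t \<and> d t \<le> \<epsilon>}"
  have ne: "?A \<noteq> {}" using ex by auto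
  have bdd: "bdd_below ?A" by (rule bdd_belowI[of _ 0]) auto
  show "0 \<le> mixing_time_c d \<epsilon>" unfolding mixing_time_c_def using ne by (intro cInf_greatest) auto
  show "0 \<le> t \<Longrightarrow> d t \<le> \<epsilon> \<Longrightarrow> mixing_time_c d \<epsilon> \<le> t"
    unfolding mixing_time_c_def using bdd by (intro cInf_lower) auto
  show "mixing_time_c d \<epsilon> < t \<Longrightarrow> d t \<le> \<epsilon>"
  proof -
    assume "mixing_time_c d \<epsilon> < t"
    then obtain s where "s \<in> ?A" "s < t"
      unfolding mixing_time_c_def using cInf_lessD[OF ne] by blast
    then show "d t \<le> \<epsilon>" using anti[of s t] by auto
  qed
qed

lemma mixing_time_props:
  assumes anti: "\<And>m m'. m \<le> m' \<Longrightarrow> d m' \<le> d m" and ex: "\<exists>m. d m \<le> \<epsilon>"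
  shows "d m \<le> \<epsilon> \<Longrightarrow> mixing_time d \<epsilon> \<le> m"
    and "mixing_time d \<epsilon> \<le> m \<Longrightarrow> d m \<le> \<epsilon>"
proof -
  show "d m \<le> \<epsilon> \<Longrightarrow> mixing_time d \<epsilon> \<le> m" unfolding mixing_time_def by (rule Least_le)
  have "d (mixing_time d \<epsilon>) \<le> \<epsilon>" unfolding mixing_time_def using ex by (rule LeastI_ex)
  then show "mixing_time d \<epsilon> \<le> m \<Longrightarrow> d m \<le> \<epsilon>" using anti by (meson order.trans)
qed

lemma liminf_pos_iff:
  fixes x :: "nat \<Rightarrow> real"
  shows "liminf (\<lambda>n. ereal (x n)) > 0 \<longleftrightarrow> (\<exists>e>0. eventually (\<lambda>n. x n > e) sequentially)"
proof
  assume "liminf (\<lambda>n. ereal (x n)) > 0"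
  then obtain e where e: "0 < ereal e" "ereal e < liminf (\<lambda>n. ereal (x n))"
    using ereal_dense2 by blast
  have "eventually (\<lambda>n. ereal e < ereal (x n)) sequentially" by (rule less_LiminfD[OF e(2)])
  then show "\<exists>e>0. eventually (\<lambda>n. x n > e) sequentially" using e(1) by auto
next
  assume "\<exists>e>0. eventually (\<lambda>n. x n > e) sequentially"
  then obtain e where e: "e > 0" "eventually (\<lambda>n. x n > e) sequentially" by blast
  have "ereal e \<le> liminf (\<lambda>n. ereal (x n))"
    by (rule Liminf_bounded) (use e(2) in eventually_elim, simp)
  then show "liminf (\<lambda>n. ereal (x n)) > 0" using e(1) by (metis ereal_less(2) less_le_trans)
qed

lemma ratio_tendsto_1_nonzero:
  fixes f g :: "nat \<Rightarrow> real"
  assumes "(\<lambda>n. f n / g n) \<longlonglongrightarrow> 1"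
  shows "eventually (\<lambda>n. f n \<noteq> 0 \<and> g n \<noteq> 0 \<and> 1 / 2 < f n / g n \<and> f n / g n < 2) sequentially"
proof -
  have "eventually (\<lambda>n. 1 / 2 < f n / g n) sequentially" "eventually (\<lambda>n. f n / g n < 2) sequentially"
    using order_tendstoD(1)[OF assms, of "1/2"] order_tendstoD(2)[OF assms, of 2] by auto
  then show ?thesis by eventually_elim auto
qed

lemma cutoff_imp_precutoff_c:
  assumes anti: "\<And>n s t. n \<ge> 1 \<Longrightarrow> s \<le> t \<Longrightarrow> d n t \<le> d n s"
    and nonneg: "\<And>n t. n \<ge> 1 \<Longrightarrow> 0 \<le> t \<Longrightarrow> 0 \<le> d n t"
    and ex: "\<And>n \<epsilon>. n \<ge> 1 \<Longrightarrow> \<epsilon> > 0 \<Longrightarrow> \<exists>t\<ge>0. d n t \<le> \<epsilon>"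
    and cut: "tv_cutoff_c d"
  shows "tv_precutoff_c d"
proof -
  let ?T = "\<lambda>n \<epsilon>. mixing_time_c (d n) \<epsilon>"
  have half: "0 < (1/2::real)" "(1/2::real) < 1" by auto
  define s where "s n = (if ?T n (1/2) > 0 then ?T n (1/2) else 1)" for n
  have ratio: "(\<lambda>n. ?T n \<epsilon> / ?T n (1/2)) \<longlonglongrightarrow> 1" if "0 < \<epsilon>" "\<epsilon> < 1" for \<epsilon>
    using cut that unfolding tv_cutoff_c_def by simp
  have props: "0 \<le> ?T n \<epsilon>" "0 \<le> t \<Longrightarrow> d n t \<le> \<epsilon> \<Longrightarrow> ?T n \<epsilon> \<le> t" "?T n \<epsilon> < t \<Longrightarrow> d n t \<le> \<epsilon>"
    if "n \<ge> 1" "\<epsilon> > 0" for n \<epsilon> t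
    using mixing_time_c_props[OF anti[OF that(1)] ex[OF that]] by blast+
  have good: "eventually (\<lambda>n. n \<ge> 1 \<and> ?T n (1/2) > 0 \<and> ?T n \<epsilon> < 2 * ?T n (1/2)) sequentially"
    if e: "0 < \<epsilon>" "\<epsilon> < 1" for \<epsilon>
    using ratio_tendsto_1_nonzero[OF ratio[OF e]] eventually_ge_at_top[of 1]
  proof eventually_elim
    case (elim n)
    then have "?T n (1/2) > 0" using props(1)[of n "1/2"] by auto
    then show ?case using elim by (auto simp: divide_simps)
  qed
  have "(\<lambda>n. d n (2 * s n)) \<longlonglongrightarrow> 0"
  proof (rule LIMSEQ_I)
    fix e :: real assume e: "e > 0"
    define \<epsilon> where "\<epsilon> = min (e / 2) (1 / 2)"
    have \<epsilon>: "0 < \<epsilon>" "\<epsilon> < 1" "\<epsilon> < e" using e by (auto simp: \<epsilon>_def)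
    from good[OF \<epsilon>(1,2)] have "eventually (\<lambda>n. norm (d n (2 * s n) - 0) < e) sequentially"
    proof eventually_elim
      case (elim n)
      then have "d n (2 * s n) \<le> \<epsilon>" using props(3)[of n \<epsilon>] \<epsilon>(1) by (auto simp: s_def)
      moreover have "0 \<le> d n (2 * s n)" using elim by (intro nonneg) (auto simp: s_def)
      ultimately show ?case using \<epsilon>(3) by simp
    qed
    then show "\<exists>no. \<forall>n\<ge>no. norm (d n (2 * s n) - 0) < e" by (simp add: eventually_sequentially)
  qed
  moreover have "liminf (\<lambda>n. ereal (d n (1/2 * s n))) > 0"
    unfolding liminf_pos_iff
  proof (intro exI[of _ "1/2"] conjI)
    show "eventually (\<lambda>n. d n (1/2 * s n) > 1/2) sequentially"
      using good[OF half]
    proof eventually_elim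
      case (elim n)
      show ?case
      proof (rule ccontr)
        assume "\<not> ?thesis"
        then have "?T n (1/2) \<le> 1/2 * s n" using elim props(2)[of n "1/2" "1/2 * s n"] by (auto simp: s_def)
        then show False using elim by (auto simp: s_def)
      qed
    qed
  qed simp
  moreover have "\<forall>n. 0 < s n" by (simp add: s_def)
  ultimately show ?thesis
    unfolding tv_precutoff_c_def by (intro exI[of _ 2] exI[of _ "1/2"] exI[of _ s]) auto
qed

lemma cutoff_imp_precutoff:
  assumes anti: "\<And>n m m'. n \<ge> 1 \<Longrightarrow> m \<le> m' \<Longrightarrow> d n m' \<le> d n m"
    and nonneg: "\<And>n m. n \<ge> 1 \<Longrightarrow> 0 \<le> d n m"
    and ex: "\<And>n \<epsilon>. n \<ge> 1 \<Longrightarrow> \<epsilon> > 0 \<Longrightarrow> \<exists>m. d n m \<le> \<epsilon>"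
    and cut: "tv_cutoff d"
  shows "tv_precutoff d"
proof -
  let ?T = "\<lambda>n \<epsilon>. real (mixing_time (d n) \<epsilon>)"
  have half: "0 < (1/2::real)" "(1/2::real) < 1" by auto
  define s where "s n = (if ?T n (1/2) > 0 then ?T n (1/2) else 1)" for n
  have ratio: "(\<lambda>n. ?T n \<epsilon> / ?T n (1/2)) \<longlonglongrightarrow> 1" if "0 < \<epsilon>" "\<epsilon> < 1" for \<epsilon>
    using cut that unfolding tv_cutoff_def by simp
  have props: "d n m \<le> \<epsilon> \<Longrightarrow> mixing_time (d n) \<epsilon> \<le> m" "mixing_time (d n) \<epsilon> \<le> m \<Longrightarrow> d n m \<le> \<epsilon>"
    if "n \<ge> 1" "\<epsilon> > 0" for n \<epsilon> m
    using mixing_time_props[OF anti[OF that(1)] ex[OF that]] by blast+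
  have good: "eventually (\<lambda>n. n \<ge> 1 \<and> ?T n (1/2) > 0 \<and> ?T n \<epsilon> < 2 * ?T n (1/2)) sequentially"
    if e: "0 < \<epsilon>" "\<epsilon> < 1" for \<epsilon>
    using ratio_tendsto_1_nonzero[OF ratio[OF e]] eventually_ge_at_top[of 1]
    by eventually_elim (auto simp: divide_simps)
  have "(\<lambda>n. d n (nat \<lceil>2 * s n\<rceil>)) \<longlonglongrightarrow> 0"
  proof (rule LIMSEQ_I)
    fix e :: real assume e: "e > 0"
    define \<epsilon> where "\<epsilon> = min (e / 2) (1 / 2)"
    have \<epsilon>: "0 < \<epsilon>" "\<epsilon> < 1" "\<epsilon> < e" using e by (auto simp: \<epsilon>_def)
    from good[OF \<epsilon>(1,2)] have "eventually (\<lambda>n. norm (d n (nat \<lceil>2 * s n\<rceil>) - 0) < e) sequentially"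
    proof eventually_elim
      case (elim n)
      then have "mixing_time (d n) \<epsilon> \<le> nat \<lceil>2 * s n\<rceil>" by (simp add: s_def) linarith
      then have "d n (nat \<lceil>2 * s n\<rceil>) \<le> \<epsilon>" using props(2)[of n \<epsilon>] \<epsilon>(1) elim by auto
      moreover have "0 \<le> d n (nat \<lceil>2 * s n\<rceil>)" using elim by (intro nonneg) auto
      ultimately show ?case using \<epsilon>(3) by simp
    qed
    then show "\<exists>no. \<forall>n\<ge>no. norm (d n (nat \<lceil>2 * s n\<rceil>) - 0) < e" by (simp add: eventually_sequentially)
  qed
  moreover have "liminf (\<lambda>n. ereal (d n (nat \<lfloor>1/2 * s n\<rfloor>))) > 0"
    unfolding liminf_pos_iff
  proof (intro exI[of _ "1/2"] conjI)
    show "eventually (\<lambda>n. d n (nat \<lfloor>1/2 * s n\<rfloor>) > 1/2) sequentially"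
      using good[OF half]
    proof eventually_elim
      case (elim n)
      show ?case
      proof (rule ccontr)
        assume "\<not> ?thesis"
        then have "mixing_time (d n) (1/2) \<le> nat \<lfloor>1/2 * s n\<rfloor>"
          using elim props(1)[of n "1/2" "nat \<lfloor>1/2 * s n\<rfloor>"] by auto
        then have "?T n (1/2) \<le> 1/2 * s n" using elim by (simp add: s_def) linarith
        then show False using elim by (auto simp: s_def)
      qed
    qed
  qed simp
  moreover have "\<forall>n. 0 < s n" by (simp add: s_def)
  ultimately show ?thesis
    unfolding tv_precutoff_def by (intro exI[of _ 2] exI[of _ "1/2"] exI[of _ s]) auto
qed

text \<open>The conclusions about cutoff that are common to continuous and discrete time; \<open>T\<close> stands for the
  mixing times, \<open>tm\<close> for the time scale \<open>t\<^sub>n\<close> and \<open>l1\<close> for \<open>\<ell>\<^sub>n\<^sub>,\<^sub>1\<close>.\<close>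

definition cutoff_criteria ::
    "bool \<Rightarrow> bool \<Rightarrow> (nat \<Rightarrow> real \<Rightarrow> real) \<Rightarrow> (nat \<Rightarrow> real) \<Rightarrow> (nat \<Rightarrow> real) \<Rightarrow> bool" where
  "cutoff_criteria cutoff precutoff T tm l1 \<longleftrightarrow>
    (cutoff \<longleftrightarrow> precutoff) \<and> (cutoff \<longleftrightarrow> filterlim (\<lambda>n. tm n * l1 n) at_top sequentially) \<and>
    (cutoff \<longleftrightarrow> (\<forall>\<epsilon>. 0 < \<epsilon> \<and> \<epsilon> < 1 \<longrightarrow> filterlim (\<lambda>n. T n \<epsilon> * l1 n) at_top sequentially)) \<and>
    (cutoff \<longleftrightarrow> (\<exists>\<epsilon>. 0 < \<epsilon> \<and> \<epsilon> < 1 \<and> filterlim (\<lambda>n. T n \<epsilon> * l1 n) at_top sequentially)) \<and>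
    (cutoff \<longrightarrow> (\<forall>\<epsilon> \<delta>. 0 < \<epsilon> \<and> \<epsilon> < \<delta> \<and> \<delta> < 1 \<longrightarrow>
       (\<lambda>n. T n \<epsilon>) \<in> \<Theta>(tm) \<and> (\<lambda>n. T n \<epsilon> - T n \<delta>) \<in> O(\<lambda>n. 1 / l1 n)))"

text \<open>Once mixing times have order \<open>tm\<close> and a window of order \<open>1 / l1\<close>, their ratios tend to one
  precisely because \<open>tm * l1\<close> tends to infinity.  The proposition \<open>extra\<close> accommodates the divergence
  of mixing times in the definition of discrete time cutoff.\<close>

lemma cutoff_equivalences:
  fixes T :: "nat \<Rightarrow> real \<Rightarrow> real" and tm l1 :: "nat \<Rightarrow> real" and cut pre extra :: bool
  defines "sep \<equiv> filterlim (\<lambda>n. tm n * l1 n) at_top sequentially"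
  assumes pos: "\<And>n. n \<ge> 1 \<Longrightarrow> 0 < tm n \<and> 0 < l1 n"
    and upper: "\<And>\<epsilon>. 0 < \<epsilon> \<Longrightarrow> \<epsilon> < 1 \<Longrightarrow> \<exists>K>0. \<forall>n\<ge>1. T n \<epsilon> \<le> K * tm n"
    and lower: "\<And>\<epsilon>. sep \<Longrightarrow> 0 < \<epsilon> \<Longrightarrow> \<epsilon> < 1 \<Longrightarrow> \<exists>b>0. \<forall>\<^sub>F n in sequentially. b * tm n \<le> T n \<epsilon>"
    and window: "\<And>\<epsilon> \<delta>. sep \<Longrightarrow> 0 < \<epsilon> \<Longrightarrow> \<epsilon> < \<delta> \<Longrightarrow> \<delta> < 1 \<Longrightarrow>
      \<exists>w>0. \<forall>\<^sub>F n in sequentially. T n \<delta> \<le> T n \<epsilon> \<and> T n \<epsilon> \<le> T n \<delta> + w / l1 n"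
    and cut: "cut \<longleftrightarrow> extra \<and> (\<forall>\<epsilon> \<delta>. 0 < \<epsilon> \<and> \<epsilon> < 1 \<and> 0 < \<delta> \<and> \<delta> < 1 \<longrightarrow> (\<lambda>n. T n \<epsilon> / T n \<delta>) \<longlonglongrightarrow> 1)"
    and extra: "sep \<Longrightarrow> extra"
    and cut_pre: "cut \<Longrightarrow> pre" and pre_sep: "pre \<Longrightarrow> sep"
  shows "cutoff_criteria cut pre T tm l1"
proof -
  have ev1: "\<forall>\<^sub>F n in sequentially. 0 < tm n \<and> 0 < l1 n"
    using eventually_ge_at_top[of 1] by eventually_elim (rule pos)
  have sep_mixing: "filterlim (\<lambda>n. T n \<epsilon> * l1 n) at_top sequentially" if sep: sep and e: "0 < \<epsilon>" "\<epsilon> < 1" for \<epsilon>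
  proof -
    obtain b where b: "b > 0" "\<forall>\<^sub>F n in sequentially. b * tm n \<le> T n \<epsilon>" using lower[OF sep e] by blast
    have "filterlim (\<lambda>n. b * (tm n * l1 n)) at_top sequentially"
      using b(1) sep unfolding sep_def by (intro filterlim_tendsto_pos_mult_at_top[OF tendsto_const]) auto
    then show ?thesis
    proof (rule filterlim_at_top_mono)
      show "\<forall>\<^sub>F n in sequentially. b * (tm n * l1 n) \<le> T n \<epsilon> * l1 n"
        using b(2) ev1 by eventually_elim (simp add: mult.assoc[symmetric] mult_right_mono)
    qed
  qed
  have mixing_sep: sep if e: "0 < \<epsilon>" "\<epsilon> < 1" and lim: "filterlim (\<lambda>n. T n \<epsilon> * l1 n) at_top sequentially" for \<epsilon>
  proof -
    obtain K where K: "K > 0" "\<forall>n\<ge>1. T n \<epsilon> \<le> K * tm n" using upper[OF e] by blast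
    have "filterlim (\<lambda>n. (1 / K) * (T n \<epsilon> * l1 n)) at_top sequentially"
      using K(1) lim by (intro filterlim_tendsto_pos_mult_at_top[OF tendsto_const]) auto
    then show sep
      unfolding sep_def
    proof (rule filterlim_at_top_mono)
      show "\<forall>\<^sub>F n in sequentially. (1 / K) * (T n \<epsilon> * l1 n) \<le> tm n * l1 n"
        using eventually_ge_at_top[of 1] ev1
      proof eventually_elim
        case (elim n)
        then have "T n \<epsilon> * l1 n \<le> K * tm n * l1 n" using K(2) by (intro mult_right_mono) auto
        then show ?case using K(1) by (simp add: field_simps)
      qed
    qed
  qed
  have window': "\<exists>w>0. \<forall>\<^sub>F n in sequentially. \<bar>T n \<epsilon> - T n \<delta>\<bar> \<le> w / l1 n"
    if sep: sep and e: "0 < \<epsilon>" "\<epsilon> < 1" "0 < \<delta>" "\<delta> < 1" for \<epsilon> \<delta>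
  proof -
    consider "\<epsilon> < \<delta>" | "\<epsilon> = \<delta>" | "\<delta> < \<epsilon>" by linarith
    then show ?thesis
    proof cases
      case 1
      from window[OF sep e(1) 1 e(4)] obtain w where w: "w > 0"
        "\<forall>\<^sub>F n in sequentially. T n \<delta> \<le> T n \<epsilon> \<and> T n \<epsilon> \<le> T n \<delta> + w / l1 n" by blast
      from w(2) have "\<forall>\<^sub>F n in sequentially. \<bar>T n \<epsilon> - T n \<delta>\<bar> \<le> w / l1 n" by eventually_elim auto
      then show ?thesis using w(1) by blast
    next
      case 2
      from ev1 have "\<forall>\<^sub>F n in sequentially. \<bar>T n \<epsilon> - T n \<delta>\<bar> \<le> 1 / l1 n"
        by eventually_elim (simp add: 2)
      then show ?thesis by (intro exI[of _ 1]) auto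
    next
      case 3
      from window[OF sep e(3) 3 e(2)] obtain w where w: "w > 0"
        "\<forall>\<^sub>F n in sequentially. T n \<epsilon> \<le> T n \<delta> \<and> T n \<delta> \<le> T n \<epsilon> + w / l1 n" by blast
      from w(2) have "\<forall>\<^sub>F n in sequentially. \<bar>T n \<epsilon> - T n \<delta>\<bar> \<le> w / l1 n" by eventually_elim auto
      then show ?thesis using w(1) by blast
    qed
  qed
  have sep_cut: cut if sep: sep
    unfolding cut
  proof (intro conjI allI impI extra[OF sep])
    fix \<epsilon> \<delta> :: real assume ed: "0 < \<epsilon> \<and> \<epsilon> < 1 \<and> 0 < \<delta> \<and> \<delta> < 1"
    obtain w where w: "w > 0" "\<forall>\<^sub>F n in sequentially. \<bar>T n \<epsilon> - T n \<delta>\<bar> \<le> w / l1 n"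
      using window'[OF sep] ed by blast
    have lim: "filterlim (\<lambda>n. T n \<delta> * l1 n) at_top sequentially" using sep_mixing[OF sep] ed by blast
    have lim0: "(\<lambda>n. w / (T n \<delta> * l1 n)) \<longlonglongrightarrow> 0"
      by (intro tendsto_divide_0[OF tendsto_const] filterlim_at_top_imp_at_infinity lim)
    have "(\<lambda>n. T n \<epsilon> / T n \<delta> - 1) \<longlonglongrightarrow> 0"
    proof (rule Lim_null_comparison[OF _ lim0])
      have "\<forall>\<^sub>F n in sequentially. T n \<delta> * l1 n \<ge> 1" using lim by (simp add: filterlim_at_top)
      then show "\<forall>\<^sub>F n in sequentially. norm (T n \<epsilon> / T n \<delta> - 1) \<le> w / (T n \<delta> * l1 n)"
        using w(2) ev1
      proof eventually_elim
        case (elim n)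
        then have T: "T n \<delta> > 0" by (metis less_le_trans mult_pos_pos zero_less_mult_pos2 zero_less_one)
        have "T n \<epsilon> / T n \<delta> - 1 = (T n \<epsilon> - T n \<delta>) / T n \<delta>" using T by (simp add: field_simps)
        then have "norm (T n \<epsilon> / T n \<delta> - 1) = \<bar>T n \<epsilon> - T n \<delta>\<bar> / T n \<delta>" using T by simp
        also have "\<dots> \<le> (w / l1 n) / T n \<delta>" using elim T by (intro divide_right_mono) auto
        finally show ?case by (simp add: mult.commute)
      qed
    qed
    then show "(\<lambda>n. T n \<epsilon> / T n \<delta>) \<longlonglongrightarrow> 1" by (simp add: LIM_zero_iff)
  qed
  have half: "0 < (1/2::real)" "(1/2::real) < 1" by auto
  have cut_sep: "cut \<longleftrightarrow> sep" using sep_cut cut_pre pre_sep by blast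
  have final: "(\<lambda>n. T n \<epsilon>) \<in> \<Theta>(tm) \<and> (\<lambda>n. T n \<epsilon> - T n \<delta>) \<in> O(\<lambda>n. 1 / l1 n)"
    if sep: sep and ed: "0 < \<epsilon>" "\<epsilon> < \<delta>" "\<delta> < 1" for \<epsilon> \<delta>
  proof
    have e1: "\<epsilon> < 1" using ed by simp
    obtain K where K: "K > 0" "\<forall>n\<ge>1. T n \<epsilon> \<le> K * tm n" using upper[OF ed(1) e1] by blast
    obtain b where b: "b > 0" "\<forall>\<^sub>F n in sequentially. b * tm n \<le> T n \<epsilon>" using lower[OF sep ed(1) e1] by blast
    have abs: "\<forall>\<^sub>F n in sequentially. b * tm n \<le> T n \<epsilon> \<and> 0 < T n \<epsilon> \<and> 0 < tm n \<and> T n \<epsilon> \<le> K * tm n"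
      using b(2) ev1 eventually_ge_at_top[of 1]
      by eventually_elim (use b(1) K(2) in \<open>auto intro: less_le_trans[OF mult_pos_pos]\<close>)
    show "(\<lambda>n. T n \<epsilon>) \<in> \<Theta>(tm)"
    proof (rule bigthetaI)
      show "(\<lambda>n. T n \<epsilon>) \<in> O(tm)"
        by (rule bigoI[of _ K]) (use abs in eventually_elim, auto)
      show "(\<lambda>n. T n \<epsilon>) \<in> \<Omega>(tm)"
        unfolding bigomega_iff_bigo
        by (rule bigoI[of _ "1 / b"]) (use abs in eventually_elim, use b(1) in \<open>auto simp: field_simps\<close>)
    qed
    obtain w where w: "w > 0" "\<forall>\<^sub>F n in sequentially. \<bar>T n \<epsilon> - T n \<delta>\<bar> \<le> w / l1 n"
      using window'[OF sep, of \<epsilon> \<delta>] ed by auto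
    show "(\<lambda>n. T n \<epsilon> - T n \<delta>) \<in> O(\<lambda>n. 1 / l1 n)"
      by (rule bigoI[of _ w]) (use w(2) ev1 in eventually_elim, auto)
  qed
  show ?thesis
    unfolding cutoff_criteria_def sep_def[symmetric]
    using cut_sep cut_pre pre_sep sep_mixing mixing_sep final half by (intro conjI) blast+
qed

text \<open>Chernoff's bound for the lower tail of the Poisson distribution, with tilting parameter \<open>1 - x\<close>.\<close>

lemma poisson_tail:
  fixes t x :: real
  assumes t: "t \<ge> 0" and x: "0 \<le> x" "x \<le> 1 / 2"
  shows "(\<Sum>k<m. exp (- t) * t ^ k / fact k) \<le> exp (- x * t + m * (x + 2 * x\<^sup>2))"
proof -
  define \<theta> where "\<theta> = 1 - x"
  have \<theta>: "\<theta> > 0" "\<theta> \<le> 1" using x by (auto simp: \<theta>_def)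
  have "(\<Sum>k<m. t ^ k / fact k) \<le> (\<Sum>k<m. ((\<theta> * t) ^ k / fact k) / \<theta> ^ m)"
  proof (rule sum_mono)
    fix k assume "k \<in> {..<m}"
    then have "\<theta> ^ m \<le> \<theta> ^ k" using \<theta> by (intro power_decreasing) auto
    then have "t ^ k / fact k * \<theta> ^ m \<le> t ^ k / fact k * \<theta> ^ k"
      using t by (intro mult_left_mono) auto
    then show "t ^ k / fact k \<le> ((\<theta> * t) ^ k / fact k) / \<theta> ^ m"
      using \<theta> by (simp add: pos_le_divide_eq power_mult_distrib mult_ac)
  qed
  also have "\<dots> = (\<Sum>k<m. (\<theta> * t) ^ k / fact k) / \<theta> ^ m" by (simp add: sum_divide_distrib)
  also have "\<dots> \<le> exp (\<theta> * t) / \<theta> ^ m"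
  proof (rule divide_right_mono)
    have "(\<Sum>k<m. (\<theta> * t) ^ k / fact k) \<le> (\<Sum>k. (\<theta> * t) ^ k /\<^sub>R fact k)"
      using sum_le_suminf[OF summable_exp_generic[of "\<theta> * t"], of "{..<m}"] \<theta> t
      by (simp add: divide_inverse mult_ac)
    then show "(\<Sum>k<m. (\<theta> * t) ^ k / fact k) \<le> exp (\<theta> * t)" by (simp add: exp_def)
  qed (use \<theta> in auto)
  finally have 1: "(\<Sum>k<m. t ^ k / fact k) \<le> exp (\<theta> * t) / \<theta> ^ m" .
  have "- x - 2 * x\<^sup>2 \<le> ln \<theta>" unfolding \<theta>_def by (rule ln_one_minus_pos_lower_bound) (use x in auto)
  then have "exp (m * (- x - 2 * x\<^sup>2)) \<le> exp (m * ln \<theta>)" by (simp add: mult_left_mono)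
  also have "\<dots> = \<theta> ^ m" using \<theta> by (simp add: exp_of_nat_mult)
  finally have "1 / \<theta> ^ m \<le> 1 / exp (m * (- x - 2 * x\<^sup>2))" using \<theta> by (intro divide_left_mono) auto
  also have "\<dots> = exp (m * (x + 2 * x\<^sup>2))"
    by (simp add: exp_minus[symmetric] divide_inverse algebra_simps)
  finally have 2: "1 / \<theta> ^ m \<le> exp (m * (x + 2 * x\<^sup>2))" .
  have "(\<Sum>k<m. exp (- t) * t ^ k / fact k) = exp (- t) * (\<Sum>k<m. t ^ k / fact k)"
    by (simp add: sum_distrib_left)
  also have "\<dots> \<le> exp (- t) * (exp (\<theta> * t) * (1 / \<theta> ^ m))"
    using 1 by (intro mult_left_mono) auto
  also have "\<dots> \<le> exp (- t) * (exp (\<theta> * t) * exp (m * (x + 2 * x\<^sup>2)))"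
    using 2 by (intro mult_left_mono) auto
  also have "\<dots> = exp (- x * t + m * (x + 2 * x\<^sup>2))"
    by (simp add: exp_add[symmetric] \<theta>_def algebra_simps)
  finally show ?thesis .
qed

section \<open>Arrays in continuous time\<close>

lemma exp_minus_1_le: "0 \<le> x \<Longrightarrow> x \<le> 1 \<Longrightarrow> exp x - 1 \<le> 2 * (x::real)"
proof -
  assume x: "0 \<le> x" "x \<le> 1"
  have "exp x \<le> 1 + x + x\<^sup>2" by (rule exp_bound[OF x])
  moreover have "x\<^sup>2 \<le> x" using x by (simp add: power2_eq_square mult_left_le)
  ultimately show ?thesis by simp
qed

lemma half_le_one_minus_exp: "0 \<le> y \<Longrightarrow> y \<le> 1 \<Longrightarrow> y / 2 \<le> 1 - exp (- (y::real))"
proof -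
  assume y: "0 \<le> y" "y \<le> 1"
  have "exp (- y) \<le> 1 / (1 + y)"
    using exp_ge_add_one_self[of y] y by (simp add: exp_minus inverse_eq_divide frac_le)
  also have "\<dots> \<le> 1 - y / 2" using y mult_left_mono[of y 1 y] by (simp add: field_simps)
  finally show ?thesis by simp
qed

lemma sum_inverse_squares_le: "(\<Sum>i=1..k. 1 / (real i + 1)\<^sup>2) \<le> 1"
proof -
  have "(\<Sum>i=1..k. 1 / (real i + 1)\<^sup>2) \<le> 1 - 1 / (real k + 1)"
  proof (induction k)
    case (Suc k)
    have "1 / (real k + 2)\<^sup>2 \<le> 1 / ((real k + 1) * (real k + 2))"
      by (intro divide_left_mono) (auto simp: power2_eq_square)
    also have "\<dots> = 1 / (real k + 1) - 1 / (real k + 2)" by (simp add: field_simps)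
    finally have le: "1 / (real k + 2)\<^sup>2 \<le> 1 / (real k + 1) - 1 / (real k + 2)" .
    have e: "real (Suc k) + 1 = real k + 2" by simp
    have "(\<Sum>i=1..Suc k. 1 / (real i + 1)\<^sup>2) = (\<Sum>i=1..k. 1 / (real i + 1)\<^sup>2) + 1 / (real k + 2)\<^sup>2"
      unfolding e[symmetric] by simp
    also have "\<dots> \<le> 1 - 1 / (real k + 2)" using Suc.IH le by linarith
    finally show ?case unfolding e .
  qed simp
  also have "\<dots> \<le> 1" by simp
  finally show ?thesis .
qed

lemma tv_precutoff_cE:
  assumes "tv_precutoff_c d"
  obtains B B' :: real and s and e :: real where "0 < B'" "B' < B" "\<forall>n. 0 < s n" "(\<lambda>n. d n (B * s n)) \<longlonglongrightarrow> 0"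
    "e > 0" "\<forall>\<^sub>F n in sequentially. d n (B' * s n) > e"
proof -
  from assms show thesis
    unfolding tv_precutoff_c_def
  proof (elim exE conjE)
    fix B B' :: real and s
    assume *: "0 < B'" "B' < B" "\<forall>n. 0 < s n" "(\<lambda>n. d n (B * s n)) \<longlonglongrightarrow> 0"
      and inf: "0 < liminf (\<lambda>n. ereal (d n (B' * s n)))"
    from inf obtain e where "e > 0" "\<forall>\<^sub>F n in sequentially. d n (B' * s n) > e"
      unfolding liminf_pos_iff by blast
    from that[OF * this] show thesis .
  qed
qed

lemma tv_precutoffE:
  assumes "tv_precutoff d"
  obtains B B' :: real and s and e :: real where "0 < B'" "B' < B" "\<forall>n. 0 < s n" "(\<lambda>n. d n (nat \<lceil>B * s n\<rceil>)) \<longlonglongrightarrow> 0"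
    "e > 0" "\<forall>\<^sub>F n in sequentially. d n (nat \<lfloor>B' * s n\<rfloor>) > e"
proof -
  from assms show thesis
    unfolding tv_precutoff_def
  proof (elim exE conjE)
    fix B B' :: real and s
    assume *: "0 < B'" "B' < B" "\<forall>n. 0 < s n" "(\<lambda>n. d n (nat \<lceil>B * s n\<rceil>)) \<longlonglongrightarrow> 0"
      and inf: "0 < liminf (\<lambda>n. ereal (d n (nat \<lfloor>B' * s n\<rfloor>)))"
    from inf obtain e where "e > 0" "\<forall>\<^sub>F n in sequentially. d n (nat \<lfloor>B' * s n\<rfloor>) > e"
      unfolding liminf_pos_iff by blast
    from that[OF * this] show thesis .
  qed
qed

text \<open>What the asymptotic argument uses about a triangular array.  Here \<open>chi2 n i t\<close> is the squared \<open>L\<^sup>2\<close> distance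
  of the \<open>i\<close>th factor in row \<open>n\<close>, and \<open>active n i\<close> means that this factor is a nontrivial group, so that
  it has a slow mode.  The condition \<open>C \<le> t * l n i\<close> says that the factor has passed its diffusive time.\<close>

locale cutoff_array =
  fixes k :: "nat \<Rightarrow> nat" and l :: "nat \<Rightarrow> nat \<Rightarrow> real" and active :: "nat \<Rightarrow> nat \<Rightarrow> bool"
    and chi2 :: "nat \<Rightarrow> nat \<Rightarrow> real \<Rightarrow> real" and dc :: "nat \<Rightarrow> real \<Rightarrow> real"
    and C M \<gamma> \<Gamma> c :: real
  assumes C_pos: "0 < C" and M_pos: "0 < M" and gamma_pos: "0 < \<gamma>" and Gamma_pos: "0 < \<Gamma>"
    and c_pos: "0 < c"
    and k_pos: "\<And>n. n \<ge> 1 \<Longrightarrow> 1 \<le> k n"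
    and l_pos: "\<And>n i. n \<ge> 1 \<Longrightarrow> i \<in> {1..k n} \<Longrightarrow> 0 < l n i"
    and l_mono: "\<And>n i j. n \<ge> 1 \<Longrightarrow> 1 \<le> i \<Longrightarrow> i \<le> j \<Longrightarrow> j \<le> k n \<Longrightarrow> l n i \<le> l n j"
    and chi2_nonneg: "\<And>n i t. n \<ge> 1 \<Longrightarrow> i \<in> {1..k n} \<Longrightarrow> 0 \<le> chi2 n i t"
    and chi2_decay: "\<And>n i s t. n \<ge> 1 \<Longrightarrow> i \<in> {1..k n} \<Longrightarrow> 0 \<le> s \<Longrightarrow>
      chi2 n i (t + s) \<le> exp (- (\<gamma> * s * l n i)) * chi2 n i t"
    and chi2_bound: "\<And>n i t. n \<ge> 1 \<Longrightarrow> i \<in> {1..k n} \<Longrightarrow> C \<le> t * l n i \<Longrightarrow> chi2 n i t \<le> M"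
    and chi2_lower: "\<And>n i t. n \<ge> 1 \<Longrightarrow> i \<in> {1..k n} \<Longrightarrow> active n i \<Longrightarrow> 0 \<le> t \<Longrightarrow>
      exp (- (\<Gamma> * t * l n i)) \<le> chi2 n i t"
    and dc_upper: "\<And>n t. n \<ge> 1 \<Longrightarrow> 0 \<le> t \<Longrightarrow> dc n t \<le> sqrt (exp (\<Sum>i=1..k n. chi2 n i t) - 1) / 2"
    and dc_lower: "\<And>n t. n \<ge> 1 \<Longrightarrow> C \<le> t * l n 1 \<Longrightarrow>
      1 - dc n t \<le> exp (- (c * (\<Sum>i=1..k n. chi2 n i t)))"
    and dc_coord: "\<And>n i t. n \<ge> 1 \<Longrightarrow> i \<in> {1..k n} \<Longrightarrow> active n i \<Longrightarrow> 0 \<le> t \<Longrightarrow>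
      exp (- (\<Gamma> * t * l n i)) / 2 \<le> dc n t"
    and dc_antimono: "\<And>n s t. n \<ge> 1 \<Longrightarrow> s \<le> t \<Longrightarrow> dc n t \<le> dc n s"
    and dc_nonneg: "\<And>n t. n \<ge> 1 \<Longrightarrow> 0 \<le> t \<Longrightarrow> 0 \<le> dc n t"
begin

definition tmax :: "nat \<Rightarrow> real" where
  "tmax n = Max ((\<lambda>i. ln (real i + 1) / l n i) ` {1..k n})"

definition S :: "nat \<Rightarrow> real \<Rightarrow> real" where
  "S n t = (\<Sum>i=1..k n. chi2 n i t)"

lemma l1_pos: "n \<ge> 1 \<Longrightarrow> 0 < l n 1"
  using l_pos[of n 1] k_pos[of n] by auto

lemma l1_le: "n \<ge> 1 \<Longrightarrow> i \<in> {1..k n} \<Longrightarrow> l n 1 \<le> l n i"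
  using l_mono[of n 1 i] by auto

lemma tmax_ge: "n \<ge> 1 \<Longrightarrow> i \<in> {1..k n} \<Longrightarrow> ln (real i + 1) \<le> tmax n * l n i"
proof -
  assume n: "n \<ge> 1" and i: "i \<in> {1..k n}"
  have "ln (real i + 1) / l n i \<le> tmax n" unfolding tmax_def using i by (intro Max_ge) auto
  then show ?thesis using l_pos[OF n i] by (simp add: pos_divide_le_eq)
qed

lemma tmax_attained: "n \<ge> 1 \<Longrightarrow> \<exists>i\<in>{1..k n}. ln (real i + 1) = tmax n * l n i"
proof -
  assume n: "n \<ge> 1"
  have "tmax n \<in> (\<lambda>i. ln (real i + 1) / l n i) ` {1..k n}"
    unfolding tmax_def using k_pos[OF n] by (intro Max_in) auto
  then obtain i where i: "i \<in> {1..k n}" "tmax n = ln (real i + 1) / l n i" by blast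
  then show ?thesis using l_pos[OF n i(1)] by (intro bexI[of _ i]) auto
qed

lemma tmax_l1_ge: "n \<ge> 1 \<Longrightarrow> ln 2 \<le> tmax n * l n 1"
  using tmax_ge[of n 1] k_pos[of n] by auto

lemma tmax_pos: "n \<ge> 1 \<Longrightarrow> 0 < tmax n"
proof -
  assume n: "n \<ge> 1"
  have "0 < tmax n * l n 1" using tmax_l1_ge[OF n] ln_gt_zero[of "2::real"] by linarith
  then show ?thesis using l1_pos[OF n] by (simp add: zero_less_mult_iff)
qed

lemma tmax_l1_le: "n \<ge> 1 \<Longrightarrow> tmax n * l n 1 \<le> ln (real (k n) + 1)"
proof -
  assume n: "n \<ge> 1"
  obtain i where i: "i \<in> {1..k n}" "ln (real i + 1) = tmax n * l n i" using tmax_attained[OF n] by blast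
  have "tmax n * l n 1 \<le> tmax n * l n i" using l1_le[OF n i(1)] tmax_pos[OF n] by (intro mult_left_mono) auto
  also have "\<dots> \<le> ln (real (k n) + 1)" using i by (simp flip: i(2))
  finally show ?thesis .
qed

lemma S_nonneg: "n \<ge> 1 \<Longrightarrow> 0 \<le> S n t"
  unfolding S_def by (intro sum_nonneg chi2_nonneg)

lemma S_decay:
  assumes n: "n \<ge> 1" and s: "0 \<le> s"
  shows "S n (t + s) \<le> exp (- (\<gamma> * s * l n 1)) * S n t"
  unfolding S_def sum_distrib_left
proof (rule sum_mono)
  fix i assume i: "i \<in> {1..k n}"
  have "exp (- (\<gamma> * s * l n i)) \<le> exp (- (\<gamma> * s * l n 1))"
    using l1_le[OF n i] s gamma_pos by (simp add: mult_left_mono)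
  then have "exp (- (\<gamma> * s * l n i)) * chi2 n i t \<le> exp (- (\<gamma> * s * l n 1)) * chi2 n i t"
    using chi2_nonneg[OF n i] by (rule mult_right_mono)
  then show "chi2 n i (t + s) \<le> exp (- (\<gamma> * s * l n 1)) * chi2 n i t"
    using chi2_decay[OF n i s, of t] by linarith
qed

lemma S_antimono: "n \<ge> 1 \<Longrightarrow> s \<le> t \<Longrightarrow> S n t \<le> S n s"
proof -
  assume n: "n \<ge> 1" and st: "s \<le> t"
  have "S n (s + (t - s)) \<le> exp (- (\<gamma> * (t - s) * l n 1)) * S n s" using st by (intro S_decay n) auto
  also have "\<dots> \<le> 1 * S n s"
    using S_nonneg[OF n] st gamma_pos l1_pos[OF n] by (intro mult_right_mono) auto
  finally show ?thesis by simp
qed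

definition "\<kappa> = \<gamma> * ln 2 / 2"

lemma kappa_pos: "0 < \<kappa>" using gamma_pos by (simp add: \<kappa>_def)

text \<open>At time \<open>a * tmax n\<close> factor \<open>i\<close> has decayed by a power of \<open>i + 1\<close> proportional to \<open>a\<close>, because
  \<open>tmax n * l n i \<ge> ln (i + 1)\<close>.  A square of \<open>i + 1\<close> makes the sum converge; the rest of the power is
  estimated at \<open>i = 1\<close>, which yields the rate \<open>\<kappa>\<close>.\<close>

lemma S_upper:
  assumes n: "n \<ge> 1" and a: "2 * C / ln 2 \<le> a" "4 \<le> a * \<gamma>"
  shows "S n (a * tmax n) \<le> 4 * M * exp (- (\<kappa> * a))"
proof -
  have ln2: "ln 2 > (0::real)" by simp
  have a0: "a > 0" using a(1) C_pos ln2 by (meson divide_pos_pos less_le_trans mult_pos_pos zero_less_numeral)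
  have "chi2 n i (a * tmax n) \<le> 4 * M * exp (- (\<kappa> * a)) * (1 / (real i + 1)\<^sup>2)" if i: "i \<in> {1..k n}" for i
  proof -
    \<comment> \<open>Until \<open>t0\<close> the factor passes its diffusive time; it decays during the remaining time \<open>s\<close>.\<close>
    define t0 where "t0 = C / ln 2 * tmax n"
    define s where "s = (a - C / ln 2) * tmax n"
    define L where "L = ln (real i + 1)"
    have L: "ln 2 \<le> L" using i by (simp add: L_def)
    have LT: "L \<le> tmax n * l n i" unfolding L_def by (rule tmax_ge[OF n i])
    have half: "a / 2 \<le> a - C / ln 2" using a(1) by (simp add: field_simps)
    have s0: "0 \<le> s" unfolding s_def using half a0 tmax_pos[OF n] by (intro mult_nonneg_nonneg) linarith+
    have "C * ln 2 \<le> C * (tmax n * l n i)" using L LT C_pos by (intro mult_left_mono) auto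
    then have "C \<le> t0 * l n i" using ln2 by (simp add: t0_def field_simps)
    then have b: "chi2 n i t0 \<le> M" by (rule chi2_bound[OF n i])
    have "a / 2 * L \<le> (a - C / ln 2) * (tmax n * l n i)"
      using half a0 L LT ln2 by (intro mult_mono) linarith+
    then have sl: "a / 2 * L \<le> s * l n i" by (simp add: s_def mult.assoc)
    have "chi2 n i (a * tmax n) = chi2 n i (t0 + s)" by (simp add: t0_def s_def algebra_simps)
    also have "\<dots> \<le> exp (- (\<gamma> * s * l n i)) * chi2 n i t0" by (rule chi2_decay[OF n i s0])
    also have "\<dots> \<le> exp (- (\<gamma> * (a / 2 * L))) * M"
      using b sl gamma_pos chi2_nonneg[OF n i] by (intro mult_mono) (auto simp: mult.assoc)
    also have "exp (- (\<gamma> * (a / 2 * L))) \<le> exp (- (2 * L) - (\<gamma> * a / 2 - 2) * ln 2)"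
    proof -
      have "(\<gamma> * a / 2 - 2) * ln 2 \<le> (\<gamma> * a / 2 - 2) * L"
        using a(2) L by (intro mult_left_mono) (auto simp: mult.commute)
      then show ?thesis by (simp add: algebra_simps)
    qed
    also have "exp (- (2 * L) - (\<gamma> * a / 2 - 2) * ln 2) = exp (- (2 * L)) * (exp (2 * ln 2) * exp (- (\<kappa> * a)))"
      by (simp add: exp_add[symmetric] \<kappa>_def algebra_simps)
    also have "exp (2 * ln 2) = (4::real)" using exp_of_nat_mult[of 2 "ln 2 :: real"] by simp
    also have "exp (- (2 * L)) = 1 / (real i + 1)\<^sup>2"
      using exp_of_nat_mult[of 2 L] by (simp add: exp_minus L_def inverse_eq_divide add_pos_pos)
    finally show ?thesis using M_pos by (simp add: mult_ac)
  qed
  then have "S n (a * tmax n) \<le> (\<Sum>i=1..k n. 4 * M * exp (- (\<kappa> * a)) * (1 / (real i + 1)\<^sup>2))"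
    unfolding S_def by (rule sum_mono)
  also have "\<dots> \<le> 4 * M * exp (- (\<kappa> * a)) * 1"
    unfolding sum_distrib_left[symmetric] using M_pos by (intro mult_left_mono sum_inverse_squares_le) auto
  finally show ?thesis by simp
qed

lemma dc_le_sqrt_S:
  assumes n: "n \<ge> 1" and t: "0 \<le> t" and S1: "S n t \<le> 1"
  shows "dc n t \<le> sqrt (S n t)"
proof -
  have "dc n t \<le> sqrt (exp (S n t) - 1) / 2" unfolding S_def by (rule dc_upper[OF n t])
  also have "\<dots> \<le> sqrt (2 * S n t) / 2"
    using exp_minus_1_le[OF S_nonneg[OF n] S1] by simp
  also have "\<dots> \<le> sqrt (4 * S n t) / 2" using S_nonneg[OF n, of t] by simp
  also have "\<dots> = sqrt (S n t)" by (simp add: real_sqrt_mult)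
  finally show ?thesis .
qed

text \<open>The rate \<open>\<kappa> / 4\<close> leaves room to absorb constants: the square root halves \<open>\<kappa>\<close>, and one half of the resulting
  exponential pays for the factor \<open>4 * sqrt M\<close>.\<close>

lemma dc_upper_tmax:
  "\<exists>A'>0. \<forall>a\<ge>A'. \<forall>n\<ge>1. dc n (a * tmax n) \<le> 1 - exp (- exp (- (a * (\<kappa> / 4))))"
proof -
  have k0: "\<kappa> > 0" by (rule kappa_pos)
  have "\<forall>\<^sub>F a in at_top. 4 * M * exp (- (\<kappa> * a)) \<le> 1" "\<forall>\<^sub>F a in at_top. 2 * sqrt M * exp (- (\<kappa> * a / 4)) \<le> 1 / 2"
    using M_pos k0 by real_asymp+
  moreover have "\<forall>\<^sub>F a in at_top. 2 * C / ln 2 \<le> a" "\<forall>\<^sub>F a in at_top. (0::real) < a" "\<forall>\<^sub>F a in at_top. 4 / \<gamma> \<le> a"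
    by (rule eventually_ge_at_top eventually_gt_at_top)+
  ultimately have "\<forall>\<^sub>F a in at_top. 4 * M * exp (- (\<kappa> * a)) \<le> 1 \<and> 2 * sqrt M * exp (- (\<kappa> * a / 4)) \<le> 1 / 2 \<and>
      2 * C / ln 2 \<le> a \<and> 0 < a \<and> 4 / \<gamma> \<le> a"
    by eventually_elim auto
  then obtain A' where A': "\<And>a. a \<ge> A' \<Longrightarrow> 4 * M * exp (- (\<kappa> * a)) \<le> 1 \<and> 2 * sqrt M * exp (- (\<kappa> * a / 4)) \<le> 1 / 2 \<and>
      2 * C / ln 2 \<le> a \<and> 0 < a \<and> 4 / \<gamma> \<le> a"
    unfolding eventually_at_top_linorder by blast
  have "dc n (a * tmax n) \<le> 1 - exp (- exp (- (a * (\<kappa> / 4))))" if a: "a \<ge> A'" and n: "n \<ge> 1" for a n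
  proof -
    note * = A'[OF a]
    have "4 \<le> a * \<gamma>" using * gamma_pos by (simp add: field_simps)
    then have S: "S n (a * tmax n) \<le> 4 * M * exp (- (\<kappa> * a))" using * by (intro S_upper n) auto
    have "dc n (a * tmax n) \<le> sqrt (S n (a * tmax n))"
      using * S tmax_pos[OF n] by (intro dc_le_sqrt_S n) auto
    also have "\<dots> \<le> sqrt (4 * M * exp (- (\<kappa> * a)))" using S by simp
    also have "exp (- (\<kappa> * a)) = (exp (- (\<kappa> * a / 4)) * exp (- (\<kappa> * a / 4)))\<^sup>2"
      by (simp add: power2_eq_square exp_add[symmetric])
    also have "sqrt (4 * M * (exp (- (\<kappa> * a / 4)) * exp (- (\<kappa> * a / 4)))\<^sup>2) =
        2 * sqrt M * exp (- (\<kappa> * a / 4)) * exp (- (\<kappa> * a / 4))"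
      by (simp add: real_sqrt_mult)
    also have "\<dots> \<le> 1 / 2 * exp (- (\<kappa> * a / 4))" using * by (intro mult_right_mono) auto
    also have "\<dots> \<le> 1 - exp (- exp (- (\<kappa> * a / 4)))"
      using half_le_one_minus_exp[of "exp (- (\<kappa> * a / 4))"] * k0 by simp
    finally show ?thesis by (simp add: mult_ac)
  qed
  moreover have "A' > 0" using A'[of A'] by simp
  ultimately show ?thesis by blast
qed

lemma S_small:
  assumes e: "e > 0"
  shows "\<forall>\<^sub>F a in at_top. \<forall>n\<ge>1. S n (a * tmax n) \<le> e"
proof -
  have "\<forall>\<^sub>F a in at_top. 4 * M * exp (- (\<kappa> * a)) \<le> e"
    using M_pos kappa_pos e by real_asymp
  moreover have "\<forall>\<^sub>F a in at_top. 2 * C / ln 2 \<le> a" "\<forall>\<^sub>F a in at_top. 4 / \<gamma> \<le> a"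
    by (rule eventually_ge_at_top)+
  ultimately show ?thesis
  proof eventually_elim
    case (elim a)
    then have "4 \<le> a * \<gamma>" using gamma_pos by (simp add: field_simps)
    then show ?case using S_upper[of _ a] elim by force
  qed
qed

lemma dc_small:
  assumes e: "e > 0"
  shows "\<exists>a>0. \<forall>n\<ge>1. dc n (a * tmax n) \<le> e"
proof -
  have "min 1 (e\<^sup>2) > 0" using e by simp
  from eventually_conj[OF S_small[OF this] eventually_gt_at_top[of 0]]
  obtain a where a: "a > 0" "\<And>n. n \<ge> 1 \<Longrightarrow> S n (a * tmax n) \<le> min 1 (e\<^sup>2)"
    unfolding eventually_at_top_linorder by (metis order_refl)
  have "dc n (a * tmax n) \<le> e" if n: "n \<ge> 1" for n
  proof -
    have "dc n (a * tmax n) \<le> sqrt (S n (a * tmax n))"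
      using a(1) a(2)[OF n] tmax_pos[OF n] by (intro dc_le_sqrt_S n) auto
    also have "\<dots> \<le> sqrt (e\<^sup>2)" using a(2)[OF n] by (intro real_sqrt_le_mono) simp
    finally show ?thesis using e by simp
  qed
  then show ?thesis using a(1) by blast
qed

lemma dc_vanishes: "n \<ge> 1 \<Longrightarrow> e > 0 \<Longrightarrow> \<exists>t\<ge>0. dc n t \<le> e"
  using dc_small[of e] tmax_pos[of n] by (metis less_imp_le mult_pos_pos)

lemma S_le_of_dc:
  assumes n: "n \<ge> 1" and t: "C \<le> t * l n 1" and d: "dc n t \<le> \<delta>" "\<delta> < 1"
  shows "S n t \<le> - ln (1 - \<delta>) / c"
proof -
  have "1 - \<delta> \<le> exp (- (c * S n t))" using dc_lower[OF n t] d by (simp add: S_def)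
  then have "ln (1 - \<delta>) \<le> ln (exp (- (c * S n t)))" using d(2) by (subst ln_le_cancel_iff) auto
  then show ?thesis using c_pos by (simp add: field_simps)
qed

text \<open>This is the source of the window: every factor decays at least at the rate of the first one.\<close>

lemma S_window:
  assumes e: "e > 0"
  shows "\<exists>w>0. \<forall>n\<ge>1. \<forall>t t'. S n t \<le> S0 \<longrightarrow> t + w / l n 1 \<le> t' \<longrightarrow> S n t' \<le> e"
proof -
  have "\<forall>\<^sub>F w in at_top. exp (- (\<gamma> * w)) * \<bar>S0\<bar> \<le> e" using gamma_pos e by real_asymp
  from eventually_conj[OF this eventually_gt_at_top[of 0]]
  obtain w where w: "w > 0" "exp (- (\<gamma> * w)) * \<bar>S0\<bar> \<le> e"
    unfolding eventually_at_top_linorder by (metis order_refl)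
  have "S n t' \<le> e" if n: "n \<ge> 1" and S0: "S n t \<le> S0" and t': "t + w / l n 1 \<le> t'" for n t t'
  proof -
    have "S n t' \<le> S n (t + w / l n 1)" by (rule S_antimono[OF n t'])
    also have "\<dots> \<le> exp (- (\<gamma> * (w / l n 1) * l n 1)) * S n t"
      using w l1_pos[OF n] by (intro S_decay n) auto
    also have "\<dots> = exp (- (\<gamma> * w)) * S n t" using l1_pos[OF n] by simp
    also have "\<dots> \<le> exp (- (\<gamma> * w)) * \<bar>S0\<bar>" using S0 by (intro mult_left_mono) auto
    finally show ?thesis using w(2) by simp
  qed
  then show ?thesis using w(1) by blast
qed

abbreviation "separated \<equiv> filterlim (\<lambda>n. tmax n * l n 1) at_top sequentially"

text \<open>Let \<open>i\<close> be the index that attains the maximum \<open>tmax n\<close>.  By monotonicity of \<open>l\<close>, at time \<open>tmax n / (2 * \<Gamma>)\<close> each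
  active factor with index at most \<open>i\<close> still contributes \<open>1 / sqrt (i + 1)\<close>, so \<open>S\<close> is about \<open>sqrt (i + 1)\<close>; and
  \<open>ln (i + 1) = tmax n * l n i\<close> tends to infinity.\<close>

lemma S_large:
  assumes sep: separated and act: "\<forall>n\<ge>1. \<forall>i\<in>{1..k n}. m0 \<le> i \<longrightarrow> active n i"
  shows "filterlim (\<lambda>n. S n (tmax n / (2 * \<Gamma>))) at_top sequentially"
proof -
  define m1 where "m1 = max 1 m0"
  have "filterlim (\<lambda>x. exp (x / 2) - real m1) at_top (at_top :: real filter)" by real_asymp
  from filterlim_compose[OF this sep]
  have "filterlim (\<lambda>n. exp (tmax n * l n 1 / 2) - real m1) at_top sequentially" .
  then show ?thesis
  proof (rule filterlim_at_top_mono)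
    show "\<forall>\<^sub>F n in sequentially. exp (tmax n * l n 1 / 2) - real m1 \<le> S n (tmax n / (2 * \<Gamma>))"
      using eventually_ge_at_top[of 1]
    proof eventually_elim
      case n: (elim n)
      obtain i where i: "i \<in> {1..k n}" "ln (real i + 1) = tmax n * l n i" using tmax_attained[OF n] by blast
      \<comment> \<open>The common lower bound for the contribution of an active factor up to \<open>i\<close> will be \<open>1 / q\<close>.\<close>
      define q where "q = sqrt (real i + 1)"
      have q1: "q \<ge> 1" by (simp add: q_def)
      have qq: "q * q = real i + 1" by (simp add: q_def)
      have lnq: "ln q = tmax n * l n i / 2" by (simp add: q_def ln_sqrt i(2))
      have chi2: "1 / q \<le> chi2 n j (tmax n / (2 * \<Gamma>))" if j: "j \<in> {m1..i}" for j
      proof -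
        have j1: "j \<in> {1..k n}" "m0 \<le> j" using j i(1) by (auto simp: m1_def)
        have "tmax n * l n j / 2 \<le> ln q"
          unfolding lnq using l_mono[OF n, of j i] j j1 i(1) tmax_pos[OF n] by auto
        then have "exp (- ln q) \<le> exp (- (\<Gamma> * (tmax n / (2 * \<Gamma>)) * l n j))"
          using Gamma_pos by simp
        also have "\<dots> \<le> chi2 n j (tmax n / (2 * \<Gamma>))"
          using tmax_pos[OF n] Gamma_pos by (intro chi2_lower n j1 act[rule_format]) auto
        finally show ?thesis using q1 by (simp add: exp_minus inverse_eq_divide)
      qed
      have "exp (tmax n * l n 1 / 2) \<le> exp (ln q)"
        unfolding lnq using l1_le[OF n i(1)] tmax_pos[OF n] by simp
      also have "\<dots> = q" using q1 by simp
      finally have "exp (tmax n * l n 1 / 2) - real m1 \<le> q - real m1 * 1" by simp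
      also have "\<dots> \<le> q - real m1 * (1 / q)" using q1 by (intro diff_left_mono mult_left_mono) auto
      also have "\<dots> = (real i + 1 - real m1) * (1 / q)" using q1 qq by (simp add: field_simps)
      also have "\<dots> \<le> card {m1..i} * (1 / q)" using q1 by (intro mult_right_mono) auto
      also have "\<dots> = (\<Sum>j\<in>{m1..i}. 1 / q)" by simp
      also have "\<dots> \<le> (\<Sum>j\<in>{m1..i}. chi2 n j (tmax n / (2 * \<Gamma>)))" by (rule sum_mono) (rule chi2)
      also have "\<dots> \<le> S n (tmax n / (2 * \<Gamma>))"
        unfolding S_def using i(1) chi2_nonneg[OF n] by (intro sum_mono2) (auto simp: m1_def)
      finally show ?case .
    qed
  qed
qed

lemma eventually_late:
  assumes sep: separated and b: "b > 0"
  shows "\<forall>\<^sub>F n in sequentially. C \<le> b * tmax n * l n 1"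
proof -
  have "\<forall>\<^sub>F n in sequentially. C / b \<le> tmax n * l n 1" using sep by (simp add: filterlim_at_top)
  then show ?thesis by eventually_elim (use b in \<open>simp add: field_simps\<close>)
qed

lemma dc_large:
  assumes sep: separated and act: "\<forall>n\<ge>1. \<forall>i\<in>{1..k n}. m0 \<le> i \<longrightarrow> active n i"
    and e: "\<epsilon> < 1"
  shows "\<forall>\<^sub>F n in sequentially. \<epsilon> < dc n (tmax n / (2 * \<Gamma>))"
proof -
  have G: "1 / (2 * \<Gamma>) > 0" using Gamma_pos by simp
  have "\<forall>\<^sub>F n in sequentially. - ln (1 - \<epsilon>) / c + 1 \<le> S n (tmax n / (2 * \<Gamma>))"
    using S_large[OF sep act] by (simp add: filterlim_at_top)
  then show ?thesis using eventually_late[OF sep G] eventually_ge_at_top[of 1]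
  proof eventually_elim
    case (elim n)
    show ?case
    proof (rule ccontr)
      assume "\<not> ?thesis"
      then have "S n (tmax n / (2 * \<Gamma>)) \<le> - ln (1 - \<epsilon>) / c"
        using elim e by (intro S_le_of_dc) auto
      then show False using elim by simp
    qed
  qed
qed

lemma not_separated:
  assumes "\<not> separated" shows "\<exists>K>0. \<exists>\<^sub>F n in sequentially. tmax n * l n 1 < K"
proof -
  obtain Z where "\<not> (\<forall>\<^sub>F n in sequentially. Z \<le> tmax n * l n 1)"
    using assms unfolding filterlim_at_top by blast
  then have "\<exists>\<^sub>F n in sequentially. tmax n * l n 1 < Z" by (simp add: frequently_def not_less)
  then have "\<exists>\<^sub>F n in sequentially. tmax n * l n 1 < max Z 1" by (rule frequently_elim1) auto
  then show ?thesis by (intro exI[of _ "max Z 1"]) auto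
qed

text \<open>If the total variation does not vanish at \<open>B' s\<^sub>n\<close>, then \<open>s\<^sub>n\<close> is at most a multiple of \<open>tmax n\<close>.  Were
  \<open>tmax n * l n 1\<close> bounded along a subsequence, then so would be \<open>B s\<^sub>n l n 1\<close>, and the slow mode of the first factor would
  keep the total variation at \<open>B s\<^sub>n\<close> away from zero.\<close>

lemma precutoff_imp_separated:
  assumes act1: "\<forall>\<^sub>F n in sequentially. active n 1" and pre: "tv_precutoff_c dc"
  shows separated
proof (rule ccontr)
  assume "\<not> separated"
  then obtain K where K: "K > 0" "\<exists>\<^sub>F n in sequentially. tmax n * l n 1 < K" using not_separated by blast
  obtain B B' s e where B: "0 < B'" "B' < B" "\<forall>n. 0 < s n" and lim: "(\<lambda>n. dc n (B * s n)) \<longlonglongrightarrow> 0"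
    and e: "e > 0" "\<forall>\<^sub>F n in sequentially. dc n (B' * s n) > e"
    by (rule tv_precutoff_cE[OF pre])
  obtain a where a: "a > 0" "\<And>n. n \<ge> 1 \<Longrightarrow> dc n (a * tmax n) \<le> e" using dc_small[OF e(1)] by blast
  define z where "z = exp (- (\<Gamma> * (B / B' * a * K))) / 2"
  have z: "z > 0" by (simp add: z_def)
  have "\<forall>\<^sub>F n in sequentially. dc n (B * s n) < z" using order_tendstoD(2)[OF lim z] .
  then have ev: "\<forall>\<^sub>F n in sequentially. K \<le> tmax n * l n 1"
    using e(2) act1 eventually_ge_at_top[of 1]
  proof eventually_elim
    case (elim n)
    have n: "n \<ge> 1" by fact
    have "B' * s n < a * tmax n"
    proof (rule ccontr)
      assume "\<not> ?thesis"
      then have "dc n (B' * s n) \<le> dc n (a * tmax n)" by (intro dc_antimono n) auto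
      then show False using a(2)[OF n] elim by simp
    qed
    then have Bs: "B * s n \<le> B / B' * a * tmax n" using B(1,2) by (simp add: field_simps)
    show ?case
    proof (rule ccontr)
      assume "\<not> ?thesis"
      then have less: "tmax n * l n 1 \<le> K" by simp
      have "B * s n * l n 1 \<le> B / B' * a * tmax n * l n 1"
        using Bs l1_pos[OF n] by (intro mult_right_mono) auto
      also have "\<dots> = B / B' * a * (tmax n * l n 1)" by simp
      also have "\<dots> \<le> B / B' * a * K" using less B(1,2) a(1) by (intro mult_left_mono) auto
      finally have "\<Gamma> * (B * s n * l n 1) \<le> \<Gamma> * (B / B' * a * K)" using Gamma_pos by (intro mult_left_mono) auto
      then have "z \<le> exp (- (\<Gamma> * (B * s n) * l n 1)) / 2" unfolding z_def by (simp add: mult.assoc)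
      also have "\<dots> \<le> dc n (B * s n)"
        using B k_pos[OF n] elim less_imp_le[of 0 "s n"] by (intro dc_coord n) auto
      finally show False using elim by simp
    qed
  qed
  have "\<exists>\<^sub>F n in sequentially. False"
    using frequently_eventually_frequently[OF K(2) ev] by (rule frequently_elim1) auto
  then show False by simp
qed

lemma mixing_props:
  assumes "n \<ge> 1" "\<epsilon> > 0"
  shows "0 \<le> mixing_time_c (dc n) \<epsilon>"
    and "0 \<le> t \<Longrightarrow> dc n t \<le> \<epsilon> \<Longrightarrow> mixing_time_c (dc n) \<epsilon> \<le> t"
    and "mixing_time_c (dc n) \<epsilon> < t \<Longrightarrow> dc n t \<le> \<epsilon>"
  using mixing_time_c_props[OF dc_antimono[OF assms(1)] dc_vanishes[OF assms]] by blast+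

theorem continuous_cutoff_equivalences:
  assumes act1: "\<forall>\<^sub>F n in sequentially. active n 1"
    and act: "\<forall>n\<ge>1. \<forall>i\<in>{1..k n}. m0 \<le> i \<longrightarrow> active n i"
  shows "cutoff_criteria (tv_cutoff_c dc) (tv_precutoff_c dc) (\<lambda>n. mixing_time_c (dc n)) tmax (\<lambda>n. l n 1)"
proof (rule cutoff_equivalences[where extra = True])
  show "0 < tmax n \<and> 0 < l n 1" if "n \<ge> 1" for n using tmax_pos l1_pos that by blast
  show "\<exists>K>0. \<forall>n\<ge>1. mixing_time_c (dc n) \<epsilon> \<le> K * tmax n" if e: "0 < \<epsilon>" for \<epsilon>
  proof -
    obtain a where a: "a > 0" "\<And>n. n \<ge> 1 \<Longrightarrow> dc n (a * tmax n) \<le> \<epsilon>" using dc_small[OF e] by blast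
    show ?thesis
      using a tmax_pos by (intro exI[of _ a] conjI allI impI mixing_props(2) e) (auto intro: less_imp_le)
  qed
  have lower: "\<forall>\<^sub>F n in sequentially. 1 / (2 * \<Gamma>) * tmax n \<le> mixing_time_c (dc n) \<epsilon>"
    if sep: separated and e: "0 < \<epsilon>" "\<epsilon> < 1" for \<epsilon>
    using dc_large[OF sep act e(2)] eventually_ge_at_top[of 1]
  proof eventually_elim
    case (elim n)
    then show ?case using mixing_props(3)[of n \<epsilon> "tmax n / (2 * \<Gamma>)"] e by (auto simp: not_less[symmetric])
  qed
  show "\<exists>b>0. \<forall>\<^sub>F n in sequentially. b * tmax n \<le> mixing_time_c (dc n) \<epsilon>"
    if sep: separated and e: "0 < \<epsilon>" "\<epsilon> < 1" for \<epsilon>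
    using lower[OF that] Gamma_pos by (intro exI[of _ "1 / (2 * \<Gamma>)"]) simp
  show "\<exists>w>0. \<forall>\<^sub>F n in sequentially. mixing_time_c (dc n) \<delta> \<le> mixing_time_c (dc n) \<epsilon> \<and>
      mixing_time_c (dc n) \<epsilon> \<le> mixing_time_c (dc n) \<delta> + w / l n 1"
    if sep: separated and ed: "0 < \<epsilon>" "\<epsilon> < \<delta>" "\<delta> < 1" for \<epsilon> \<delta>
  proof -
    have d0: "\<delta> > 0" using ed by simp
    have "min 1 (\<epsilon>\<^sup>2) > 0" using ed by simp
    from S_window[OF this, of "- ln (1 - \<delta>) / c"] obtain w where w: "w > 0"
      "\<And>n t t'. n \<ge> 1 \<Longrightarrow> S n t \<le> - ln (1 - \<delta>) / c \<Longrightarrow> t + w / l n 1 \<le> t' \<Longrightarrow> S n t' \<le> min 1 (\<epsilon>\<^sup>2)"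
      by blast
    have G: "1 / (2 * \<Gamma>) > 0" using Gamma_pos by simp
    have "\<forall>\<^sub>F n in sequentially. mixing_time_c (dc n) \<delta> \<le> mixing_time_c (dc n) \<epsilon> \<and>
        mixing_time_c (dc n) \<epsilon> \<le> mixing_time_c (dc n) \<delta> + w / l n 1"
      using lower[OF sep d0 ed(3)] eventually_late[OF sep G] eventually_ge_at_top[of 1]
    proof eventually_elim
      case (elim n)
      have n: "n \<ge> 1" by fact
      have l1: "l n 1 > 0" by (rule l1_pos[OF n])
      show ?case
      proof
        show "mixing_time_c (dc n) \<delta> \<le> mixing_time_c (dc n) \<epsilon>"
        proof (rule ccontr)
          assume "\<not> ?thesis"
          then have "mixing_time_c (dc n) \<epsilon> < mixing_time_c (dc n) \<delta>" by simp
          from dense[OF this] obtain t where t: "mixing_time_c (dc n) \<epsilon> < t" "t < mixing_time_c (dc n) \<delta>"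
            by blast
          have "dc n t \<le> \<delta>" using mixing_props(3)[OF n ed(1) t(1)] ed(2) by simp
          then show False
            using mixing_props(2)[OF n d0, of t] mixing_props(1)[OF n ed(1)] t by auto
        qed
        show "mixing_time_c (dc n) \<epsilon> \<le> mixing_time_c (dc n) \<delta> + w / l n 1"
        \<comment> \<open>The total variation is known to be at most \<open>\<delta>\<close> only after its mixing time, whence the margin \<open>h\<close>.\<close>
        proof (rule field_le_epsilon)
          fix h :: real assume h: "h > 0"
          define t where "t = mixing_time_c (dc n) \<delta> + h"
          have t: "tmax n / (2 * \<Gamma>) \<le> t" using elim h by (simp add: t_def)
          have t0: "0 \<le> t" using t tmax_pos[OF n] Gamma_pos by (meson divide_nonneg_pos less_imp_le mult_pos_pos order_trans zero_less_numeral)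
          have "C \<le> (tmax n / (2 * \<Gamma>)) * l n 1" using elim by simp
          also have "\<dots> \<le> t * l n 1" using t l1 by (intro mult_right_mono) auto
          finally have Ct: "C \<le> t * l n 1" .
          have "dc n t \<le> \<delta>" using h by (intro mixing_props(3)[OF n d0]) (simp add: t_def)
          then have "S n t \<le> - ln (1 - \<delta>) / c" using Ct ed(3) by (intro S_le_of_dc n)
          then have S: "S n (t + w / l n 1) \<le> min 1 (\<epsilon>\<^sup>2)" by (rule w(2)[OF n _ order_refl])
          have tw: "0 \<le> t + w / l n 1" using t0 w(1) l1 by simp
          have "dc n (t + w / l n 1) \<le> sqrt (S n (t + w / l n 1))"
            using S by (intro dc_le_sqrt_S n tw) auto
          also have "\<dots> \<le> sqrt (\<epsilon>\<^sup>2)" using S by (intro real_sqrt_le_mono) simp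
          finally have "dc n (t + w / l n 1) \<le> \<epsilon>" using ed(1) by simp
          then have "mixing_time_c (dc n) \<epsilon> \<le> t + w / l n 1" by (intro mixing_props(2)[OF n ed(1) tw])
          then show "mixing_time_c (dc n) \<epsilon> \<le> mixing_time_c (dc n) \<delta> + w / l n 1 + h" by (simp add: t_def)
        qed
      qed
    qed
    then show ?thesis using w(1) by blast
  qed
  show "tv_cutoff_c dc \<longleftrightarrow> True \<and> (\<forall>\<epsilon> \<delta>. 0 < \<epsilon> \<and> \<epsilon> < 1 \<and> 0 < \<delta> \<and> \<delta> < 1 \<longrightarrow>
      (\<lambda>n. mixing_time_c (dc n) \<epsilon> / mixing_time_c (dc n) \<delta>) \<longlonglongrightarrow> 1)"
    by (simp add: tv_cutoff_c_def)
  show "tv_precutoff_c dc" if "tv_cutoff_c dc"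
    by (rule cutoff_imp_precutoff_c[OF dc_antimono dc_nonneg dc_vanishes that])
  show separated if "tv_precutoff_c dc" by (rule precutoff_imp_separated[OF act1 that])
qed auto

end

section \<open>Arrays in discrete time\<close>

text \<open>The term \<open>exp (W / l n 1 - \<theta> * m)\<close> accounts for negative eigenvalues, with \<open>exp (W / l n 1)\<close> bounding
  the order of the product group.\<close>

locale discrete_cutoff_array = cutoff_array +
  fixes dd :: "nat \<Rightarrow> nat \<Rightarrow> real" and W \<theta> :: real
  assumes W_pos: "0 < W" and theta_pos: "0 < \<theta>"
    and k_l1: "\<And>n. n \<ge> 1 \<Longrightarrow> real (k n) * l n 1 \<le> C"
    and dd_upper: "\<And>n m. n \<ge> 1 \<Longrightarrow>
      dd n m \<le> sqrt (exp (\<Sum>i=1..k n. chi2 n i (real m)) - 1 + exp (W / l n 1 - \<theta> * real m)) / 2"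
    and dd_coord: "\<And>n m. n \<ge> 1 \<Longrightarrow> active n 1 \<Longrightarrow> \<Gamma> * l n 1 \<le> 1 / 2 \<Longrightarrow>
      (1 - \<Gamma> * l n 1) ^ m / 2 \<le> dd n m"
    and dc_le_dd: "\<And>n m t. n \<ge> 1 \<Longrightarrow> 0 \<le> t \<Longrightarrow>
      dc n t \<le> dd n m + (\<Sum>j<m. exp (- t) * t ^ j / fact j)"
    and dd_antimono: "\<And>n m m'. n \<ge> 1 \<Longrightarrow> m \<le> m' \<Longrightarrow> dd n m' \<le> dd n m"
    and dd_nonneg: "\<And>n m. n \<ge> 1 \<Longrightarrow> 0 \<le> dd n m"
begin

lemma l1_le_C: "n \<ge> 1 \<Longrightarrow> l n 1 \<le> C"
proof -
  assume n: "n \<ge> 1"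
  have "1 * l n 1 \<le> real (k n) * l n 1" using k_pos[OF n] l1_pos[OF n] by (intro mult_right_mono) auto
  then show ?thesis using k_l1[OF n] by simp
qed

lemma tmax_lower: "n \<ge> 1 \<Longrightarrow> ln 2 / C \<le> tmax n"
proof -
  assume n: "n \<ge> 1"
  have "ln 2 \<le> tmax n * C"
    using tmax_l1_ge[OF n] mult_left_mono[OF l1_le_C[OF n], of "tmax n"] tmax_pos[OF n] by linarith
  then show ?thesis using C_pos by (simp add: field_simps)
qed

text \<open>The Poisson fluctuations at time \<open>tmax n\<close> fit into the window, since \<open>tmax n * l n 1 \<le> ln (k n + 1) \<le> k n\<close> and
  \<open>k n * l n 1\<close> is bounded.\<close>

lemma sqrt_tmax: "n \<ge> 1 \<Longrightarrow> sqrt (tmax n) \<le> sqrt C / l n 1"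
proof -
  assume n: "n \<ge> 1"
  have "tmax n * l n 1 \<le> ln (real (k n) + 1)" by (rule tmax_l1_le[OF n])
  also have "\<dots> \<le> real (k n)" using ln_add_one_self_le_self[of "real (k n)"] by (simp add: add.commute)
  also have "\<dots> \<le> C / l n 1" using k_l1[OF n] l1_pos[OF n] by (simp add: field_simps)
  finally have "tmax n \<le> C / (l n 1)\<^sup>2" using l1_pos[OF n] by (simp add: field_simps power2_eq_square)
  then have "sqrt (tmax n) \<le> sqrt (C / (l n 1)\<^sup>2)" by simp
  also have "\<dots> = sqrt C / l n 1" using l1_pos[OF n] by (simp add: real_sqrt_divide)
  finally show ?thesis .
qed

lemma dd_le:
  assumes n: "n \<ge> 1" and S: "S n (real m) \<le> e" and W: "W / l n 1 - \<theta> * real m \<le> ln e"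
    and e: "0 < e" "e \<le> 1"
  shows "dd n m \<le> sqrt e"
proof -
  have "exp (S n (real m)) - 1 \<le> 2 * S n (real m)"
    using S e by (intro exp_minus_1_le S_nonneg n) auto
  moreover have "exp (W / l n 1 - \<theta> * real m) \<le> e" using W e(1) by (metis exp_le_cancel_iff exp_ln)
  ultimately have "exp (S n (real m)) - 1 + exp (W / l n 1 - \<theta> * real m) \<le> 4 * e" using S e(1) by linarith
  then have "sqrt (exp (S n (real m)) - 1 + exp (W / l n 1 - \<theta> * real m)) \<le> sqrt (4 * e)"
    by (rule real_sqrt_le_mono)
  then show ?thesis using dd_upper[OF n, of m] by (simp add: S_def real_sqrt_mult)
qed

text \<open>Both error terms vanish on the scale \<open>tmax n\<close>: \<open>1 / l n 1\<close> is at most a multiple of \<open>tmax n\<close>, and \<open>tmax n\<close> is bounded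
  below.\<close>

lemma dd_small:
  assumes e: "e > 0"
  shows "\<exists>a>0. \<forall>n\<ge>1. \<forall>m. a * tmax n \<le> real m \<longrightarrow> dd n m \<le> e"
proof -
  define e' where "e' = min 1 (e\<^sup>2)"
  have e': "0 < e'" "e' \<le> 1" using e by (auto simp: e'_def)
  have ln2: "ln 2 > (0::real)" by simp
  have "\<forall>\<^sub>F a in at_top. W / ln 2 - ln e' * C / ln 2 \<le> \<theta> * a"
    using theta_pos by real_asymp
  from eventually_conj[OF eventually_conj[OF S_small[OF e'(1)] this] eventually_gt_at_top[of 0]]
  obtain a where a: "a > 0" "\<And>n. n \<ge> 1 \<Longrightarrow> S n (a * tmax n) \<le> e'" "W / ln 2 - ln e' * C / ln 2 \<le> \<theta> * a"
    unfolding eventually_at_top_linorder by (metis order_refl)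
  have "dd n m \<le> e" if n: "n \<ge> 1" and m: "a * tmax n \<le> real m" for n m
  proof -
    have "S n (real m) \<le> e'" using S_antimono[OF n m] a(2)[OF n] by linarith
    moreover have "W / l n 1 - \<theta> * real m \<le> ln e'"
    proof -
      have "1 / l n 1 \<le> tmax n / ln 2" using tmax_l1_ge[OF n] l1_pos[OF n] ln2 by (simp add: field_simps)
      then have "W * (1 / l n 1) \<le> W * (tmax n / ln 2)" using W_pos by (intro mult_left_mono) auto
      moreover have "\<theta> * (a * tmax n) \<le> \<theta> * real m" using m theta_pos by (intro mult_left_mono) auto
      moreover have "(W / ln 2 - ln e' * C / ln 2) * tmax n \<le> \<theta> * a * tmax n"
        using a(3) tmax_pos[OF n] by (intro mult_right_mono) auto
      moreover have "- ln e' * 1 \<le> - ln e' * (C / ln 2 * tmax n)"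
        using tmax_lower[OF n] e' C_pos ln2 by (intro mult_left_mono) (auto simp: field_simps)
      ultimately show ?thesis by (simp add: algebra_simps)
    qed
    ultimately have "dd n m \<le> sqrt e'" using e' by (intro dd_le n)
    also have "\<dots> \<le> sqrt (e\<^sup>2)" unfolding e'_def by (intro real_sqrt_le_mono) simp
    finally show ?thesis using e by simp
  qed
  then show ?thesis using a(1) by blast
qed

lemma dd_vanishes: "n \<ge> 1 \<Longrightarrow> e > 0 \<Longrightarrow> \<exists>m. dd n m \<le> e"
  using dd_small[of e] by (meson real_arch_simple)

lemma dmixing_props:
  assumes "n \<ge> 1" "\<epsilon> > 0"
  shows "dd n m \<le> \<epsilon> \<Longrightarrow> mixing_time (dd n) \<epsilon> \<le> m"
    and "mixing_time (dd n) \<epsilon> \<le> m \<Longrightarrow> dd n m \<le> \<epsilon>"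
  using mixing_time_props[OF dd_antimono[OF assms(1)] dd_vanishes[OF assms]] by blast+

lemma dmixing_upper:
  assumes e: "\<epsilon> > 0" shows "\<exists>K>0. \<forall>n\<ge>1. real (mixing_time (dd n) \<epsilon>) \<le> K * tmax n"
proof -
  obtain a where a: "a > 0" "\<And>n m. n \<ge> 1 \<Longrightarrow> a * tmax n \<le> real m \<Longrightarrow> dd n m \<le> \<epsilon>"
    using dd_small[OF e] by blast
  have ln2: "ln 2 > (0::real)" by simp
  have "real (mixing_time (dd n) \<epsilon>) \<le> (a + C / ln 2) * tmax n" if n: "n \<ge> 1" for n
  proof -
    have "dd n (nat \<lceil>a * tmax n\<rceil>) \<le> \<epsilon>" by (rule a(2)[OF n]) linarith
    then have "mixing_time (dd n) \<epsilon> \<le> nat \<lceil>a * tmax n\<rceil>" by (rule dmixing_props(1)[OF n e])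
    moreover have "0 \<le> a * tmax n" using a(1) tmax_pos[OF n] by simp
    ultimately have "real (mixing_time (dd n) \<epsilon>) \<le> a * tmax n + 1" by linarith
    moreover have "1 \<le> C / ln 2 * tmax n" using tmax_lower[OF n] C_pos ln2 by (simp add: field_simps)
    ultimately show ?thesis unfolding distrib_right by linarith
  qed
  then show ?thesis using a(1) C_pos ln2 by (intro exI[of _ "a + C / ln 2"]) (auto intro: add_pos_pos)
qed

lemma tmax_at_top:
  assumes k: "filterlim k at_top sequentially"
  shows "filterlim tmax at_top sequentially" and "(\<lambda>n. l n 1) \<longlonglongrightarrow> 0"
proof -
  have kr: "filterlim (\<lambda>n. real (k n)) at_top sequentially"
    using filterlim_compose[OF filterlim_real_sequentially k] .
  have "filterlim (\<lambda>n. ln 2 / C * real (k n)) at_top sequentially"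
    using C_pos by (intro filterlim_tendsto_pos_mult_at_top[OF tendsto_const _ kr]) auto
  then show "filterlim tmax at_top sequentially"
  proof (rule filterlim_at_top_mono)
    show "\<forall>\<^sub>F n in sequentially. ln 2 / C * real (k n) \<le> tmax n"
      using eventually_ge_at_top[of 1]
    proof eventually_elim
      case n: (elim n)
      have "ln 2 * (real (k n) * l n 1) \<le> (tmax n * l n 1) * C"
        using tmax_l1_ge[OF n] k_l1[OF n] C_pos l1_pos[OF n] tmax_pos[OF n] by (intro mult_mono) auto
      then have "(ln 2 * real (k n)) * l n 1 \<le> (tmax n * C) * l n 1" by (simp add: mult_ac)
      then have "ln 2 * real (k n) \<le> tmax n * C" using l1_pos[OF n] by (rule mult_right_le_imp_le)
      then show ?case using C_pos by (simp add: field_simps)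
    qed
  qed
  have lim: "(\<lambda>n. C / real (k n)) \<longlonglongrightarrow> 0"
    by (intro tendsto_divide_0[OF tendsto_const] filterlim_at_top_imp_at_infinity kr)
  show "(\<lambda>n. l n 1) \<longlonglongrightarrow> 0"
  proof (rule Lim_null_comparison[OF _ lim])
    show "\<forall>\<^sub>F n in sequentially. norm (l n 1) \<le> C / real (k n)"
      using eventually_ge_at_top[of 1]
    proof eventually_elim
      case n: (elim n)
      have "real (k n) > 0" using k_pos[OF n] by simp
      then show ?case using k_l1[OF n] l1_pos[OF n] by (simp add: pos_le_divide_eq mult.commute)
    qed
  qed
qed

text \<open>The continuous walk run for time \<open>2 * m\<close> has made at least \<open>m\<close> jumps except with exponentially small
  probability, so it is at least as well mixed as the discrete walk after \<open>m\<close> steps.\<close>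

lemma dmixing_lower:
  assumes k: "filterlim k at_top sequentially" and sep: separated
    and act: "\<forall>n\<ge>1. \<forall>i\<in>{1..k n}. m0 \<le> i \<longrightarrow> active n i"
    and e: "0 < \<epsilon>" "\<epsilon> < 1"
  shows "\<forall>\<^sub>F n in sequentially. 1 / (8 * \<Gamma>) * tmax n \<le> real (mixing_time (dd n) \<epsilon>)"
proof -
  define \<epsilon>' where "\<epsilon>' = (1 + \<epsilon>) / 2"
  have e': "\<epsilon>' < 1" using e by (simp add: \<epsilon>'_def)
  have "\<forall>\<^sub>F x in at_top. exp (- ((x - 1) / 8)) \<le> (1 - \<epsilon>) / 2" using e by real_asymp
  then have "\<forall>\<^sub>F x in at_top. exp (- ((x - 1) / 8)) \<le> (1 - \<epsilon>) / 2 \<and> 8 * \<Gamma> \<le> x * (4 * \<Gamma>) \<and> 2 \<le> x"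
    using eventually_ge_at_top[of 2] by eventually_elim (use Gamma_pos in auto)
  moreover have "filterlim (\<lambda>n. tmax n / (4 * \<Gamma>)) at_top sequentially"
    using filterlim_tendsto_pos_mult_at_top[OF tendsto_const _ tmax_at_top(1)[OF k], of "1 / (4 * \<Gamma>)"] Gamma_pos
    by simp
  ultimately have "\<forall>\<^sub>F n in sequentially. exp (- ((tmax n / (4 * \<Gamma>) - 1) / 8)) \<le> (1 - \<epsilon>) / 2 \<and>
      8 * \<Gamma> \<le> tmax n / (4 * \<Gamma>) * (4 * \<Gamma>) \<and> 2 \<le> tmax n / (4 * \<Gamma>)"
    by (rule eventually_compose_filterlim)
  then show ?thesis using dc_large[OF sep act e'] eventually_ge_at_top[of 1]
  proof eventually_elim
    case (elim n)
    have n: "n \<ge> 1" by fact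
    define x where "x = tmax n / (4 * \<Gamma>)"
    define m where "m = nat \<lfloor>x\<rfloor>"
    have x: "2 \<le> x" "exp (- ((x - 1) / 8)) \<le> (1 - \<epsilon>) / 2" using elim by (auto simp: x_def)
    have m: "real m \<le> x" "x - 1 < real m" using x unfolding m_def by linarith+
    have "(\<Sum>j<m. exp (- (2 * real m)) * (2 * real m) ^ j / fact j) \<le>
        exp (- (1/4) * (2 * real m) + real m * (1/4 + 2 * (1/4)\<^sup>2))"
      by (rule poisson_tail) auto
    also have "\<dots> = exp (- (real m / 8))" by (simp add: power2_eq_square field_simps)
    also have "\<dots> \<le> exp (- ((x - 1) / 8))" using m by simp
    also have "\<dots> \<le> (1 - \<epsilon>) / 2" by (rule x(2))
    finally have tail: "(\<Sum>j<m. exp (- (2 * real m)) * (2 * real m) ^ j / fact j) \<le> (1 - \<epsilon>) / 2" .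
    have "2 * real m \<le> tmax n / (2 * \<Gamma>)" using m(1) Gamma_pos by (simp add: x_def field_simps)
    then have "\<epsilon>' < dc n (2 * real m)" using dc_antimono[OF n, of "2 * real m" "tmax n / (2 * \<Gamma>)"] elim by simp
    also have "\<dots> \<le> dd n m + (1 - \<epsilon>) / 2"
      by (rule order.trans[OF dc_le_dd[OF n, of "2 * real m" m] add_left_mono[OF tail]]) simp
    finally have "\<epsilon> < dd n m" by (simp add: \<epsilon>'_def field_simps)
    then have "\<not> mixing_time (dd n) \<epsilon> \<le> m" using dmixing_props(2)[OF n e(1), of m] by auto
    then have "x - 1 \<le> real (mixing_time (dd n) \<epsilon>)" using m by simp
    moreover have "1 / (8 * \<Gamma>) * tmax n = x / 2" using Gamma_pos by (simp add: x_def)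
    ultimately show ?case using x(1) by linarith
  qed
qed

text \<open>Transfer to continuous time and back.  From \<open>dd n m \<le> \<delta>\<close> it follows that \<open>dc n t \<le> \<delta>'\<close> for a time \<open>t\<close> that
  exceeds \<open>m\<close> by a multiple of \<open>sqrt m\<close>; so \<open>S n t\<close> is bounded, a further multiple of \<open>1 / l n 1\<close> makes it small, and
  \<open>dd\<close> is then small as well.\<close>

lemma dmixing_window:
  assumes k: "filterlim k at_top sequentially" and sep: separated
    and act: "\<forall>n\<ge>1. \<forall>i\<in>{1..k n}. m0 \<le> i \<longrightarrow> active n i"
    and ed: "0 < \<epsilon>" "\<epsilon> < \<delta>" "\<delta> < 1"
  shows "\<exists>w>0. \<forall>\<^sub>F n in sequentially. real (mixing_time (dd n) \<delta>) \<le> real (mixing_time (dd n) \<epsilon>) \<and>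
    real (mixing_time (dd n) \<epsilon>) \<le> real (mixing_time (dd n) \<delta>) + w / l n 1"
proof -
  have d0: "\<delta> > 0" using ed by simp
  \<comment> \<open>Any level strictly between \<open>\<delta>\<close> and one will do; half of the gap pays for the Poisson tail.\<close>
  define \<delta>' where "\<delta>' = (1 + \<delta>) / 2"
  have d': "\<delta>' < 1" using ed by (simp add: \<delta>'_def)
  have "\<forall>\<^sub>F x in at_top. exp (2 - x) \<le> (1 - \<delta>) / 2" using ed by real_asymp
  from eventually_conj[OF this eventually_gt_at_top[of 0]]
  obtain c0 :: real where c0: "c0 > 0" "exp (2 - c0) \<le> (1 - \<delta>) / 2"
    unfolding eventually_at_top_linorder by (metis order_refl)
  define e where "e = min 1 (\<epsilon>\<^sup>2)"
  have e: "0 < e" "e \<le> 1" using ed by (auto simp: e_def)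
  obtain w where w: "w > 0"
      "\<And>n t t'. n \<ge> 1 \<Longrightarrow> S n t \<le> - ln (1 - \<delta>') / c \<Longrightarrow> t + w / l n 1 \<le> t' \<Longrightarrow> S n t' \<le> e"
    using S_window[OF e(1), of "- ln (1 - \<delta>') / c"] by blast
  obtain K where K: "K > 0" "\<And>n. n \<ge> 1 \<Longrightarrow> real (mixing_time (dd n) \<delta>) \<le> K * tmax n"
    using dmixing_upper[OF d0] by blast
  define b where "b = 1 / (8 * \<Gamma>)"
  have b: "b > 0" using Gamma_pos by (simp add: b_def)
  have low: "\<forall>\<^sub>F n in sequentially. b * tmax n \<le> real (mixing_time (dd n) \<delta>)"
    unfolding b_def by (rule dmixing_lower[OF k sep act d0 ed(3)])
  define w' where "w' = c0 * (sqrt K * sqrt C) + w + C"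
  have w': "w' > 0" using c0 K(1) C_pos w(1) by (auto simp: w'_def intro!: add_pos_pos)
  have big: "\<forall>\<^sub>F n in sequentially. 4 / b \<le> tmax n"
    using tmax_at_top(1)[OF k] by (simp add: filterlim_at_top)
  have sepW: "\<forall>\<^sub>F n in sequentially. (W - ln e * C) / (\<theta> * b) \<le> tmax n * l n 1"
    using sep by (simp add: filterlim_at_top)
  have "\<forall>\<^sub>F n in sequentially. real (mixing_time (dd n) \<delta>) \<le> real (mixing_time (dd n) \<epsilon>) \<and>
      real (mixing_time (dd n) \<epsilon>) \<le> real (mixing_time (dd n) \<delta>) + w' / l n 1"
    using low big sepW eventually_late[OF sep b] eventually_ge_at_top[of 1]
  proof eventually_elim
    case (elim n)
    have n: "n \<ge> 1" by fact
    have l1: "l n 1 > 0" by (rule l1_pos[OF n])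
    define m where "m = mixing_time (dd n) \<delta>"
    have m_low: "b * tmax n \<le> real m" using elim by (simp add: m_def)
    have m4: "4 \<le> real m" using elim(2) m_low b by (simp add: field_simps)
    define t where "t = real m + c0 * sqrt (real m)"
    have mt: "real m \<le> t" using c0(1) by (simp add: t_def)
    have t0: "0 \<le> t" using mt m4 by simp
    \<comment> \<open>The tilting parameter for deviations of order \<open>sqrt m\<close>.\<close>
    define x where "x = 1 / sqrt (real m)"
    have sm: "sqrt (real m) \<ge> 2" using m4 real_le_rsqrt[of 2 "real m"] by simp
    have xs: "x * sqrt (real m) = 1" using m4 by (simp add: x_def)
    have mxx: "real m * x\<^sup>2 = 1" using m4 by (simp add: x_def power_divide)

    have "(\<Sum>j<m. exp (- t) * t ^ j / fact j) \<le> exp (- x * t + real m * (x + 2 * x\<^sup>2))"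
      using sm m4 by (intro poisson_tail t0) (auto simp: x_def field_simps)
    also have "- x * t + real m * (x + 2 * x\<^sup>2) = 2 - c0"
    proof -
      have "- x * t + real m * (x + 2 * x\<^sup>2) = - (real m * x) - c0 * (x * sqrt (real m)) + real m * x + 2 * (real m * x\<^sup>2)"
        by (simp add: t_def algebra_simps)
      then show ?thesis by (simp add: xs mxx)
    qed
    finally have "dc n t \<le> dd n m + (1 - \<delta>) / 2" using dc_le_dd[OF n t0, of m] c0(2) by linarith
    moreover have "dd n m \<le> \<delta>" by (rule dmixing_props(2)[OF n d0]) (simp add: m_def)
    ultimately have dct: "dc n t \<le> \<delta>'" by (simp add: \<delta>'_def field_simps)
    have "C \<le> b * tmax n * l n 1" by fact
    also have "\<dots> \<le> t * l n 1" using m_low mt l1 by (intro mult_right_mono) auto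
    finally have "S n t \<le> - ln (1 - \<delta>') / c" using dct d' by (intro S_le_of_dc n)
    define m' where "m' = nat \<lceil>t + w / l n 1\<rceil>"
    have tw: "0 \<le> t + w / l n 1" using t0 w(1) l1 by simp
    have m': "t + w / l n 1 \<le> real m'" "real m' \<le> t + w / l n 1 + 1" using tw unfolding m'_def by linarith+
    have Sm': "S n (real m') \<le> e" using w(2)[OF n \<open>S n t \<le> _\<close> m'(1)] .
    have "W / l n 1 - \<theta> * real m' \<le> ln e"
    proof -
      have "W - ln e * C \<le> \<theta> * b * (tmax n * l n 1)" using elim(3) theta_pos b by (simp add: field_simps)
      then have "W - ln e * l n 1 \<le> \<theta> * (b * tmax n) * l n 1"
        using mult_left_mono[OF l1_le_C[OF n], of "- ln e"] e by (simp add: mult_ac)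
      also have "\<dots> \<le> \<theta> * real m' * l n 1"
      proof -
        have "b * tmax n \<le> real m'" using m_low mt m'(1) w(1) l1
          by (meson add_increasing2 divide_nonneg_pos less_imp_le order_trans)
        then show ?thesis using theta_pos l1 by (intro mult_right_mono mult_left_mono) auto
      qed
      finally show ?thesis using l1 by (simp add: field_simps)
    qed
    then have "dd n m' \<le> sqrt e" using Sm' e by (intro dd_le n)
    also have "\<dots> \<le> sqrt (\<epsilon>\<^sup>2)" unfolding e_def by (intro real_sqrt_le_mono) simp
    finally have "dd n m' \<le> \<epsilon>" using ed(1) by simp
    then have "mixing_time (dd n) \<epsilon> \<le> m'" by (rule dmixing_props(1)[OF n ed(1)])
    then have "real (mixing_time (dd n) \<epsilon>) \<le> real m + c0 * sqrt (real m) + w / l n 1 + 1"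
      using m'(2) by (simp add: t_def)
    also have "\<dots> \<le> real m + w' / l n 1"
    proof -
      have "sqrt (real m) \<le> sqrt (K * tmax n)" using K(2)[OF n] by (simp add: m_def)
      also have "\<dots> \<le> sqrt K * (sqrt C / l n 1)"
        unfolding real_sqrt_mult using sqrt_tmax[OF n] K(1) by (intro mult_left_mono) auto
      finally have "c0 * sqrt (real m) \<le> c0 * (sqrt K * (sqrt C / l n 1))" using c0(1) by (intro mult_left_mono) auto
      moreover have "1 \<le> C / l n 1" using l1_le_C[OF n] l1 by (simp add: field_simps)
      ultimately show ?thesis by (simp add: w'_def add_divide_distrib)
    qed
    finally have up: "real (mixing_time (dd n) \<epsilon>) \<le> real (mixing_time (dd n) \<delta>) + w' / l n 1"
      by (simp add: m_def)
    have "dd n (mixing_time (dd n) \<epsilon>) \<le> \<epsilon>" by (rule dmixing_props(2)[OF n ed(1) order_refl])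
    then have "mixing_time (dd n) \<delta> \<le> mixing_time (dd n) \<epsilon>"
      using ed(2) by (intro dmixing_props(1)[OF n d0]) auto
    then show ?case using up by simp
  qed
  then show ?thesis using w' by blast
qed

text \<open>As in continuous time.  Rounding costs one step, which is negligible because \<open>tmax n\<close> tends to infinity, and
  \<open>1 - \<Gamma> * l n 1 \<ge> exp (- 2 * \<Gamma> * l n 1)\<close> because \<open>l n 1\<close> tends to zero.\<close>

lemma discrete_precutoff_imp_separated:
  assumes k: "filterlim k at_top sequentially"
    and act1: "\<forall>\<^sub>F n in sequentially. active n 1" and pre: "tv_precutoff dd"
  shows separated
proof (rule ccontr)
  assume "\<not> separated"
  then obtain K where K: "K > 0" "\<exists>\<^sub>F n in sequentially. tmax n * l n 1 < K" using not_separated by blast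
  obtain B B' e :: real and s where B: "0 < B'" "B' < B" "\<forall>n. 0 < s n"
    and lim: "(\<lambda>n. dd n (nat \<lceil>B * s n\<rceil>)) \<longlonglongrightarrow> 0"
    and e: "e > 0" "\<forall>\<^sub>F n in sequentially. dd n (nat \<lfloor>B' * s n\<rfloor>) > e"
    by (rule tv_precutoffE[OF pre])
  obtain a where a: "a > 0" "\<And>n m. n \<ge> 1 \<Longrightarrow> a * tmax n \<le> real m \<Longrightarrow> dd n m \<le> e"
    using dd_small[OF e(1)] by blast
  define R where "R = B / B' * (a + 1) + 1"
  have R: "R > 0" using B a(1) by (auto simp: R_def intro!: add_pos_pos mult_pos_pos divide_pos_pos)
  define z where "z = exp (- (2 * \<Gamma> * (R * K))) / 2"
  have z: "z > 0" by (simp add: z_def)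
  have small: "\<forall>\<^sub>F n in sequentially. l n 1 < 1 / (4 * \<Gamma>)"
    using order_tendstoD(2)[OF tmax_at_top(2)[OF k], of "1 / (4 * \<Gamma>)"] Gamma_pos by simp
  have big: "\<forall>\<^sub>F n in sequentially. 1 \<le> tmax n" using tmax_at_top(1)[OF k] by (simp add: filterlim_at_top)
  have "\<forall>\<^sub>F n in sequentially. dd n (nat \<lceil>B * s n\<rceil>) < z" using order_tendstoD(2)[OF lim z] .
  then have ev: "\<forall>\<^sub>F n in sequentially. K \<le> tmax n * l n 1"
    using e(2) act1 small big eventually_ge_at_top[of 1]
  proof eventually_elim
    case (elim n)
    have n: "n \<ge> 1" by fact
    have sn: "0 < s n" using B(3) by simp
    have "real (nat \<lfloor>B' * s n\<rfloor>) < a * tmax n"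
      using a(2)[OF n, of "nat \<lfloor>B' * s n\<rfloor>"] elim by force
    then have "B' * s n < a * tmax n + 1" using sn B(1) by linarith
    also have "\<dots> \<le> (a + 1) * tmax n" using elim by (simp add: algebra_simps)
    finally have "B / B' * (B' * s n) \<le> B / B' * ((a + 1) * tmax n)"
      using B(1,2) by (intro mult_left_mono) auto
    then have "B * s n \<le> B / B' * (a + 1) * tmax n" using B(1) by (simp add: mult.assoc)
    moreover have "real (nat \<lceil>B * s n\<rceil>) \<le> B * s n + 1"
      using sn B(1,2) by (simp add: of_nat_ceiling)
    ultimately have Bs: "real (nat \<lceil>B * s n\<rceil>) \<le> R * tmax n"
      using elim by (simp add: R_def algebra_simps)
    show ?case
    proof (rule ccontr)
      assume "\<not> ?thesis"
      then have less: "tmax n * l n 1 \<le> K" by simp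
      define m where "m = nat \<lceil>B * s n\<rceil>"
      have y: "0 \<le> \<Gamma> * l n 1" "\<Gamma> * l n 1 \<le> 1 / 2" using elim Gamma_pos l1_pos[OF n] by (auto simp: field_simps)
      have "real m * l n 1 \<le> R * tmax n * l n 1"
        using Bs l1_pos[OF n] unfolding m_def by (intro mult_right_mono) auto
      also have "\<dots> = R * (tmax n * l n 1)" by simp
      also have "\<dots> \<le> R * K" using less R by (intro mult_left_mono) auto
      finally have "2 * \<Gamma> * (real m * l n 1) \<le> 2 * \<Gamma> * (R * K)" using Gamma_pos by (intro mult_left_mono) auto
      then have "z \<le> exp (- (2 * \<Gamma> * (real m * l n 1))) / 2" unfolding z_def by simp
      also have "exp (- (2 * \<Gamma> * (real m * l n 1))) = exp (- (2 * (\<Gamma> * l n 1))) ^ m"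
        by (simp add: exp_of_nat_mult[symmetric] mult_ac)
      also have "\<dots> \<le> (1 - \<Gamma> * l n 1) ^ m"
      proof (rule power_mono)
        have "- (2 * (\<Gamma> * l n 1)) \<le> - (\<Gamma> * l n 1) - 2 * (\<Gamma> * l n 1)\<^sup>2"
          using y mult_left_mono[OF y(2) y(1)] by (simp add: power2_eq_square)
        also have "\<dots> \<le> ln (1 - \<Gamma> * l n 1)" by (rule ln_one_minus_pos_lower_bound[OF y])
        finally show "exp (- (2 * (\<Gamma> * l n 1))) \<le> 1 - \<Gamma> * l n 1"
          using y by (subst ln_ge_iff[symmetric]) auto
      qed simp
      also have "(1 - \<Gamma> * l n 1) ^ m / 2 \<le> dd n m" using elim y(2) by (intro dd_coord n)
      finally show False using elim by (simp add: m_def)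
    qed
  qed
  have "\<exists>\<^sub>F n in sequentially. False"
    using frequently_eventually_frequently[OF K(2) ev] by (rule frequently_elim1) auto
  then show False by simp
qed

theorem discrete_cutoff_equivalences:
  assumes k: "filterlim k at_top sequentially"
    and act1: "\<forall>\<^sub>F n in sequentially. active n 1"
    and act: "\<forall>n\<ge>1. \<forall>i\<in>{1..k n}. m0 \<le> i \<longrightarrow> active n i"
  shows "cutoff_criteria (tv_cutoff dd) (tv_precutoff dd) (\<lambda>n \<epsilon>. real (mixing_time (dd n) \<epsilon>)) tmax (\<lambda>n. l n 1)"
proof (rule cutoff_equivalences)
  show "0 < tmax n \<and> 0 < l n 1" if "n \<ge> 1" for n using tmax_pos l1_pos that by blast
  show "\<exists>K>0. \<forall>n\<ge>1. real (mixing_time (dd n) \<epsilon>) \<le> K * tmax n" if "0 < \<epsilon>" for \<epsilon>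
    by (rule dmixing_upper[OF that])
  show "\<exists>b>0. \<forall>\<^sub>F n in sequentially. b * tmax n \<le> real (mixing_time (dd n) \<epsilon>)"
    if sep: separated and e: "0 < \<epsilon>" "\<epsilon> < 1" for \<epsilon>
    using dmixing_lower[OF k sep act e] Gamma_pos by (intro exI[of _ "1 / (8 * \<Gamma>)"]) simp
  show "\<exists>w>0. \<forall>\<^sub>F n in sequentially. real (mixing_time (dd n) \<delta>) \<le> real (mixing_time (dd n) \<epsilon>) \<and>
      real (mixing_time (dd n) \<epsilon>) \<le> real (mixing_time (dd n) \<delta>) + w / l n 1"
    if sep: separated and ed: "0 < \<epsilon>" "\<epsilon> < \<delta>" "\<delta> < 1" for \<epsilon> \<delta>
    by (rule dmixing_window[OF k sep act ed])
  show "tv_cutoff dd \<longleftrightarrow> (\<exists>\<epsilon>0. 0 < \<epsilon>0 \<and> \<epsilon>0 < 1 \<and> filterlim (\<lambda>n. mixing_time (dd n) \<epsilon>0) at_top sequentially) \<and>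
      (\<forall>\<epsilon> \<delta>. 0 < \<epsilon> \<and> \<epsilon> < 1 \<and> 0 < \<delta> \<and> \<delta> < 1 \<longrightarrow>
        (\<lambda>n. real (mixing_time (dd n) \<epsilon>) / real (mixing_time (dd n) \<delta>)) \<longlonglongrightarrow> 1)"
    by (simp add: tv_cutoff_def)
  show "\<exists>\<epsilon>0. 0 < \<epsilon>0 \<and> \<epsilon>0 < 1 \<and> filterlim (\<lambda>n. mixing_time (dd n) \<epsilon>0) at_top sequentially"
    if sep: separated
  proof (intro exI[of _ "1/2"] conjI)
    have "filterlim (\<lambda>n. 1 / (8 * \<Gamma>) * tmax n) at_top sequentially"
      using Gamma_pos by (intro filterlim_tendsto_pos_mult_at_top[OF tendsto_const _ tmax_at_top(1)[OF k]]) auto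
    then have "filterlim (\<lambda>n. real (mixing_time (dd n) (1/2))) at_top sequentially"
      by (rule filterlim_at_top_mono) (rule dmixing_lower[OF k sep act], auto)
    then show "filterlim (\<lambda>n. mixing_time (dd n) (1/2)) at_top sequentially"
      by (simp add: filterlim_sequentially_iff_filterlim_real)
  qed auto
  show "tv_precutoff dd" if "tv_cutoff dd"
    by (rule cutoff_imp_precutoff[OF dd_antimono dd_nonneg dd_vanishes that])
  show separated if "tv_precutoff dd" by (rule discrete_precutoff_imp_separated[OF k act1 that])
qed

end

section \<open>A bounded number of factors\<close>

context cutoff_array begin

text \<open>If row lengths are bounded then \<open>tmax n\<close> is at most a multiple of \<open>1 / l n 1\<close>, so the slow mode of the first factor
  survives for any multiple of \<open>tmax n\<close>.  For the finitely many rows in which the first factor may be trivial, any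
  active factor serves, with a rate depending on the row.\<close>

theorem bounded_number_of_factors:
  assumes act1: "\<forall>\<^sub>F n in sequentially. active n 1" and Kb: "\<And>n. n \<ge> 1 \<Longrightarrow> real (k n) \<le> Kb"
  shows "\<exists>A' \<sigma>1 \<sigma>2. A' > 0 \<and> \<sigma>2 > \<sigma>1 \<and> \<sigma>1 > 0 \<and>
      (\<forall>a>A'. \<forall>n\<ge>1. ((\<exists>i\<in>{1..k n}. active n i) \<longrightarrow> 1 - exp (- exp (- a * \<sigma>2)) \<le> dc n (a * tmax n)) \<and>
        dc n (a * tmax n) \<le> 1 - exp (- exp (- a * \<sigma>1)))"
    and "\<not> tv_precutoff_c dc"
proof -
  obtain n0 where n0: "\<And>n. n \<ge> n0 \<Longrightarrow> active n 1" using act1 unfolding eventually_sequentially by blast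
  have Kb0: "0 \<le> Kb" using Kb[of 1] k_pos[of 1] by (simp add: order.trans[of 0 "real (k 1)"])
  define b where "b n = \<Gamma> * (tmax n * l n (k n))" for n
  have b0: "0 \<le> b n" if "n \<ge> 1" for n
    using that Gamma_pos tmax_pos[OF that] l_pos[OF that, of "k n"] k_pos[OF that] by (auto simp: b_def)
  \<comment> \<open>One rate for all rows: the sum covers the rows before \<open>n0\<close>.\<close>
  define \<sigma> where "\<sigma> = \<Gamma> * ln (Kb + 1) + (\<Sum>n=1..<n0. b n)"
  have bs: "0 \<le> (\<Sum>n=1..<n0. b n)" by (intro sum_nonneg b0) auto
  have G0: "0 \<le> \<Gamma> * ln (Kb + 1)" using Kb0 Gamma_pos by simp
  have sigma0: "0 \<le> \<sigma>" unfolding \<sigma>_def using bs G0 by simp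
  have low: "exp (- (a * \<sigma>)) / 2 \<le> dc n (a * tmax n)"
    if a: "a \<ge> 0" and n: "n \<ge> 1" and i: "i \<in> {1..k n}" "active n i" for a n i
  proof -
    have "\<exists>j\<in>{1..k n}. active n j \<and> \<Gamma> * (tmax n * l n j) \<le> \<sigma>"
    proof (cases "n \<ge> n0")
      case True
      have "tmax n * l n 1 \<le> ln (real (k n) + 1)" by (rule tmax_l1_le[OF n])
      also have "\<dots> \<le> ln (Kb + 1)" using Kb[OF n] by simp
      finally have "\<Gamma> * (tmax n * l n 1) \<le> \<sigma>"
        unfolding \<sigma>_def using bs Gamma_pos by (intro add_increasing2 mult_left_mono) auto
      then show ?thesis using n0[OF True] k_pos[OF n] by (intro bexI[of _ 1]) auto
    next
      case False
      have "\<Gamma> * (tmax n * l n i) \<le> b n"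
        unfolding b_def using l_mono[OF n, of i "k n"] i(1) tmax_pos[OF n] Gamma_pos
        by (intro mult_left_mono) auto
      also have "\<dots> \<le> (\<Sum>n=1..<n0. b n)"
        using False n b0 by (intro member_le_sum) auto
      also have "\<dots> \<le> \<sigma>" using G0 by (simp add: \<sigma>_def)
      finally show ?thesis using i by blast
    qed
    then obtain j where j: "j \<in> {1..k n}" "active n j" "\<Gamma> * (tmax n * l n j) \<le> \<sigma>" by blast
    have "a * (\<Gamma> * (tmax n * l n j)) \<le> a * \<sigma>" using j(3) a by (rule mult_left_mono)
    then have "exp (- (a * \<sigma>)) / 2 \<le> exp (- (\<Gamma> * (a * tmax n) * l n j)) / 2" by (simp add: mult_ac)
    also have "\<dots> \<le> dc n (a * tmax n)" using a tmax_pos[OF n] by (intro dc_coord n j) auto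
    finally show ?thesis .
  qed
  obtain A' where A': "A' > 0" "\<And>a n. a \<ge> A' \<Longrightarrow> n \<ge> 1 \<Longrightarrow>
      dc n (a * tmax n) \<le> 1 - exp (- exp (- (a * (\<kappa> / 4))))"
    using dc_upper_tmax by blast
  have lower: "1 - exp (- exp (- a * (\<sigma> + 1 + \<kappa> / 4))) \<le> dc n (a * tmax n)"
    if a: "a \<ge> 1" and n: "n \<ge> 1" and i: "i \<in> {1..k n}" "active n i" for a n i
  proof -
    have "1 - exp (- exp (- a * (\<sigma> + 1 + \<kappa> / 4))) \<le> exp (- a * (\<sigma> + 1 + \<kappa> / 4))"
      using exp_ge_add_one_self[of "- exp (- a * (\<sigma> + 1 + \<kappa> / 4))"] by simp
    also have "\<dots> \<le> exp (- (a * \<sigma>) - 1)"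
    proof -
      have "1 \<le> a * (1 + \<kappa> / 4)" using a kappa_pos mult_mono[of 1 a 1 "1 + \<kappa> / 4"] by simp
      then show ?thesis by (simp add: algebra_simps)
    qed
    also have "\<dots> = exp (- (a * \<sigma>)) * exp (- 1)" by (simp add: exp_add[symmetric])
    also have "\<dots> \<le> exp (- (a * \<sigma>)) * (1 / 2)"
    proof (rule mult_left_mono)
      show "exp (- 1) \<le> (1 / 2 :: real)"
        using exp_ge_add_one_self[of "1::real"] by (simp add: exp_minus inverse_eq_divide field_simps)
    qed simp
    also have "\<dots> \<le> dc n (a * tmax n)" using low[OF _ n i, of a] a by simp
    finally show ?thesis .
  qed
  show "\<exists>A' \<sigma>1 \<sigma>2. A' > 0 \<and> \<sigma>2 > \<sigma>1 \<and> \<sigma>1 > 0 \<and>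
      (\<forall>a>A'. \<forall>n\<ge>1. ((\<exists>i\<in>{1..k n}. active n i) \<longrightarrow> 1 - exp (- exp (- a * \<sigma>2)) \<le> dc n (a * tmax n)) \<and>
        dc n (a * tmax n) \<le> 1 - exp (- exp (- a * \<sigma>1)))"
  proof (intro exI conjI allI impI)
    show "max A' 1 > 0" by simp
    show "\<kappa> / 4 < \<sigma> + 1 + \<kappa> / 4" using sigma0 by simp
    show "\<kappa> / 4 > 0" using kappa_pos by simp
    fix a :: real and n :: nat assume a: "a > max A' 1" and n: "n \<ge> 1"
    show "1 - exp (- exp (- a * (\<sigma> + 1 + \<kappa> / 4))) \<le> dc n (a * tmax n)" if "\<exists>i\<in>{1..k n}. active n i"
      using that a n lower[of a n] by auto
    show "dc n (a * tmax n) \<le> 1 - exp (- exp (- a * (\<kappa> / 4)))" using A'(2)[of a n] a n by simp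
  qed
  show "\<not> tv_precutoff_c dc"
  proof
    assume "tv_precutoff_c dc"
    then have separated by (rule precutoff_imp_separated[OF act1])
    then have "\<forall>\<^sub>F n in sequentially. ln (Kb + 1) + 1 \<le> tmax n * l n 1" by (simp add: filterlim_at_top)
    then obtain n where n: "n \<ge> 1" "ln (Kb + 1) + 1 \<le> tmax n * l n 1"
      unfolding eventually_sequentially by (metis nat_le_linear)
    have "tmax n * l n 1 \<le> ln (real (k n) + 1)" by (rule tmax_l1_le[OF n(1)])
    also have "\<dots> \<le> ln (Kb + 1)" using Kb[OF n(1)] by simp
    finally show False using n(2) by simp
  qed
qed

end

section \<open>Products of walks of moderate growth\<close>

lemma symmetric_walk_spectrum:
  fixes G :: "('a, 'b) monoid_scheme" (structure)
  assumes walk: "random_walk G Q" and sym: "symmetric_driver G Q"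
  obtains \<phi> \<beta> where "spectral_walk G Q {..<card (carrier G)} 0 \<phi> \<beta>"
proof -
  interpret random_walk G Q by (rule walk)
  let ?N = "card (carrier G)"
  have ne: "carrier G \<noteq> {}" using one_closed by blast
  have N: "?N > 0" using finite_carrier ne by (simp add: card_gt_0_iff)
  have tsym: "transition G Q x y = transition G Q y x" if xy: "x \<in> carrier G" "y \<in> carrier G" for x y
  proof -
    have "inv (inv x \<otimes> y) = inv y \<otimes> x" using xy by (simp add: inv_mult_group)
    moreover have "pmf Q (inv x \<otimes> y) = pmf Q (inv (inv x \<otimes> y))"
      using sym xy unfolding symmetric_driver_def by blast
    ultimately show ?thesis by (simp add: transition_def)
  qed
  have col: "(\<Sum>x\<in>carrier G. transition G Q x y) = 1" if y: "y \<in> carrier G" for y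
  proof -
    have cancel: "y \<otimes> (inv y \<otimes> a) = a" if "a \<in> carrier G" for a
      using that y by (simp add: m_assoc[symmetric])
    have "(\<Sum>x\<in>carrier G. transition G Q x y) = (\<Sum>s\<in>carrier G. pmf Q s)"
      unfolding transition_def using y
      by (intro sum.reindex_bij_witness[where i = "\<lambda>s. y \<otimes> inv s" and j = "\<lambda>x. inv x \<otimes> y"])
         (auto simp: m_assoc inv_mult_group cancel)
    also have "\<dots> = 1" using finite_carrier support_subset by (rule sum_pmf_eq_1)
    finally show ?thesis .
  qed
  have f1: "(\<Sum>x\<in>carrier G. 1 / sqrt ?N * (1 / sqrt ?N)) = 1" using N by simp
  have f2: "(\<Sum>x\<in>carrier G. 1 / sqrt ?N * transition G Q x y) = 1 * (1 / sqrt ?N)" if "y \<in> carrier G" for y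
    using col[OF that] by (simp add: sum_divide_distrib[symmetric])
  obtain \<phi> \<beta> where *: "eigenbasis (carrier G) (transition G Q) {..<?N} \<phi> \<beta>"
      "\<phi> 0 = (\<lambda>_. 1 / sqrt ?N)" "\<beta> 0 = 1"
    by (rule symmetric_eigenbasis[OF finite_carrier ne tsym f1 f2])
  have "spectral_walk G Q {..<?N} 0 \<phi> \<beta>"
    by unfold_locales (use finite_carrier support_subset * N in auto)
  then show thesis by (rule that)
qed

text \<open>The summand \<open>1\<close> makes positivity evident.\<close>

definition trace_const :: "real \<Rightarrow> real \<Rightarrow> nat \<Rightarrow> real" where
  "trace_const A \<eta> D = 1 + (\<Sum>s. trace_term A \<eta> D s)"

definition gap_const :: "real \<Rightarrow> nat \<Rightarrow> real" where
  "gap_const A D = 200 + 64 * A\<^sup>2 * (32 ^ D)\<^sup>2"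

text \<open>One row of the array.  The estimates below verify the hypotheses of \<open>cutoff_array\<close> and \<open>discrete_cutoff_array\<close>,
  with constants that depend on \<open>A\<close>, \<open>\<eta>\<close>, \<open>D\<close> and \<open>C\<close> only.\<close>

locale growing_product = product_walk "{1..K}" G Q J j0 \<phi> \<beta> r
  for K :: nat and G :: "nat \<Rightarrow> ('a, 'b) monoid_scheme" and Q :: "nat \<Rightarrow> 'a pmf"
    and J :: "nat \<Rightarrow> 'j set" and j0 \<phi> \<beta> r +
  fixes A \<eta> :: real and D :: nat and C :: real and l :: "nat \<Rightarrow> real"
  assumes walk: "\<And>i. i \<in> {1..K} \<Longrightarrow> growing_walk (G i) (Q i) (J i) (j0 i) (\<phi> i) (\<beta> i) A \<eta> D"
    and K_pos: "1 \<le> K" and r_pos: "\<And>i. i \<in> {1..K} \<Longrightarrow> 0 < r i"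
    and C_gt_1: "1 < C" and eta_le: "\<eta> \<le> 1 / 2"
    and l_pos: "\<And>i. i \<in> {1..K} \<Longrightarrow> 0 < l i" and l1_le: "\<And>i. i \<in> {1..K} \<Longrightarrow> l 1 \<le> l i"
    and approx: "\<And>i. i \<in> {1..K} \<Longrightarrow> l i / C \<le> r i / (real (group_diameter (G i) (set_pmf (Q i))))\<^sup>2"
      "\<And>i. i \<in> {1..K} \<Longrightarrow> r i / (real (group_diameter (G i) (set_pmf (Q i))))\<^sup>2 \<le> C * l i"
begin

abbreviation "\<rho> i \<equiv> real (group_diameter (G i) (set_pmf (Q i)))"

lemma rho_ge_1: "i \<in> {1..K} \<Longrightarrow> 1 \<le> \<rho> i"
proof -
  assume i: "i \<in> {1..K}"
  interpret F: growing_walk "G i" "Q i" "J i" "j0 i" "\<phi> i" "\<beta> i" A \<eta> D by (rule walk[OF i])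
  show ?thesis using F.rho_ge_1 by simp
qed

lemma one_in: "1 \<in> {1..K}" using K_pos by simp

lemma const_pos: "0 < \<eta>" "0 < A" "0 < trace_const A \<eta> D"
proof -
  interpret F: growing_walk "G 1" "Q 1" "J 1" "j0 1" "\<phi> 1" "\<beta> 1" A \<eta> D by (rule walk[OF one_in])
  show "0 < \<eta>" "0 < A" using F.eta_pos F.A_pos by auto
  have "0 \<le> (\<Sum>s. trace_term A \<eta> D s)"
    using F.eta_pos F.A_pos by (intro suminf_nonneg summable_trace_term) (auto simp: trace_term_def)
  then show "0 < trace_const A \<eta> D" by (simp add: trace_const_def)
qed

text \<open>The condition \<open>C \<le> t * l i\<close> makes the time \<open>r i * t\<close> of the factor at least \<open>\<rho>\<^sup>2\<close>.\<close>

lemma trace_le: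
  assumes i: "i \<in> {1..K}" and t: "C \<le> t * l i"
  shows "(\<Sum>j\<in>J i. exp (- (r i * t * (1 - \<beta> i j)))) \<le> trace_const A \<eta> D" and "0 \<le> t"
proof -
  interpret F: growing_walk "G i" "Q i" "J i" "j0 i" "\<phi> i" "\<beta> i" A \<eta> D by (rule walk[OF i])
  have "0 < t * l i" using t C_gt_1 by simp
  then show t0: "0 \<le> t" using l_pos[OF i] by (simp add: zero_less_mult_iff)
  have "1 \<le> t * (l i / C)" using t C_gt_1 by (simp add: field_simps)
  also have "\<dots> \<le> t * (r i / (\<rho> i)\<^sup>2)" using approx(1)[OF i] t0 by (rule mult_left_mono)
  finally have "(\<rho> i)\<^sup>2 \<le> r i * t" using rho_ge_1[OF i] by (simp add: field_simps)
  from F.heat_trace_le[OF this] show "(\<Sum>j\<in>J i. exp (- (r i * t * (1 - \<beta> i j)))) \<le> trace_const A \<eta> D"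
    by (simp add: F.decay_def trace_const_def)
qed

lemma chi2_bound:
  assumes i: "i \<in> {1..K}" and t: "C \<le> t * l i"
  shows "chi2 i t \<le> trace_const A \<eta> D"
proof -
  interpret F: growing_walk "G i" "Q i" "J i" "j0 i" "\<phi> i" "\<beta> i" A \<eta> D by (rule walk[OF i])
  have t0: "0 \<le> t" by (rule trace_le(2)[OF i t])
  have "chi2 i t \<le> (\<Sum>j\<in>J i. exp (- (r i * t * (1 - \<beta> i j))))"
    unfolding chi2_def
  proof (rule order.trans[OF sum_mono sum_mono2])
    fix j assume j: "j \<in> J i - {j0 i}"
    define z where "z = r i * t * (1 - \<beta> i j)"
    have "0 \<le> z" using r_pos[OF i] t0 F.beta_le_1[of j] j by (simp add: z_def)
    moreover have "2 * (r i * t) * (1 - \<beta> i j) = 2 * z" by (simp add: z_def)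
    ultimately show "exp (- (2 * (r i * t) * (1 - \<beta> i j))) \<le> exp (- (r i * t * (1 - \<beta> i j)))"
      by (simp only: z_def[symmetric] exp_le_cancel_iff)
  qed (use F.finite_J in auto)
  also have "\<dots> \<le> trace_const A \<eta> D" by (rule trace_le(1)[OF i t])
  finally show ?thesis .
qed

lemma chi2_decay:
  assumes i: "i \<in> {1..K}" and s: "0 \<le> s"
  shows "chi2 i (t + s) \<le> exp (- (\<eta> / C * s * l i)) * chi2 i t"
  unfolding chi2_def sum_distrib_left
proof (rule sum_mono)
  fix j assume j: "j \<in> J i - {j0 i}"
  interpret F: growing_walk "G i" "Q i" "J i" "j0 i" "\<phi> i" "\<beta> i" A \<eta> D by (rule walk[OF i])
  have "\<eta> / C * s * l i = \<eta> * s * (l i / C)" by simp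
  also have "\<dots> \<le> \<eta> * s * (r i / (\<rho> i)\<^sup>2)"
    using approx(1)[OF i] s const_pos by (intro mult_left_mono) auto
  also have "\<dots> = 2 * (r i * s) * (\<eta> / (2 * (\<rho> i)\<^sup>2))" by simp
  also have "\<dots> \<le> 2 * (r i * s) * (1 - \<beta> i j)"
    using F.spectral_gap[OF j] r_pos[OF i] s by (intro mult_left_mono) auto
  finally have "exp (- (2 * (r i * t) * (1 - \<beta> i j))) * exp (- (2 * (r i * s) * (1 - \<beta> i j))) \<le>
      exp (- (2 * (r i * t) * (1 - \<beta> i j))) * exp (- (\<eta> / C * s * l i))"
    by (intro mult_left_mono) auto
  also have "exp (- (2 * (r i * t) * (1 - \<beta> i j))) * exp (- (2 * (r i * s) * (1 - \<beta> i j))) =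
      exp (- (2 * (r i * (t + s)) * (1 - \<beta> i j)))"
    by (simp add: exp_add[symmetric] algebra_simps)
  finally show "exp (- (2 * (r i * (t + s)) * (1 - \<beta> i j))) \<le>
      exp (- (\<eta> / C * s * l i)) * exp (- (2 * (r i * t) * (1 - \<beta> i j)))" by (simp add: mult.commute)
qed

lemma slow_mode:
  assumes i: "i \<in> {1..K}" and act: "card (carrier (G i)) > 1"
  obtains j where "j \<in> J i - {j0 i}" "0 \<le> r i * (1 - \<beta> i j)" "r i * (1 - \<beta> i j) \<le> gap_const A D * C * l i"
proof -
  interpret F: growing_walk "G i" "Q i" "J i" "j0 i" "\<phi> i" "\<beta> i" A \<eta> D by (rule walk[OF i])
  obtain j where j: "j \<in> J i - {j0 i}" "(1 - \<beta> i j) * (\<rho> i)\<^sup>2 \<le> gap_const A D"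
    using F.small_eigenvalue[OF act] unfolding gap_const_def by blast
  have nn: "0 \<le> r i * (1 - \<beta> i j)" using r_pos[OF i] F.beta_le_1[of j] j by simp
  have "r i * (1 - \<beta> i j) = (r i / (\<rho> i)\<^sup>2) * ((1 - \<beta> i j) * (\<rho> i)\<^sup>2)"
    using rho_ge_1[OF i] by simp
  also have "\<dots> \<le> (C * l i) * gap_const A D"
    using approx(2)[OF i] j r_pos[OF i] F.beta_le_1[of j] l_pos[OF i] C_gt_1
    by (intro mult_mono) auto
  finally show thesis using that[OF j(1) nn] by (simp add: mult_ac)
qed

lemma chi2_lower:
  assumes i: "i \<in> {1..K}" and act: "card (carrier (G i)) > 1" and t: "0 \<le> t"
  shows "exp (- (2 * gap_const A D * C * t * l i)) \<le> chi2 i t"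
proof -
  interpret F: growing_walk "G i" "Q i" "J i" "j0 i" "\<phi> i" "\<beta> i" A \<eta> D by (rule walk[OF i])
  obtain j where j: "j \<in> J i - {j0 i}" "r i * (1 - \<beta> i j) \<le> gap_const A D * C * l i"
    using slow_mode[OF i act] by metis
  have "(2 * t) * (r i * (1 - \<beta> i j)) \<le> (2 * t) * (gap_const A D * C * l i)"
    using j(2) t by (intro mult_left_mono) auto
  then have "exp (- (2 * gap_const A D * C * t * l i)) \<le> exp (- (2 * (r i * t) * (1 - \<beta> i j)))"
    by (simp add: mult_ac)
  also have "\<dots> \<le> chi2 i t"
    unfolding chi2_def using F.finite_J by (intro member_le_sum[OF j(1)]) auto
  finally show ?thesis .
qed

lemma tv_c_lower_coordinate:
  assumes i: "i \<in> {1..K}" and act: "card (carrier (G i)) > 1" and t: "0 \<le> t"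
  shows "exp (- (2 * gap_const A D * C * t * l i)) / 2 \<le>
    tv_c (product_group {1..K} G) (product_driver {1..K} r G Q) t"
proof -
  obtain j where j: "j \<in> J i - {j0 i}" "0 \<le> r i * (1 - \<beta> i j)" "r i * (1 - \<beta> i j) \<le> gap_const A D * C * l i"
    by (rule slow_mode[OF i act])
  have "t * (r i * (1 - \<beta> i j)) \<le> 2 * (t * (gap_const A D * C * l i))"
    using mult_left_mono[OF j(3) t] mult_nonneg_nonneg[OF t order.trans[OF j(2,3)]] by linarith
  then have "exp (- (2 * gap_const A D * C * t * l i)) / 2 \<le> exp (- (r i * t * (1 - \<beta> i j))) / 2"
    by (simp add: mult_ac)
  also have "\<dots> \<le> tv_c (product_group {1..K} G) (product_driver {1..K} r G Q) t"
    by (rule tv_c_coordinate_lower[OF i j(1)])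
  finally show ?thesis .
qed

lemma tv_lower_coordinate:
  assumes act: "card (carrier (G 1)) > 1" and small: "2 * gap_const A D * C * l 1 \<le> 1 / 2"
  shows "(1 - 2 * gap_const A D * C * l 1) ^ m / 2 \<le>
    tv (product_group {1..K} G) (product_driver {1..K} r G Q) m"
proof -
  obtain j where j: "j \<in> J 1 - {j0 1}" "0 \<le> r 1 * (1 - \<beta> 1 j)" "r 1 * (1 - \<beta> 1 j) \<le> gap_const A D * C * l 1"
    by (rule slow_mode[OF one_in act])
  have "(1 - 2 * gap_const A D * C * l 1) ^ m \<le> \<bar>1 - r 1 * (1 - \<beta> 1 j)\<bar> ^ m"
    using small j(2,3) by (intro power_mono) linarith+
  then show ?thesis using tv_coordinate_lower[OF one_in j(1), of m] by linarith
qed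

text \<open>As \<open>\<rho> i \<ge> 1\<close>, each \<open>l i\<close> is at most \<open>C * r i\<close>, and the \<open>r i\<close> sum to one.\<close>

lemma sum_l_le: "real K * l 1 \<le> C"
proof -
  have "real K * l 1 = (\<Sum>i\<in>{1..K}. l 1)" by simp
  also have "\<dots> \<le> (\<Sum>i\<in>{1..K}. C * r i)"
  proof (rule sum_mono)
    fix i assume i: "i \<in> {1..K}"
    have "r i / (\<rho> i)\<^sup>2 \<le> r i / 1"
      using rho_ge_1[OF i] r_pos[OF i] by (intro divide_left_mono) (auto simp: one_le_power)
    then have "l i / C \<le> r i" using approx(1)[OF i] by simp
    then show "l 1 \<le> C * r i" using l1_le[OF i] C_gt_1 by (simp add: field_simps)
  qed
  also have "\<dots> = C" using r_sum by (simp add: sum_distrib_left[symmetric])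
  finally show ?thesis .
qed

text \<open>Each factor has order at most polynomial in \<open>\<rho> i\<close>, hence at most exponential in
  \<open>(\<rho> i)\<^sup>2 \<le> C * r i / l 1\<close>.\<close>

lemma card_product_le:
  "(\<Prod>i\<in>{1..K}. real (card (carrier (G i)))) \<le> exp ((A / \<eta> + real D) * C / l 1)"
proof -
  define w where "w = A / \<eta> + real D"
  have w0: "0 \<le> w" using const_pos by (simp add: w_def)
  have "(\<Prod>i\<in>{1..K}. real (card (carrier (G i)))) \<le> (\<Prod>i\<in>{1..K}. exp (w * C / l 1 * r i))"
  proof (intro prod_mono conjI)
    fix i assume i: "i \<in> {1..K}"
    interpret F: growing_walk "G i" "Q i" "J i" "j0 i" "\<phi> i" "\<beta> i" A \<eta> D by (rule walk[OF i])
    have rho: "1 \<le> \<rho> i" by (rule rho_ge_1[OF i])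
    have rho2: "1 \<le> (\<rho> i)\<^sup>2" using rho by (simp add: one_le_power)
    have "real (card (carrier (G i))) \<le> A / \<eta> * \<rho> i ^ D" using F.N_le by simp
    also have "\<dots> \<le> exp (A / \<eta> * (\<rho> i)\<^sup>2) * exp (real D * (\<rho> i)\<^sup>2)"
    proof (rule mult_mono)
      have "A / \<eta> * 1 \<le> A / \<eta> * (\<rho> i)\<^sup>2" using rho2 const_pos by (intro mult_left_mono) auto
      also have "\<dots> \<le> exp (A / \<eta> * (\<rho> i)\<^sup>2)" using exp_ge_add_one_self[of "A / \<eta> * (\<rho> i)\<^sup>2"] by linarith
      finally show "A / \<eta> \<le> exp (A / \<eta> * (\<rho> i)\<^sup>2)" by simp
      have "\<rho> i \<le> (\<rho> i)\<^sup>2" using rho by (simp add: power2_eq_square)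
      also have "\<dots> \<le> exp ((\<rho> i)\<^sup>2)" using exp_ge_add_one_self[of "(\<rho> i)\<^sup>2"] by linarith
      finally have "\<rho> i ^ D \<le> exp ((\<rho> i)\<^sup>2) ^ D" by (intro power_mono) auto
      then show "\<rho> i ^ D \<le> exp (real D * (\<rho> i)\<^sup>2)" by (simp add: exp_of_nat_mult)
    qed auto
    also have "\<dots> = exp (w * (\<rho> i)\<^sup>2)" by (simp add: exp_add[symmetric] w_def algebra_simps)
    also have "\<dots> \<le> exp (w * C / l 1 * r i)"
    proof -
      have "l 1 * (\<rho> i)\<^sup>2 \<le> l i * (\<rho> i)\<^sup>2" using l1_le[OF i] by (intro mult_right_mono) auto
      also have "\<dots> \<le> C * r i"
      proof -
        have "0 < (\<rho> i)\<^sup>2" using rho2 by linarith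
        moreover have "l i \<le> C * r i / (\<rho> i)\<^sup>2" using approx(1)[OF i] C_gt_1 by (simp add: field_simps)
        ultimately show ?thesis by (simp only: pos_le_divide_eq)
      qed
      finally have "(\<rho> i)\<^sup>2 \<le> C * r i / l 1" using l_pos[OF one_in] by (simp add: field_simps)
      from mult_left_mono[OF this w0] show ?thesis by (simp add: mult_ac)
    qed
    finally show "real (card (carrier (G i))) \<le> exp (w * C / l 1 * r i)" .
  qed auto
  also have "\<dots> = exp (w * C / l 1 * (\<Sum>i\<in>{1..K}. r i))"
    by (simp add: exp_sum[symmetric] sum_distrib_left)
  finally show ?thesis using r_sum by (simp add: w_def)
qed

lemma tv_upper_lazy:
  assumes lazy: "\<And>i. i \<in> {1..K} \<Longrightarrow> \<one>\<^bsub>G i\<^esub> \<in> set_pmf (Q i)"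
  shows "tv (product_group {1..K} G) (product_driver {1..K} r G Q) m \<le>
    sqrt (exp (\<Sum>i\<in>{1..K}. chi2 i (real m)) - 1 + exp ((A / \<eta> + real D) * C / l 1 - 4 * \<eta> * real m)) / 2"
proof -
  have low: "2 * \<eta> - 1 \<le> \<beta> i j" if i: "i \<in> {1..K}" and j: "j \<in> J i" for i j
  proof -
    interpret F: growing_walk "G i" "Q i" "J i" "j0 i" "\<phi> i" "\<beta> i" A \<eta> D by (rule walk[OF i])
    show ?thesis using F.beta_lower[OF j] F.eta_le[OF lazy[OF i]] by linarith
  qed
  have "(1 - 2 * \<eta>) ^ (2 * m) \<le> exp (- (2 * \<eta>)) ^ (2 * m)"
    using exp_ge_add_one_self[of "- (2 * \<eta>)"] eta_le by (intro power_mono) auto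
  also have "\<dots> = exp (- (4 * \<eta> * real m))" by (simp add: exp_of_nat_mult[symmetric])
  finally have p: "(1 - 2 * \<eta>) ^ (2 * m) \<le> exp (- (4 * \<eta> * real m))" .
  have "(\<Prod>i\<in>{1..K}. real (card (carrier (G i)))) * (1 - 2 * \<eta>) ^ (2 * m) \<le>
      exp ((A / \<eta> + real D) * C / l 1) * exp (- (4 * \<eta> * real m))"
    using eta_le by (intro mult_mono card_product_le p) auto
  also have "\<dots> = exp ((A / \<eta> + real D) * C / l 1 - 4 * \<eta> * real m)"
    by (simp add: exp_add[symmetric])
  finally have "exp (\<Sum>i\<in>{1..K}. chi2 i (real m)) - 1 + (\<Prod>i\<in>{1..K}. real (card (carrier (G i)))) * (1 - 2 * \<eta>) ^ (2 * m)
      \<le> exp (\<Sum>i\<in>{1..K}. chi2 i (real m)) - 1 + exp ((A / \<eta> + real D) * C / l 1 - 4 * \<eta> * real m)"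
    by simp
  then show ?thesis using tv_product_upper[OF low, of m]
    by (meson divide_right_mono order.trans real_sqrt_le_mono zero_le_numeral)
qed

lemma tv_c_lower_l2:
  assumes t: "C \<le> t * l 1"
  shows "1 - tv_c (product_group {1..K} G) (product_driver {1..K} r G Q) t \<le>
    exp (- (1 / (2 * (sqrt (trace_const A \<eta> D) + 1)\<^sup>2) * (\<Sum>i\<in>{1..K}. chi2 i t)))"
proof -
  have t0: "0 \<le> t" by (rule trace_le(2)[OF one_in t])
  have "C \<le> t * l i" if i: "i \<in> {1..K}" for i
    using t mult_left_mono[OF l1_le[OF i] t0] by linarith
  from tv_c_product_lower[OF t0 trace_le(1)[OF _ this]] show ?thesis by simp
qed

end

section \<open>Cutoff for products of random walks of moderate growth\<close>

lemma (in growing_walk) nontrivial_if_diameter: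
  assumes "\<rho> \<ge> 2" shows "card (carrier G) > 1"
proof (rule ccontr)
  assume "\<not> card (carrier G) > 1"
  then have "card (carrier G) = 1" using N_pos by simp
  then obtain x where x: "carrier G = {x}" by (auto simp: card_1_singleton_iff)
  then have "E = carrier G" using support_subset E_ne by auto
  then have "set_pow G E 1 = carrier G" using set_pow_one[OF support_subset] by simp
  then have "\<rho> \<le> 1" by (intro rho_le) auto
  then show False using assms by simp
qed

lemma moderate_growth_power:
  assumes fin: "finite (carrier G)" and grp: "group G" and A: "A > 0"
    and mg: "moderate_growth A d G E" and D: "d \<le> real D"
    and m: "1 \<le> m" "m \<le> group_diameter G E"
  shows "(real m / real (group_diameter G E)) ^ D * card (carrier G) \<le> A * card (set_pow G E m)"
proof -
  interpret group G by (rule grp)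
  let ?\<rho> = "group_diameter G E"
  have gen: "generating_set G E" using mg by (simp add: moderate_growth_def)
  note full = group_diameter_props(2)[OF fin gen]
  have N: "card (carrier G) > 0" using fin one_closed by (auto simp: card_gt_0_iff)
  define x where "x = real m / real ?\<rho>"
  have x: "0 < x" "x \<le> 1" using m by (auto simp: x_def)
  have "x ^ D = x powr real D" using x by (simp add: powr_realpow)
  also have "\<dots> \<le> x powr d" using x D by (intro powr_mono') auto
  also have "\<dots> = A * (1 / A * x powr d)" using A by simp
  also have "\<dots> \<le> A * (real (card (set_pow G E m)) / real (card (carrier G)))"
    using mg m A full unfolding moderate_growth_def x_def by (intro mult_left_mono) auto
  finally show ?thesis using N by (simp add: x_def field_simps)
qed

theorem theorem2p3:
  fixes k :: "nat \<Rightarrow> nat"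
    and G :: "nat \<Rightarrow> nat \<Rightarrow> 'a monoid"
    and Q :: "nat \<Rightarrow> nat \<Rightarrow> 'a pmf"
    and p :: "nat \<Rightarrow> nat \<Rightarrow> real"
    and l :: "nat \<Rightarrow> nat \<Rightarrow> real"
    and A d C :: real
  defines "q \<equiv> \<lambda>n. \<Sum>i=1..k n. p n i"
    and "E \<equiv> \<lambda>n i. set_pmf (Q n i)"
  defines "\<rho> \<equiv> \<lambda>n i. group_diameter (G n i) (E n i)"
  defines "dc \<equiv> \<lambda>n. tv_c (product_group {1..k n} (G n))
                       (product_driver {1..k n} (\<lambda>i. p n i / q n) (G n) (Q n))"
    and "dd \<equiv> \<lambda>n. tv (product_group {1..k n} (G n))
                     (product_driver {1..k n} (\<lambda>i. p n i / q n) (G n) (Q n))"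
    and "t \<equiv> \<lambda>n. Max ((\<lambda>i. ln (real i + 1) / l n i) ` {1..k n})"
  assumes k_pos: "\<forall>n\<ge>1. k n \<ge> 1"
    and walks: "\<forall>n\<ge>1. \<forall>i\<in>{1..k n}. random_walk (G n i) (Q n i)"
    and p_pos: "\<forall>n\<ge>1. \<forall>i\<in>{1..k n}. p n i > 0"
    and symmetric: "\<forall>n\<ge>1. \<forall>i\<in>{1..k n}. symmetric_driver (G n i) (Q n i)"
    and inf_pos: "Inf {pmf (Q n i) x | n i x. n \<ge> 1 \<and> i \<in> {1..k n} \<and> x \<in> E n i} > 0"
    and A_pos: "A > 0"
    and growth: "\<forall>n\<ge>1. \<forall>i\<in>{1..k n}. moderate_growth A d (G n i) (E n i)"
    and rho_1: "\<forall>\<^sub>F n in sequentially. \<rho> n 1 \<ge> 4"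
    and C_gt_1: "C > 1"
    and l_pos: "\<forall>n\<ge>1. \<forall>i\<in>{1..k n}. l n i > 0"
    and l_mono: "\<forall>n\<ge>1. \<forall>i\<ge>1. i + 1 \<le> k n \<longrightarrow> l n i \<le> l n (i + 1)"
    and l_approx: "\<forall>n\<ge>1. \<forall>i\<in>{1..k n}.
            l n i / C \<le> p n i / (q n * (real (\<rho> n i))\<^sup>2) \<and>
            p n i / (q n * (real (\<rho> n i))\<^sup>2) \<le> C * l n i"
  shows
    "((\<lambda>n. real (k n)) \<in> O(\<lambda>n. 1) \<longrightarrow>
        (\<exists>A' \<sigma>1 \<sigma>2. A' > 0 \<and> \<sigma>2 > \<sigma>1 \<and> \<sigma>1 > 0 \<and>
           (\<forall>a>A'. \<forall>n\<ge>1.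
              ((\<exists>i\<in>{1..k n}. card (carrier (G n i)) > 1) \<longrightarrow>
                 1 - exp (- exp (- a * \<sigma>2)) \<le> dc n (a * t n)) \<and>
              dc n (a * t n) \<le> 1 - exp (- exp (- a * \<sigma>1)))) \<and>
        \<not> tv_precutoff_c dc)
     \<and>
     (filterlim k at_top sequentially \<and>
      (\<forall>\<^sub>F m in sequentially. \<forall>n\<ge>1. \<forall>i\<in>{1..k n}. i \<ge> m \<longrightarrow> \<rho> n i \<ge> 4) \<longrightarrow>
        ((tv_cutoff_c dc \<longleftrightarrow> tv_precutoff_c dc) \<and>
         (tv_cutoff_c dc \<longleftrightarrow> filterlim (\<lambda>n. t n * l n 1) at_top sequentially) \<and>
         (tv_cutoff_c dc \<longleftrightarrow>
            (\<forall>\<epsilon>. 0 < \<epsilon> \<and> \<epsilon> < 1 \<longrightarrow>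
               filterlim (\<lambda>n. mixing_time_c (dc n) \<epsilon> * l n 1) at_top sequentially)) \<and>
         (tv_cutoff_c dc \<longleftrightarrow>
            (\<exists>\<epsilon>. 0 < \<epsilon> \<and> \<epsilon> < 1 \<and>
               filterlim (\<lambda>n. mixing_time_c (dc n) \<epsilon> * l n 1) at_top sequentially)) \<and>
         (tv_cutoff_c dc \<longrightarrow>
            (\<forall>\<epsilon> \<delta>. 0 < \<epsilon> \<and> \<epsilon> < \<delta> \<and> \<delta> < 1 \<longrightarrow>
               (\<lambda>n. mixing_time_c (dc n) \<epsilon>) \<in> \<Theta>(t) \<and>
               (\<lambda>n. mixing_time_c (dc n) \<epsilon> - mixing_time_c (dc n) \<delta>) \<in> O(\<lambda>n. 1 / l n 1)))))
     \<and>
     ((\<forall>n\<ge>1. \<forall>i\<in>{1..k n}. \<one>\<^bsub>G n i\<^esub> \<in> E n i) \<and>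
      filterlim k at_top sequentially \<and>
      (\<forall>\<^sub>F m in sequentially. \<forall>n\<ge>1. \<forall>i\<in>{1..k n}. i \<ge> m \<longrightarrow> \<rho> n i \<ge> 4) \<longrightarrow>
        ((tv_cutoff dd \<longleftrightarrow> tv_precutoff dd) \<and>
         (tv_cutoff dd \<longleftrightarrow> filterlim (\<lambda>n. t n * l n 1) at_top sequentially) \<and>
         (tv_cutoff dd \<longleftrightarrow>
            (\<forall>\<epsilon>. 0 < \<epsilon> \<and> \<epsilon> < 1 \<longrightarrow>
               filterlim (\<lambda>n. real (mixing_time (dd n) \<epsilon>) * l n 1) at_top sequentially)) \<and>
         (tv_cutoff dd \<longleftrightarrow>
            (\<exists>\<epsilon>. 0 < \<epsilon> \<and> \<epsilon> < 1 \<and>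
               filterlim (\<lambda>n. real (mixing_time (dd n) \<epsilon>) * l n 1) at_top sequentially)) \<and>
         (tv_cutoff dd \<longrightarrow>
            (\<forall>\<epsilon> \<delta>. 0 < \<epsilon> \<and> \<epsilon> < \<delta> \<and> \<delta> < 1 \<longrightarrow>
               (\<lambda>n. real (mixing_time (dd n) \<epsilon>)) \<in> \<Theta>(t) \<and>
               (\<lambda>n. real (mixing_time (dd n) \<epsilon>) - real (mixing_time (dd n) \<delta>))
                  \<in> O(\<lambda>n. 1 / l n 1)))))"
proof -
  let ?P = "{pmf (Q n i) x | n i x. n \<ge> 1 \<and> i \<in> {1..k n} \<and> x \<in> E n i}"
  \<comment> \<open>The minimum with \<open>1 / 2\<close> keeps \<open>1 - 2 \<eta>\<close> nonnegative.\<close>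
  define \<eta> where "\<eta> = min (Inf ?P) (1 / 2)"
  have eta: "0 < \<eta>" "\<eta> \<le> 1 / 2" using inf_pos by (auto simp: \<eta>_def)
  have eta_le: "\<eta> \<le> pmf (Q n i) x" if "n \<ge> 1" "i \<in> {1..k n}" "x \<in> set_pmf (Q n i)" for n i x
  proof -
    have "Inf ?P \<le> pmf (Q n i) x"
      using that by (intro cInf_lower bdd_belowI[of _ 0]) (auto simp: E_def)
    then show ?thesis by (simp add: \<eta>_def)
  qed
  define D where "D = nat \<lceil>d\<rceil>"
  have D: "d \<le> real D" unfolding D_def by linarith
  define J where "J = (\<lambda>n i. {..<card (carrier (G n i))})"
  have "\<forall>n i. \<exists>f. n \<ge> 1 \<and> i \<in> {1..k n} \<longrightarrow> spectral_walk (G n i) (Q n i) (J n i) 0 (fst f) (snd f)"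
  proof (intro allI)
    fix n i
    show "\<exists>f. n \<ge> 1 \<and> i \<in> {1..k n} \<longrightarrow> spectral_walk (G n i) (Q n i) (J n i) 0 (fst f) (snd f)"
    proof (cases "n \<ge> 1 \<and> i \<in> {1..k n}")
      case True
      then obtain \<phi> \<beta> where "spectral_walk (G n i) (Q n i) (J n i) 0 \<phi> \<beta>"
        using symmetric_walk_spectrum[of "G n i" "Q n i"] walks symmetric unfolding J_def by blast
      then show ?thesis by (intro exI[of _ "(\<phi>, \<beta>)"]) simp
    qed blast
  qed
  then obtain F where F: "\<And>n i. n \<ge> 1 \<Longrightarrow> i \<in> {1..k n} \<Longrightarrow>
      spectral_walk (G n i) (Q n i) (J n i) 0 (fst (F n i)) (snd (F n i))"
    by metis
  define \<phi> where "\<phi> = (\<lambda>n i. fst (F n i))"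
  define \<beta> where "\<beta> = (\<lambda>n i. snd (F n i))"
  define r where "r = (\<lambda>n i. p n i / q n)"
  have walk: "growing_walk (G n i) (Q n i) (J n i) 0 (\<phi> n i) (\<beta> n i) A \<eta> D"
    if ni: "n \<ge> 1" "i \<in> {1..k n}" for n i
  proof -
    interpret random_walk "G n i" "Q n i" using walks ni by blast
    have mg: "moderate_growth A d (G n i) (set_pmf (Q n i))" using growth ni by (auto simp: E_def)
    show ?thesis
      unfolding growing_walk_def growing_walk_axioms_def \<phi>_def \<beta>_def
    proof (intro conjI allI impI F[OF ni])
      show "symmetric_driver (G n i) (Q n i)" using symmetric ni by blast
      show "generating_set (G n i) (set_pmf (Q n i))" using mg by (simp add: moderate_growth_def)
      show "(real m / real (group_diameter (G n i) (set_pmf (Q n i)))) ^ D * real (card (carrier (G n i)))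
          \<le> A * real (card (set_pow (G n i) (set_pmf (Q n i)) m))"
        if "1 \<le> m" "m \<le> group_diameter (G n i) (set_pmf (Q n i))" for m
        by (rule moderate_growth_power[OF finite_carrier is_group A_pos mg D that])
    qed (use eta eta_le ni A_pos in auto)
  qed
  have q_pos: "q n > 0" if "n \<ge> 1" for n
    unfolding q_def using p_pos k_pos that by (intro sum_pos) auto
  have l_le: "l n i \<le> l n j" if n: "n \<ge> 1" and ij: "1 \<le> i" "i \<le> j" "j \<le> k n" for n i j
    using ij(2) ij(3)
  proof (induction j rule: dec_induct)
    case (step j)
    then have "l n j \<le> l n (j + 1)" using l_mono n ij(1) by auto
    then show ?case using step by simp
  qed simp
  have prod: "growing_product (k n) (G n) (Q n) (J n) (\<lambda>_. 0) (\<phi> n) (\<beta> n) (r n) A \<eta> D C (l n)"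
    if n: "n \<ge> 1" for n
    unfolding growing_product_def growing_product_axioms_def product_walk_def
  proof (intro conjI allI impI)
    fix i assume i: "i \<in> {1..k n}"
    show "spectral_walk (G n i) (Q n i) (J n i) 0 (\<phi> n i) (\<beta> n i)"
      unfolding \<phi>_def \<beta>_def by (rule F[OF n i])
    show "growing_walk (G n i) (Q n i) (J n i) 0 (\<phi> n i) (\<beta> n i) A \<eta> D" by (rule walk[OF n i])
    show r_pos: "0 < r n i" using p_pos q_pos n i by (simp add: r_def)
    then show "0 \<le> r n i" by simp
    show "0 < l n i" using l_pos n i by blast
    show "l n 1 \<le> l n i" using l_le[OF n, of 1 i] i by simp
    show "l n i / C \<le> r n i / (real (group_diameter (G n i) (set_pmf (Q n i))))\<^sup>2"
      "r n i / (real (group_diameter (G n i) (set_pmf (Q n i))))\<^sup>2 \<le> C * l n i"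
      using l_approx n i by (auto simp: r_def \<rho>_def E_def)
  next
    show "sum (r n) {1..k n} = 1"
      using q_pos[OF n] by (simp add: r_def sum_divide_distrib[symmetric] q_def)
  qed (use k_pos C_gt_1 eta n in auto)
  define active where "active = (\<lambda>n i. card (carrier (G n i)) > 1)"
  define chi2 where "chi2 = (\<lambda>n. product_walk.chi2 (J n) (\<lambda>_. 0) (\<beta> n) (r n))"
  define M where "M = trace_const A \<eta> D"
  define \<Gamma> where "\<Gamma> = 2 * gap_const A D * C"
  define c where "c = 1 / (2 * (sqrt M + 1)\<^sup>2)"
  have dc: "dc n = tv_c (product_group {1..k n} (G n)) (product_driver {1..k n} (r n) (G n) (Q n))" for n
    by (simp add: dc_def r_def)
  have dd: "dd n = tv (product_group {1..k n} (G n)) (product_driver {1..k n} (r n) (G n) (Q n))" for n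
    by (simp add: dd_def r_def)
  have M: "0 < M"
    unfolding M_def by (rule growing_product.const_pos(3)[OF prod[of 1]]) simp
  interpret arr: cutoff_array k l active chi2 dc C M "\<eta> / C" \<Gamma> c
  proof
    show "0 < C" using C_gt_1 by simp
    then show "0 < \<eta> / C" using eta by simp
    show "0 < \<Gamma>" using C_gt_1 by (auto simp: \<Gamma>_def gap_const_def intro!: mult_pos_pos add_pos_nonneg)
    show "0 < M" by (rule M)
    then have "0 < sqrt M + 1" by (intro add_pos_pos) auto
    then show "0 < c" by (simp add: c_def)
    fix n :: nat assume n: "n \<ge> 1"
    interpret P: growing_product "k n" "G n" "Q n" "J n" "\<lambda>_. 0" "\<phi> n" "\<beta> n" "r n" A \<eta> D C "l n"
      by (rule prod[OF n])
    show "1 \<le> k n" using k_pos n by blast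
    show "l n i \<le> l n j" if "1 \<le> i" "i \<le> j" "j \<le> k n" for i j by (rule l_le[OF n that])
    show "dc n t \<le> dc n s" if "s \<le> t" for s t unfolding dc by (rule P.prod.tv_c_antimono[OF that])
    show "0 \<le> dc n t" if "0 \<le> t" for t unfolding dc by (rule P.prod.tv_c_nonneg[OF that])
    show "dc n t \<le> sqrt (exp (\<Sum>i=1..k n. chi2 n i t) - 1) / 2" if "0 \<le> t" for t
      unfolding dc chi2_def by (rule P.tv_c_product_upper)
    show "1 - dc n t \<le> exp (- (c * (\<Sum>i=1..k n. chi2 n i t)))" if "C \<le> t * l n 1" for t
      unfolding dc chi2_def c_def M_def by (rule P.tv_c_lower_l2[OF that])
    fix i assume i: "i \<in> {1..k n}"
    show "0 < l n i" using l_pos n i by blast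
    show "0 \<le> chi2 n i t" for t unfolding chi2_def by (rule P.chi2_nonneg)
    show "chi2 n i (t + s) \<le> exp (- (\<eta> / C * s * l n i)) * chi2 n i t" if "0 \<le> s" for s t
      unfolding chi2_def by (rule P.chi2_decay[OF i that])
    show "chi2 n i t \<le> M" if "C \<le> t * l n i" for t
      unfolding chi2_def M_def by (rule P.chi2_bound[OF i that])
    show "exp (- (\<Gamma> * t * l n i)) \<le> chi2 n i t" if "active n i" "0 \<le> t" for t
      unfolding chi2_def \<Gamma>_def using that by (intro P.chi2_lower[OF i]) (auto simp: active_def)
    show "exp (- (\<Gamma> * t * l n i)) / 2 \<le> dc n t" if "active n i" "0 \<le> t" for t
      unfolding dc \<Gamma>_def using that by (intro P.tv_c_lower_coordinate[OF i]) (auto simp: active_def)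
  qed
  have tmax: "arr.tmax = t" by (rule ext) (simp add: arr.tmax_def t_def)
  have active_if: "active n i" if "n \<ge> 1" "i \<in> {1..k n}" "\<rho> n i \<ge> 4" for n i
    using growing_walk.nontrivial_if_diameter[OF walk[OF that(1,2)]] that(3)
    by (simp add: active_def \<rho>_def E_def)
  have act1: "\<forall>\<^sub>F n in sequentially. active n 1"
    using rho_1 eventually_ge_at_top[of 1]
  proof eventually_elim
    case (elim n)
    then show ?case using k_pos by (intro active_if) auto
  qed
  have act: "\<exists>m0. \<forall>n\<ge>1. \<forall>i\<in>{1..k n}. m0 \<le> i \<longrightarrow> active n i"
    if ev: "\<forall>\<^sub>F m in sequentially. \<forall>n\<ge>1. \<forall>i\<in>{1..k n}. i \<ge> m \<longrightarrow> \<rho> n i \<ge> 4"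
  proof -
    obtain m0 where "\<forall>n\<ge>1. \<forall>i\<in>{1..k n}. i \<ge> m0 \<longrightarrow> \<rho> n i \<ge> 4"
      using ev unfolding eventually_sequentially by blast
    then show ?thesis using active_if by (intro exI[of _ m0]) blast
  qed
  show ?thesis
  proof (intro conjI[of "_ \<longrightarrow> _"] impI, goal_cases)
    case 1
    then obtain c0 where "\<forall>\<^sub>F n in sequentially. norm (real (k n)) \<le> c0 * norm (1::real)"
      by (elim landau_o.bigE)
    then obtain n0 where n0: "\<And>n. n \<ge> n0 \<Longrightarrow> real (k n) \<le> c0"
      unfolding eventually_sequentially by auto
    have "real (k n) \<le> \<bar>c0\<bar> + (\<Sum>n<n0. real (k n))" for n
    proof (cases "n \<ge> n0")
      case True
      then show ?thesis using n0[OF True] sum_nonneg[of "{..<n0}" "\<lambda>n. real (k n)"] by simp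
    next
      case False
      then have "real (k n) \<le> (\<Sum>n<n0. real (k n))" by (intro member_le_sum) auto
      then show ?thesis by simp
    qed
    from arr.bounded_number_of_factors[OF act1 this]
    show ?case
      unfolding tmax active_def by (rule conjI)
  next
    case 2
    then obtain m0 where "\<forall>n\<ge>1. \<forall>i\<in>{1..k n}. m0 \<le> i \<longrightarrow> active n i" using act by blast
    from arr.continuous_cutoff_equivalences[OF act1 this]
    show ?case
      unfolding tmax cutoff_criteria_def .
  next
    case asm: 3
    then obtain m0 where m0: "\<forall>n\<ge>1. \<forall>i\<in>{1..k n}. m0 \<le> i \<longrightarrow> active n i" using act by blast
    interpret darr: discrete_cutoff_array k l active chi2 dc C M "\<eta> / C" \<Gamma> c dd "(A / \<eta> + real D) * C" "4 * \<eta>"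
    proof
      show "0 < (A / \<eta> + real D) * C" using A_pos eta C_gt_1 by (intro mult_pos_pos add_pos_nonneg) auto
      show "0 < 4 * \<eta>" using eta by simp
      fix n :: nat assume n: "n \<ge> 1"
      interpret P: growing_product "k n" "G n" "Q n" "J n" "\<lambda>_. 0" "\<phi> n" "\<beta> n" "r n" A \<eta> D C "l n"
        by (rule prod[OF n])
      show "real (k n) * l n 1 \<le> C" by (rule P.sum_l_le)
      fix m
      show "dd n m \<le> sqrt (exp (\<Sum>i=1..k n. chi2 n i (real m)) - 1 +
          exp ((A / \<eta> + real D) * C / l n 1 - 4 * \<eta> * real m)) / 2"
        unfolding dd chi2_def using asm n by (intro P.tv_upper_lazy) (auto simp: E_def)
      show "(1 - \<Gamma> * l n 1) ^ m / 2 \<le> dd n m" if "active n 1" "\<Gamma> * l n 1 \<le> 1 / 2"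
        using that unfolding dd \<Gamma>_def active_def by (rule P.tv_lower_coordinate)
      show "dc n t \<le> dd n m + (\<Sum>j<m. exp (- t) * t ^ j / fact j)" if "0 \<le> t" for t
        unfolding dc dd by (rule P.prod.tv_c_le_tv[OF that])
      show "dd n m' \<le> dd n m" if "m \<le> m'" for m' unfolding dd by (rule P.prod.tv_antimono[OF that])
      show "0 \<le> dd n m" unfolding dd by (rule P.prod.tv_bounds)
    qed
    from asm have "filterlim k at_top sequentially" by blast
    from darr.discrete_cutoff_equivalences[OF this act1 m0]
    show ?case
      unfolding tmax cutoff_criteria_def .
  qed
qed

end
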